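(* Let $(y^1,y^1_r,y^1_l)$ and $(y^2,y^2_r,y^2_l)$ be two weak solutions (on $[0,T]$) of the Camassa-Holm equation with the same boundary conditions $(v_l,v_r,y_r^c,y_l^c)$ and with initial conditions $y_0^1$ and $y_0^2$ respectively, and let $v^1,v^2$ be the associated velocities and $\tilde v:=v^1-v^2$. Assume that $v_l,v_r\in H^1(0,T)$. Then there exists $C>0$ such that for any $0\le T_0<T_1\le T$, if neither $v_l$ nor $v_r$ changes sign on the interval $[T_0,T_1]$, then $$\Vert (v^1-v^2)(T_1,\cdot)\Vert_{H^1(0,1)}^2\le\Big(\Vert (v^1-v^2)(T_0,\cdot)\Vert_{H^1(0,1)}^2+|\partial_x\tilde v(T_0,0)|^2+|\partial_x\tilde v(T_0,1)|^2\Big)\exp(C(T_1-T_0)).$$ In particular, if $y_0^1=y_0^2$, then $(y^1,y_r^1,y_l^1)=(y^2,y_r^2,y_l^2)$ on the interval $[0,T]$.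
   Context: Fix $T>0$, $\kappa\in\mathbb R$, and $\Omega_T:=[0,T]\times(0,1)$. The functions $v_l,v_r\in C^0([0,T])$ are real-valued and each is non-zero except on a finite set. Put $\Gamma_l:=\{t\in[0,T]: v_l(t)>0\}$ and $\Gamma_r:=\{t\in[0,T]: v_r(t)<0\}$. The data are $y_0\in L^\infty(0,1)$, $y_l^c\in L^\infty(\Gamma_l)$, $y_r^c\in L^\infty(\Gamma_r)$. Velocity associated with $y$: for $y\in C^0([0,T],L^2(0,1))$, the velocity $v$ is, for each $t$, the unique $v(t,\cdot)\in H^2(0,1)$ with $(1-\partial_x^2)v(t,\cdot)=y(t,\cdot)-\kappa$ on $(0,1)$, $v(t,0)=v_l(t)$, $v(t,1)=v_r(t)$. Weak solution: a triple $(y,y_r,y_l)\in \big(L^\infty(\Omega_T)\cap C^0([0,T],L^2(0,1))\big)\times L^\infty([0,T])\times L^\infty([0,T])$ is a weak solution of the Camassa-Holm equation with initial and boundary conditions $(y_0,v_l,v_r,y_r^c,y_l^c)$ if $y_{|t=0}=y_0$, $(y_r)_{|\Gamma_r}=y_r^c$, $(y_l)_{|\Gamma_l}=y_l^c$, and for all $0\le t_0\le t_1<T$ and all $\phi\in H^1([t_0,t_1]\times[0,1])$, $$\int_{t_0}^{t_1}\!\!\int_0^1\big(y\,\partial_t\phi+yv\,\partial_x\phi-y\,\partial_xv\,\phi\big)=\int_{t_0}^{t_1}\big(y_rv_r\phi(\cdot,1)-y_lv_l\phi(\cdot,0)\big)+\int_0^1\phi(t_1,\cdot)y(t_1,\cdot)-\int_0^1\phi(t_0,\cdot)y(t_0,\cdot),$$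 where $v$ is the velocity associated with $y$. $\Vert f\Vert_{H^1(0,1)}^2=\Vert f\Vert_{L^2}^2+\Vert\partial_xf\Vert_{L^2}^2$. *)

theory Defs
  imports "HOL-Analysis.Analysis"
begin

section \<open>Lebesgue and Sobolev spaces on subsets of a Euclidean space\<close>

text \<open>
  Elements of Lebesgue and Sobolev spaces are given by representatives, so equality of such
  elements is equality almost everywhere.
\<close>

definition Linf :: "'a::euclidean_space set \<Rightarrow> ('a \<Rightarrow> real) \<Rightarrow> bool" where
  "Linf S f \<longleftrightarrow> f \<in> borel_measurable (lebesgue_on S) \<and>
     (\<exists>M. AE x in lebesgue_on S. \<bar>f x\<bar> \<le> M)"

definition L2 :: "'a::euclidean_space set \<Rightarrow> ('a \<Rightarrow> real) \<Rightarrow> bool" where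
  "L2 S f \<longleftrightarrow> f \<in> borel_measurable (lebesgue_on S) \<and>
     integrable (lebesgue_on S) (\<lambda>x. (f x)\<^sup>2)"

definition L2_norm :: "'a::euclidean_space set \<Rightarrow> ('a \<Rightarrow> real) \<Rightarrow> real" where
  "L2_norm S f = sqrt (\<integral>x. (f x)\<^sup>2 \<partial>lebesgue_on S)"

definition C1_on :: "'a::euclidean_space set \<Rightarrow> ('a \<Rightarrow> real) \<Rightarrow> ('a \<Rightarrow> 'a \<Rightarrow>\<^sub>L real) \<Rightarrow> bool" where
  "C1_on S f f' \<longleftrightarrow> continuous_on S f' \<and>
     (\<forall>x\<in>S. (f has_derivative blinfun_apply (f' x)) (at x within S))"

definition test_function :: "'a::euclidean_space set \<Rightarrow> ('a \<Rightarrow> real) \<Rightarrow> ('a \<Rightarrow> 'a \<Rightarrow>\<^sub>L real) \<Rightarrow> bool" where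
  "test_function \<Omega> \<phi> \<phi>' \<longleftrightarrow> C1_on UNIV \<phi> \<phi>' \<and>
     (\<exists>K. compact K \<and> K \<subseteq> \<Omega> \<and> (\<forall>x. x \<notin> K \<longrightarrow> \<phi> x = 0))"

text \<open>
  \<open>g\<close> is the weak derivative of \<open>f\<close> in direction \<open>b\<close> on the open set \<open>\<Omega>\<close>, both functions being
  locally integrable.  The test functions are those of class \<open>C\<^sup>1\<close> with compact support in \<open>\<Omega>\<close>, as
  in Brezis' textbook; by mollification, smooth ones give the same notion.
\<close>

definition has_weak_deriv ::
    "'a::euclidean_space set \<Rightarrow> 'a \<Rightarrow> ('a \<Rightarrow> real) \<Rightarrow> ('a \<Rightarrow> real) \<Rightarrow> bool" where
  "has_weak_deriv \<Omega> b f g \<longleftrightarrow>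
     (\<forall>K. compact K \<and> K \<subseteq> \<Omega> \<longrightarrow> f absolutely_integrable_on K \<and> g absolutely_integrable_on K) \<and>
     (\<forall>\<phi> \<phi>'. test_function \<Omega> \<phi> \<phi>' \<longrightarrow>
        (\<integral>x. f x * blinfun_apply (\<phi>' x) b \<partial>lebesgue_on \<Omega>) = - (\<integral>x. g x * \<phi> x \<partial>lebesgue_on \<Omega>))"

definition weak_deriv :: "'a::euclidean_space set \<Rightarrow> 'a \<Rightarrow> ('a \<Rightarrow> real) \<Rightarrow> 'a \<Rightarrow> real" where
  "weak_deriv \<Omega> b f = (SOME g. has_weak_deriv \<Omega> b f g)"

definition sobolev_H1 :: "'a::euclidean_space set \<Rightarrow> ('a \<Rightarrow> real) \<Rightarrow> bool" where
  "sobolev_H1 \<Omega> f \<longleftrightarrow> L2 \<Omega> f \<and> (\<forall>b\<in>Basis. \<exists>g. L2 \<Omega> g \<and> has_weak_deriv \<Omega> b f g)"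

definition sobolev_H2 :: "'a::euclidean_space set \<Rightarrow> ('a \<Rightarrow> real) \<Rightarrow> bool" where
  "sobolev_H2 \<Omega> f \<longleftrightarrow> L2 \<Omega> f \<and> (\<forall>b\<in>Basis. \<exists>g. sobolev_H1 \<Omega> g \<and> has_weak_deriv \<Omega> b f g)"

definition H1_norm :: "'a::euclidean_space set \<Rightarrow> ('a \<Rightarrow> real) \<Rightarrow> real" where
  "H1_norm \<Omega> f = sqrt ((L2_norm \<Omega> f)\<^sup>2 + (\<Sum>b\<in>Basis. (L2_norm \<Omega> (weak_deriv \<Omega> b f))\<^sup>2))"


section \<open>Test functions on a space-time rectangle and their traces\<close>

text \<open>Points are pairs \<open>(t, x)\<close>: direction \<open>(1, 0)\<close> is time and \<open>(0, 1)\<close> is space.\<close>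

definition rect :: "real \<Rightarrow> real \<Rightarrow> (real \<times> real) set" where
  "rect t0 t1 = {t0<..<t1} \<times> {0<..<1}"

definition L2_sides :: "real \<Rightarrow> real \<Rightarrow> (real \<times> real \<Rightarrow> real) \<Rightarrow> bool" where
  "L2_sides t0 t1 g \<longleftrightarrow>
     L2 {t0..t1} (\<lambda>t. g (t, 0)) \<and> L2 {t0..t1} (\<lambda>t. g (t, 1)) \<and>
     L2 {0..1} (\<lambda>x. g (t0, x)) \<and> L2 {0..1} (\<lambda>x. g (t1, x))"

definition L2_norm_sides :: "real \<Rightarrow> real \<Rightarrow> (real \<times> real \<Rightarrow> real) \<Rightarrow> real" where
  "L2_norm_sides t0 t1 g = 
     L2_norm {t0..t1} (\<lambda>t. g (t, 0)) + L2_norm {t0..t1} (\<lambda>t. g (t, 1)) +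
     L2_norm {0..1} (\<lambda>x. g (t0, x)) + L2_norm {0..1} (\<lambda>x. g (t1, x))"

text \<open>
  \<open>H1_rect t0 t1 \<phi> \<phi>t \<phi>x \<gamma>\<close>: the function \<open>\<phi>\<close> is in \<open>H\<^sup>1\<close> of the rectangle, with weak partial
  derivatives \<open>\<phi>t\<close> and \<open>\<phi>x\<close>, and \<open>\<gamma>\<close> is its boundary trace.  The trace operator is the continuous
  extension to \<open>H\<^sup>1\<close> of the restriction to the boundary of functions of class \<open>C\<^sup>1\<close> on the closed
  rectangle.  Only the values of \<open>\<gamma>\<close> on the four sides matter.  A single approximating sequence
  serves all sides, so that for \<open>t0 = t1\<close>, where the rectangle is a null set, the two traces in
  time coincide.
\<close>

definition H1_rect :: "real \<Rightarrow> real \<Rightarrow> (real \<times> real \<Rightarrow> real) \<Rightarrow> (real \<times> real \<Rightarrow> real) \<Rightarrow>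
    (real \<times> real \<Rightarrow> real) \<Rightarrow> (real \<times> real \<Rightarrow> real) \<Rightarrow> bool" where
  "H1_rect t0 t1 \<phi> \<phi>t \<phi>x \<gamma> \<longleftrightarrow>
     L2 (rect t0 t1) \<phi> \<and> L2 (rect t0 t1) \<phi>t \<and> L2 (rect t0 t1) \<phi>x \<and>
     has_weak_deriv (rect t0 t1) (1, 0) \<phi> \<phi>t \<and> has_weak_deriv (rect t0 t1) (0, 1) \<phi> \<phi>x \<and>
     L2_sides t0 t1 \<gamma> \<and>
     (\<exists>\<psi> \<psi>'. (\<forall>n::nat. C1_on ({t0..t1} \<times> {0..1}) (\<psi> n) (\<psi>' n)) \<and>
        (\<lambda>n. L2_norm (rect t0 t1) (\<lambda>p. \<psi> n p - \<phi> p)) \<longlonglongrightarrow> 0 \<and>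
        (\<lambda>n. L2_norm (rect t0 t1) (\<lambda>p. blinfun_apply (\<psi>' n p) (1, 0) - \<phi>t p)) \<longlonglongrightarrow> 0 \<and>
        (\<lambda>n. L2_norm (rect t0 t1) (\<lambda>p. blinfun_apply (\<psi>' n p) (0, 1) - \<phi>x p)) \<longlonglongrightarrow> 0 \<and>
        (\<lambda>n. L2_norm_sides t0 t1 (\<lambda>p. \<psi> n p - \<gamma> p)) \<longlonglongrightarrow> 0)"


section \<open>Weak solutions of the Camassa-Holm equation on an interval\<close>

text \<open>
  The first argument of \<open>y\<close> is time.  Every element of \<open>L\<^sup>\<infinity>(\<Omega>\<^sub>T) \<inter> C\<^sup>0([0,T], L\<^sup>2(0,1))\<close> has a
  representative that is jointly measurable and whose time slices are the values of the continuous
  curve for \<^emph>\<open>every\<close> \<open>t\<close>; the functions \<open>y\<close> below are representatives of this kind.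
\<close>

definition C0_L2 :: "real \<Rightarrow> (real \<Rightarrow> real \<Rightarrow> real) \<Rightarrow> bool" where
  "C0_L2 T y \<longleftrightarrow> (\<forall>t\<in>{0..T}. L2 {0<..<1} (y t) \<and>
     ((\<lambda>s. L2_norm {0<..<1} (\<lambda>x. y s x - y t x)) \<longlongrightarrow> 0) (at t within {0..T}))"

definition Gamma_l :: "real \<Rightarrow> (real \<Rightarrow> real) \<Rightarrow> real set" where
  "Gamma_l T vl = {t \<in> {0..T}. vl t > 0}"

definition Gamma_r :: "real \<Rightarrow> (real \<Rightarrow> real) \<Rightarrow> real set" where
  "Gamma_r T vr = {t \<in> {0..T}. vr t < 0}"

text \<open>
  Each slice \<open>v t\<close> is the representative of its class that is continuous on \<open>[0,1]\<close>, which gives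
  meaning to the boundary conditions and determines \<open>v t\<close> on \<open>[0,1]\<close>.
\<close>

definition is_velocity :: "real \<Rightarrow> real \<Rightarrow> (real \<Rightarrow> real) \<Rightarrow> (real \<Rightarrow> real) \<Rightarrow>
    (real \<Rightarrow> real \<Rightarrow> real) \<Rightarrow> (real \<Rightarrow> real \<Rightarrow> real) \<Rightarrow> bool" where
  "is_velocity T \<kappa> vl vr y v \<longleftrightarrow> (\<forall>t\<in>{0..T}.
     sobolev_H2 {0<..<1} (v t) \<and> continuous_on {0..1} (v t) \<and>
     (\<exists>p q. has_weak_deriv {0<..<1} 1 (v t) p \<and> has_weak_deriv {0<..<1} 1 p q \<and>
        (AE x in lebesgue_on {0<..<1}. v t x - q x = y t x - \<kappa>)) \<and>
     v t 0 = vl t \<and> v t 1 = vr t)"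

text \<open>
  A continuous representative of an \<open>H\<^sup>2(0,1)\<close> function is of class \<open>C\<^sup>1\<close> on \<open>[0,1]\<close>; at the
  endpoints its derivative is the one-sided one.
\<close>

definition dx :: "(real \<Rightarrow> real \<Rightarrow> real) \<Rightarrow> real \<Rightarrow> real \<Rightarrow> real" where
  "dx v t x = vector_derivative (v t) (at x within {0..1})"

definition weak_solution :: "real \<Rightarrow> real \<Rightarrow> (real \<Rightarrow> real) \<Rightarrow> (real \<Rightarrow> real) \<Rightarrow> (real \<Rightarrow> real) \<Rightarrow>
    (real \<Rightarrow> real) \<Rightarrow> (real \<Rightarrow> real) \<Rightarrow>
    (real \<Rightarrow> real \<Rightarrow> real) \<Rightarrow> (real \<Rightarrow> real) \<Rightarrow> (real \<Rightarrow> real) \<Rightarrow> bool" where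
  "weak_solution T \<kappa> y0 vl vr yrc ylc y yr yl \<longleftrightarrow>
     Linf ({0..T} \<times> {0<..<1}) (\<lambda>(t, x). y t x) \<and> C0_L2 T y \<and>
     Linf {0..T} yr \<and> Linf {0..T} yl \<and>
     (AE x in lebesgue_on {0<..<1}. y 0 x = y0 x) \<and>
     (AE t in lebesgue_on (Gamma_r T vr). yr t = yrc t) \<and>
     (AE t in lebesgue_on (Gamma_l T vl). yl t = ylc t) \<and>
     (\<exists>v. is_velocity T \<kappa> vl vr y v \<and>
       (\<forall>t0 t1 \<phi> \<phi>t \<phi>x \<gamma>. 0 \<le> t0 \<and> t0 \<le> t1 \<and> t1 < T \<and> H1_rect t0 t1 \<phi> \<phi>t \<phi>x \<gamma> \<longrightarrow>
         (\<integral>(t, x). y t x * \<phi>t (t, x) + y t x * v t x * \<phi>x (t, x) - y t x * dx v t x * \<phi> (t, x)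
             \<partial>lebesgue_on (rect t0 t1)) =
         (\<integral>t. yr t * vr t * \<gamma> (t, 1) - yl t * vl t * \<gamma> (t, 0) \<partial>lebesgue_on {t0..t1})
         + (\<integral>x. \<gamma> (t1, x) * y t1 x \<partial>lebesgue_on {0<..<1})
         - (\<integral>x. \<gamma> (t0, x) * y t0 x \<partial>lebesgue_on {0<..<1})))"

definition no_sign_change_on :: "real set \<Rightarrow> (real \<Rightarrow> real) \<Rightarrow> bool" where
  "no_sign_change_on S f \<longleftrightarrow> (\<forall>t\<in>S. 0 \<le> f t) \<or> (\<forall>t\<in>S. f t \<le> 0)"

end

theory Submission
  imports Defs
begin

text \<open>
  Put \<open>u = v\<^sup>1 - v\<^sup>2\<close>, which vanishes at both ends, and \<open>g = y\<^sup>1 - y\<^sup>2 = u - \<partial>\<^sub>x\<^sup>2 u\<close>.  The energy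
  \<open>E = \<parallel>u\<parallel>\<^sup>2\<close> in \<open>H\<^sup>1\<close> is the pairing of \<open>g\<close> with \<open>u\<close>, so testing the difference of the two weak
  formulations with \<open>u\<close> and integrating by parts gives
  \<open>E' \<le> C E + v\<^sub>l (\<partial>\<^sub>x u(t,0))\<^sup>2 - v\<^sub>r (\<partial>\<^sub>x u(t,1))\<^sup>2\<close>.  The boundary terms are harmless at outflow ends.
  At an inflow end the trace of \<open>\<partial>\<^sub>x u\<close> is the pairing of \<open>g\<close> with a solution of \<open>\<phi>'' = \<phi>\<close> that vanishes
  at the other end; as the inflow data agree, its time derivative is bounded by \<open>E\<close> and the two
  traces.  Gronwall's inequality for \<open>E\<close> plus the squares of the inflow traces gives the estimate.
  Uniqueness follows by advancing through the finitely many sign changes of \<open>v\<^sub>l\<close> and \<open>v\<^sub>r\<close>.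
\<close>

text \<open>The obstacle to testing with \<open>u\<close> is time regularity: \<open>y\<close> is
  only continuous into L2, so \<open>u\<close> is not known in advance to be differentiable in time.
  The weak form is therefore used only with functions of space alone, and \<open>E\<close> is
  differentiated through its difference quotients. All integrands in time are continuous, so the
  derivatives exist at every interior time. The energy alone does not close. Integration by parts
  removes every derivative of \<open>p = dx u\<close> but leaves the squares of its end values,
  which the H1 norm of \<open>u\<close> does not control; hence the traces in the estimate. The
  equation for a trace is free of unknown boundary data at an inflow end, where the data are
  prescribed. It contains the other trace, multiplied by the velocity at the other end.
  \<open>C\<close> depends only on sup bounds of \<open>v2\<close> and \<open>dx v2\<close> and on
  L2 bounds of \<open>y1\<close> and \<open>y2 - \<kappa>\<close> over all of \<open>[0, T]\<close>,
  hence not on the subinterval. The weak form is available only for \<open>t1 < T\<close>; time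
  \<open>T\<close> itself is reached by continuity.\<close>

section \<open>Lebesgue integrals on the line\<close>

text \<open>A signed density that integrates to zero over intervals integrates to zero over all
  Borel sets, by induction on their generation, and so vanishes almost everywhere. The induction
  concerns Borel sets, so \<open>f\<close>, extended by zero, is first replaced by a Borel
  representative \<open>h'\<close>.\<close>

lemma negligible_if_integrals_zero:
  fixes f :: "real \<Rightarrow> real"
  assumes f: "f absolutely_integrable_on {a..b}"
    and z: "\<And>c d. a \<le> c \<Longrightarrow> c \<le> d \<Longrightarrow> d \<le> b \<Longrightarrow> integral {c..d} f = 0"
  shows "negligible {x \<in> {a..b}. f x \<noteq> 0}"
proof -
  define h where "h = (\<lambda>x. indicator {a..b} x * f x)"
  have hl: "integrable lebesgue h"
    using f by (simp add: set_integrable_def h_def)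
  then obtain h' where h': "h' \<in> borel_measurable lborel" "AE x in lborel. h x = h' x"
    using completion_ex_borel_measurable_real[of h lborel] by auto
  have ae: "AE x in lebesgue. h x = h' x"
    using h'(2) by (rule AE_completion)
  have h'l: "integrable lebesgue h'"
    by (rule integrable_cong_AE_imp[OF hl]) (use ae h' in \<open>auto intro: measurable_completion simp: eq_commute\<close>)
  then have h'b: "integrable lborel h'"
    using h'(1) by (simp add: integrable_completion)
  have Icc: "(LINT x:{c..d}|lborel. h' x) = 0" for c d
  proof (cases "max a c \<le> min b d")
    case False
    have "(LINT x:{c..d}|lborel. h' x) = (LINT x:{c..d}|lebesgue. h' x)"
      unfolding set_lebesgue_integral_def using h'(1) by (subst integral_completion) auto
    also have "\<dots> = (LINT x:{c..d}|lebesgue. h x)"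
      by (rule set_lebesgue_integral_cong_AE) (use ae h' hl in \<open>auto intro: measurable_completion borel_measurable_integrable\<close>)
    also have "\<dots> = 0"
      unfolding set_lebesgue_integral_def h_def
      by (rule integral_eq_zero_AE, rule AE_I2) (use False in \<open>auto simp: indicator_def\<close>)
    finally show ?thesis .
  next
    case True
    have "(LINT x:{c..d}|lborel. h' x) = (LINT x:{c..d}|lebesgue. h' x)"
      unfolding set_lebesgue_integral_def using h'(1) by (subst integral_completion) auto
    also have "\<dots> = (LINT x:{c..d}|lebesgue. h x)"
      by (rule set_lebesgue_integral_cong_AE) (use ae h' hl in \<open>auto intro: measurable_completion borel_measurable_integrable\<close>)
    also have "\<dots> = (LINT x:{max a c..min b d}|lebesgue. f x)"
      unfolding set_lebesgue_integral_def h_def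
      by (rule Bochner_Integration.integral_cong) (auto simp: indicator_def)
    also have "\<dots> = integral {max a c..min b d} f"
      by (rule set_lebesgue_integral_eq_integral)
        (rule absolutely_integrable_on_subinterval[OF f], auto)
    also have "\<dots> = 0" using True by (intro z) auto
    finally show ?thesis .
  qed
  have UN: "(LINT x:A|lborel. h' x) = 0" if "A \<in> sets lborel" for A
  proof -
    have "A \<in> sets borel" using that by simp
    then show ?thesis
    proof (induction rule: borel_set_induct)
      case empty then show ?case by (simp add: set_lebesgue_integral_def)
    next
      case (interval c d) then show ?case using Icc by simp
    next
      \<comment> \<open>The integral over the whole line is the limit of those over
        \<open>{- n..n}\<close>, hence zero, and it splits into \<open>A\<close> and its
        complement.\<close>
      case (compl A)
      have "(\<lambda>n. LINT x:{- real n..real n}|lborel. h' x) \<longlonglongrightarrow> (LINT x|lborel. h' x)"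
        unfolding set_lebesgue_integral_def
      proof (rule integral_dominated_convergence[where w="\<lambda>x. \<bar>h' x\<bar>"])
        show "AE x in lborel. (\<lambda>i. indicat_real {- real i..real i} x *\<^sub>R h' x) \<longlonglongrightarrow> h' x"
        proof (rule AE_I2)
          fix x :: real
          obtain N :: nat where N: "\<bar>x\<bar> \<le> real N" using real_arch_simple by blast
          have "\<forall>\<^sub>F i in sequentially. indicat_real {- real i..real i} x *\<^sub>R h' x = h' x"
            using eventually_ge_at_top[of N] by eventually_elim (use N in \<open>auto simp: indicator_def\<close>)
          then show "(\<lambda>i. indicat_real {- real i..real i} x *\<^sub>R h' x) \<longlonglongrightarrow> h' x"
            by (rule tendsto_eventually)
        qed
      qed (use h' h'b in \<open>auto simp: indicator_def\<close>)
      then have "(\<lambda>n. 0) \<longlonglongrightarrow> (LINT x|lborel. h' x)" using Icc by simp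
      then have "(LINT x|lborel. h' x) = 0" using LIMSEQ_unique tendsto_const by metis
      moreover have "(LINT x|lborel. h' x) = (LINT x:A|lborel. h' x) + (LINT x:-A|lborel. h' x)"
      proof -
        have "(LINT x:A \<union> -A|lborel. h' x) = (LINT x:A|lborel. h' x) + (LINT x:-A|lborel. h' x)"
          by (rule set_integral_Un) (use compl h'b in \<open>auto simp: set_integrable_def intro!: integrable_mult_indicator[where 'b=real, simplified]\<close>)
        then show ?thesis by (simp add: set_lebesgue_integral_def)
      qed
      ultimately show ?case using compl.IH by simp
    next
      case (union F)
      have "(LINT x:(\<Union>i. F i)|lborel. h' x) = (\<Sum>i. LINT x:F i|lborel. h' x)"
        by (rule lebesgue_integral_countable_add)
          (use union h'b in \<open>auto simp: set_integrable_def disjoint_family_on_def intro!: integrable_mult_indicator[where 'b=real, simplified]\<close>)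
      then show ?case using union.IH by simp
    qed
  qed
  have "AE x in lborel. h' x = 0" by (rule sigma_finite_measure.density_zero[OF lborel.sigma_finite_measure_axioms h'b]) (rule UN)
  then have "AE x in lebesgue. h' x = 0" by (rule AE_completion)
  with ae have "AE x in lebesgue. h x = 0" by eventually_elim simp
  then have "AE x in lebesgue. x \<notin> {x \<in> {a..b}. f x \<noteq> 0}"
    by eventually_elim (auto simp: h_def)
  then show ?thesis
    by (simp add: negligible_iff_null_sets completion.null_sets_iff_AE)
qed

text \<open>Fubini for \<open>f s * g t\<close>, with the plane cut along the diagonal. This is
  integration by parts before any primitive is named, for factors that are merely
  integrable.\<close>

lemma integral_mult_eq_iterated:
  fixes f g :: "real \<Rightarrow> real"
  assumes f: "integrable lborel f" and g: "integrable lborel g"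
  shows "(LINT s|lborel. f s) * (LINT t|lborel. g t) =
      (LINT t|lborel. (LINT s|lborel. indicator {..t} s * f s) * g t)
    + (LINT s|lborel. f s * (LINT t|lborel. indicator {..s} t * g t))"
proof -
  have [measurable]: "f \<in> borel_measurable borel" "g \<in> borel_measurable borel"
    using f g by auto
  define h where "h = (\<lambda>(s,t). f s * g t)"
  have hI: "integrable (lborel \<Otimes>\<^sub>M lborel) h"
  proof (rule lborel_pair.Fubini_integrable)
    show "h \<in> borel_measurable (lborel \<Otimes>\<^sub>M lborel)" unfolding h_def by measurable
    show "integrable lborel (\<lambda>x. LINT y|lborel. norm (h (x, y)))"
      unfolding h_def using f by (simp add: abs_mult)
    show "AE x in lborel. integrable lborel (\<lambda>y. h (x, y))"
      unfolding h_def using g by simp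
  qed
  define A where "A = {p::real\<times>real. fst p \<le> snd p}"
  have A[measurable]: "A \<in> sets (lborel \<Otimes>\<^sub>M lborel)" 
  proof -
    have "closed A" unfolding A_def by (intro closed_Collect_le continuous_intros)
    then show ?thesis by (simp only: lborel_prod sets_lborel borel_closed)
  qed
  have h1: "integrable (lborel \<Otimes>\<^sub>M lborel) (\<lambda>p. indicator A p * h p)"
    using integrable_mult_indicator[OF A hI] by simp
  have h2: "integrable (lborel \<Otimes>\<^sub>M lborel) (\<lambda>p. indicator (-A) p * h p)"
    by (rule Bochner_Integration.integrable_cong[THEN iffD1, OF refl _ Bochner_Integration.integrable_diff[OF hI h1]])
      (auto simp: indicator_def)
  have "(LINT s|lborel. f s) * (LINT t|lborel. g t) = (LINT s|lborel. LINT t|lborel. h (s,t))"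
    by (simp add: h_def)
  also have "\<dots> = integral\<^sup>L (lborel \<Otimes>\<^sub>M lborel) h"
    using lborel_pair.integral_fst'[OF hI] .
  also have "\<dots> = (\<integral>p. indicator A p * h p \<partial>(lborel \<Otimes>\<^sub>M lborel)) + (\<integral>p. indicator (-A) p * h p \<partial>(lborel \<Otimes>\<^sub>M lborel))"
    by (subst Bochner_Integration.integral_add[OF h1 h2, symmetric])
      (rule Bochner_Integration.integral_cong, auto simp: indicator_def)
  also have "(\<integral>p. indicator A p * h p \<partial>(lborel \<Otimes>\<^sub>M lborel)) = (LINT t|lborel. LINT s|lborel. indicator A (s,t) * h (s,t))"
    using lborel_pair.integral_snd[of "\<lambda>s t. indicator A (s,t) * h (s,t)"] h1 by (simp add: case_prod_unfold)
  also have "\<dots> = (LINT t|lborel. (LINT s|lborel. indicator {..t} s * f s) * g t)"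
  proof (rule Bochner_Integration.integral_cong[OF refl])
    fix t :: real
    have "(LINT s|lborel. indicator A (s,t) * h (s,t)) = (LINT s|lborel. (indicator {..t} s * f s) * g t)"
      by (rule Bochner_Integration.integral_cong) (auto simp: A_def h_def indicator_def)
    then show "(LINT s|lborel. indicator A (s,t) * h (s,t)) = (LINT s|lborel. indicator {..t} s * f s) * g t"
      by simp
  qed
  also have "(\<integral>p. indicator (-A) p * h p \<partial>(lborel \<Otimes>\<^sub>M lborel)) = (LINT s|lborel. LINT t|lborel. indicator (-A) (s,t) * h (s,t))"
    using lborel_pair.integral_fst'[OF h2] by simp
  also have "\<dots> = (LINT s|lborel. f s * (LINT t|lborel. indicator {..s} t * g t))"
  proof (rule Bochner_Integration.integral_cong[OF refl])
    fix s :: real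
    \<comment> \<open>Off \<open>A\<close> the inequality \<open>t < s\<close> is strict; the point
      \<open>t = s\<close> is null, which makes the two halves symmetric.\<close>
    have "(LINT t|lborel. indicator (-A) (s,t) * h (s,t)) = (LINT t|lborel. f s * (indicator {..s} t * g t))"
    proof (rule integral_cong_AE)
      show "AE t in lborel. indicator (-A) (s,t) * h (s,t) = f s * (indicator {..s} t * g t)"
        using AE_lborel_singleton[of s] by eventually_elim (auto simp: A_def h_def indicator_def)
      show "(\<lambda>t. indicator (-A) (s,t) * h (s,t)) \<in> borel_measurable lborel"
      proof -
        have "(\<lambda>t. indicator (-A) (s,t) * h (s,t)) = (\<lambda>t. indicator {..<s} t * (f s * g t))"
          by (auto simp: A_def h_def indicator_def)
        then show ?thesis by simp
      qed
    qed simp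
    then show "(LINT t|lborel. indicator (-A) (s,t) * h (s,t)) = f s * (LINT t|lborel. indicator {..s} t * g t)"
      by simp
  qed
  finally show ?thesis .
qed

section \<open>Absolutely continuous functions on the unit interval\<close>

text \<open>\<open>prim F f\<close>: on \<open>[0,1]\<close>, \<open>F\<close> is absolutely continuous with derivative \<open>f\<close>.\<close>

definition prim :: "(real \<Rightarrow> real) \<Rightarrow> (real \<Rightarrow> real) \<Rightarrow> bool" where
  "prim F f \<longleftrightarrow> f absolutely_integrable_on {0..1} \<and>
     (\<forall>x\<in>{0..1}. F x = F 0 + integral {0..x} f)"

lemma primI:
  assumes "f absolutely_integrable_on {0..1}" "\<And>x. 0 \<le> x \<Longrightarrow> x \<le> 1 \<Longrightarrow> F x = c + integral {0..x} f"
  shows "prim F f"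
  unfolding prim_def
proof (intro conjI ballI)
  have "F 0 = c" using assms(2)[of 0] by simp
  then show "F x = F 0 + integral {0..x} f" if "x \<in> {0..1}" for x using assms(2)[of x] that by simp
qed (fact assms(1))

lemma primD: "prim F f \<Longrightarrow> 0 \<le> x \<Longrightarrow> x \<le> 1 \<Longrightarrow> F x = F 0 + integral {0..x} f"
  unfolding prim_def using atLeastAtMost_iff by blast

lemma prim_abs_integrable: "prim F f \<Longrightarrow> f absolutely_integrable_on {0..1}"
  by (simp add: prim_def)

lemma prim_abs_integrable_sub: "prim F f \<Longrightarrow> 0 \<le> a \<Longrightarrow> b \<le> 1 \<Longrightarrow> f absolutely_integrable_on {a..b}"
  by (rule absolutely_integrable_on_subinterval[where S="{0..1}"]) (auto simp: prim_def)

lemma prim_continuous: 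
  assumes "prim F f" shows "continuous_on {0..1} F"
proof -
  have "f integrable_on {0..1}" using assms set_lebesgue_integral_eq_integral(1) unfolding prim_def by blast
  then have c: "continuous_on {0..1} (\<lambda>x. F 0 + integral {0..x} f)"
    by (intro continuous_intros indefinite_integral_continuous_1)
  have "F 0 + integral {0..x} f = F x" if "x \<in> {0..1}" for x
    by (rule primD[OF assms, symmetric]) (use that in auto)
  then show ?thesis by (rule continuous_on_eq[OF c])
qed

lemma prim_diff_eq:
  assumes "prim F f" "0 \<le> a" "a \<le> b" "b \<le> 1"
  shows "F b - F a = integral {a..b} f"
proof -
  have "f integrable_on {0..b}" 
    using prim_abs_integrable_sub[OF assms(1), of 0 b] assms set_lebesgue_integral_eq_integral(1) by auto
  then have "integral {0..a} f + integral {a..b} f = integral {0..b} f"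
    using assms by (intro Henstock_Kurzweil_Integration.integral_combine) auto
  moreover have "F a = F 0 + integral {0..a} f" "F b = F 0 + integral {0..b} f"
    by (rule primD[OF assms(1)]; use assms in linarith)+
  ultimately show ?thesis by linarith
qed

lemma prim_cong:
  assumes "prim F f" "\<And>x. 0 \<le> x \<Longrightarrow> x \<le> 1 \<Longrightarrow> G x = F x" "\<And>x. 0 \<le> x \<Longrightarrow> x \<le> 1 \<Longrightarrow> g x = f x"
  shows "prim G g"
proof (rule primI[of _ _ "F 0"])
  show "g absolutely_integrable_on {0..1}"
    using prim_abs_integrable[OF assms(1)] by (rule absolutely_integrable_spike[OF _ negligible_empty]) (use assms(3) in auto)
  fix x :: real assume "0 \<le> x" "x \<le> 1"
  then have "integral {0..x} g = integral {0..x} f" by (intro integral_cong) (use assms(3) in auto)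
  then show "G x = F 0 + integral {0..x} g"
    using primD[OF assms(1) \<open>0 \<le> x\<close> \<open>x \<le> 1\<close>] assms(2)[OF \<open>0 \<le> x\<close> \<open>x \<le> 1\<close>] by linarith
qed

lemma prim_cong_AE:
  assumes "prim F f" "negligible N" "\<And>x. 0 \<le> x \<Longrightarrow> x \<le> 1 \<Longrightarrow> x \<notin> N \<Longrightarrow> g x = f x"
  shows "prim F g"
proof (rule primI[of _ _ "F 0"])
  show "g absolutely_integrable_on {0..1}"
    by (rule absolutely_integrable_spike[OF prim_abs_integrable[OF assms(1)] assms(2)]) (use assms(3) in auto)
  fix x :: real assume "0 \<le> x" "x \<le> 1"
  then have "integral {0..x} g = integral {0..x} f" by (intro integral_spike[of N]) (use assms in auto)
  then show "F x = F 0 + integral {0..x} g"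
    using primD[OF assms(1) \<open>0 \<le> x\<close> \<open>x \<le> 1\<close>] by linarith
qed

lemma prim_const: "prim (\<lambda>x. c) (\<lambda>x. 0)"
  by (rule primI[of _ _ c]) auto

lemma prim_add:
  assumes "prim F f" "prim G g" shows "prim (\<lambda>x. F x + G x) (\<lambda>x. f x + g x)"
proof (rule primI[of _ _ "F 0 + G 0"])
  show "(\<lambda>x. f x + g x) absolutely_integrable_on {0..1}" using assms unfolding prim_def by (simp add: set_integral_add)
  fix x :: real assume x: "0 \<le> x" "x \<le> 1"
  have i: "f integrable_on {0..x}" "g integrable_on {0..x}"
    using prim_abs_integrable_sub[OF assms(1), of 0 x] prim_abs_integrable_sub[OF assms(2), of 0 x] x set_lebesgue_integral_eq_integral(1) by auto
  then show "F x + G x = F 0 + G 0 + integral {0..x} (\<lambda>x. f x + g x)"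
    using primD[OF assms(1) x] primD[OF assms(2) x] Henstock_Kurzweil_Integration.integral_add[OF i] by linarith
qed

lemma prim_cmult:
  assumes "prim F f" shows "prim (\<lambda>x. c * F x) (\<lambda>x. c * f x)"
proof (rule primI[of _ _ "c * F 0"])
  show "(\<lambda>x. c * f x) absolutely_integrable_on {0..1}" using assms unfolding prim_def by simp
  fix x :: real assume x: "0 \<le> x" "x \<le> 1"
  have "c * F x = c * (F 0 + integral {0..x} f)" using primD[OF assms x] by metis
  then show "c * F x = c * F 0 + integral {0..x} (\<lambda>x. c * f x)"
    by (simp add: distrib_left)
qed

lemma prim_diff:
  assumes "prim F f" "prim G g" shows "prim (\<lambda>x. F x - G x) (\<lambda>x. f x - g x)"
  using prim_add[OF assms(1) prim_cmult[OF assms(2), of "-1"]] by simp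

lemma prim_deriv:
  assumes "\<And>x. 0 \<le> x \<Longrightarrow> x \<le> 1 \<Longrightarrow> (F has_real_derivative f x) (at x within {0..1})"
    and "continuous_on {0..1} f"
  shows "prim F f"
proof (rule primI[of _ _ "F 0"])
  show "f absolutely_integrable_on {0..1}" using assms(2) by (rule absolutely_integrable_continuous_real)
  fix x :: real assume x: "0 \<le> x" "x \<le> 1"
  have "(f has_integral F x - F 0) {0..x}"
    by (rule fundamental_theorem_of_calculus)
      (use x in \<open>auto intro!: has_vector_derivative_within_subset[OF assms(1)[unfolded has_real_derivative_iff_has_vector_derivative]]\<close>)
  then show "F x = F 0 + integral {0..x} f" by (simp add: integral_unique)
qed

lemma abs_integrable_cont_mult:
  fixes c f :: "real \<Rightarrow> real"
  assumes "continuous_on {a..b} c" "f absolutely_integrable_on {a..b}"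
  shows "(\<lambda>x. c x * f x) absolutely_integrable_on {a..b}"
proof (rule absolutely_integrable_bounded_measurable_product_real)
  show "c \<in> borel_measurable (lebesgue_on {a..b})" 
    by (rule continuous_imp_measurable_on_sets_lebesgue) (use assms in auto)
  show "bounded (c ` {a..b})" using assms(1) by (intro compact_imp_bounded compact_continuous_image) auto
qed (use assms in auto)

text \<open>Passage from the gauge integral of a Lebesgue measurable \<open>f\<close> to
  \<open>lborel\<close>, where the Fubini argument takes place; \<open>f'\<close> is a Borel
  representative of \<open>f\<close> extended by zero outside \<open>[a, b]\<close>.\<close>

lemma integral_eq_LBINT_indicator:
  assumes "f' \<in> borel_measurable lborel" "AE x in lborel. indicator {a..b} x * f x = f' x"
    "(f::real \<Rightarrow> real) absolutely_integrable_on {a..b}" "a \<le> c" "d \<le> b"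
  shows "integral {c..d} f = (LBINT x. indicator {c..d} x * f' x)"
proof -
  have ae: "AE x in lebesgue. indicator {a..b} x * f x = f' x" using assms(2) by (rule AE_completion)
  have "f absolutely_integrable_on {c..d}"
    by (rule absolutely_integrable_on_subinterval[OF assms(3)]) (use assms in auto)
  then have "integral {c..d} f = (LINT x:{c..d}|lebesgue. f x)" "integrable lebesgue (\<lambda>x. indicator {c..d} x * f x)"
    by (simp_all add: set_lebesgue_integral_eq_integral set_integrable_def)
  moreover have "(LINT x:{c..d}|lebesgue. f x) = (LINT x|lebesgue. indicator {c..d} x * f' x)"
    unfolding set_lebesgue_integral_def
  proof (rule integral_cong_AE)
    show "AE x in lebesgue. indicat_real {c..d} x *\<^sub>R f x = indicat_real {c..d} x * f' x"
      using ae by eventually_elim (use assms(4,5) in \<open>auto simp: indicator_def split: if_splits\<close>)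
  qed (use calculation assms(1) in \<open>auto intro: measurable_completion\<close>)
  moreover have "\<dots> = (LBINT x. indicator {c..d} x * f' x)"
    using assms(1) by (intro integral_completion) auto
  ultimately show ?thesis by simp
qed

text \<open>One of the two triangles of \<open>integral_mult_eq_iterated\<close> on
  \<open>[0, x]\<close>: as \<open>F 0 = 0\<close>, the inner integral over \<open>{..t}\<close> is
  \<open>F t\<close>. The other triangle is the same statement with the factors exchanged.\<close>

lemma prim_weighted_integral:
  assumes F: "prim F f" and g': "g' \<in> borel_measurable lborel" "AE x in lborel. indicator {0..1} x * g x = g' x"
    and "F 0 = 0" and x: "0 \<le> x" "x \<le> 1"
    and f': "f' \<in> borel_measurable lborel" "AE x in lborel. indicator {0..1} x * f x = f' x"
    and g: "g absolutely_integrable_on {0..1}"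
  shows "(LBINT t. (LBINT s. indicator {..t} s * (indicator {0..x} s * f' s)) * (indicator {0..x} t * g' t))
    = integral {0..x} (\<lambda>t. F t * g t)"
proof -
  have Fx: "F t = (LBINT s. indicator {0..t} s * f' s)" if "0 \<le> t" "t \<le> 1" for t
    using integral_eq_LBINT_indicator[OF f' prim_abs_integrable[OF F], of 0 t] primD[OF F that] that assms(4) by simp
  have "integral {0..x} (\<lambda>t. F t * g t) = (LBINT t. indicator {0..x} t * ((indicator {0..1} t * F t) * g' t))"
  proof (rule integral_eq_LBINT_indicator[of _ 0 1])
    show "AE t in lborel. indicator {0..1} t * (F t * g t) = (indicator {0..1} t * F t) * g' t"
      using g'(2) by eventually_elim (auto simp: indicator_def split: if_splits)
    have "(\<lambda>t. indicator {0..1} t *\<^sub>R F t) \<in> borel_measurable borel"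
      by (rule borel_measurable_continuous_on_indicator) (use prim_continuous[OF F] in auto)
    then show "(\<lambda>t. (indicator {0..1} t * F t) * g' t) \<in> borel_measurable lborel"
      using g'(1) by simp
    show "(\<lambda>t. F t * g t) absolutely_integrable_on {0..1}"
      by (intro abs_integrable_cont_mult prim_continuous[OF F] g)
  qed (use x in auto)
  also have "\<dots> = (LBINT t. (LBINT s. indicator {..t} s * (indicator {0..x} s * f' s)) * (indicator {0..x} t * g' t))"
  proof (rule Bochner_Integration.integral_cong[OF refl])
    fix t :: real
    show "indicat_real {0..x} t * ((indicator {0..1} t * F t) * g' t) =
      (LBINT s. indicator {..t} s * (indicator {0..x} s * f' s)) * (indicator {0..x} t * g' t)"
    proof (cases "t \<in> {0..x}")
      case True
      then have "(LBINT s. indicator {..t} s * (indicator {0..x} s * f' s)) = (LBINT s. indicator {0..t} s * f' s)"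
        by (intro Bochner_Integration.integral_cong) (auto simp: indicator_def)
      then show ?thesis using True x Fx[of t] by simp
    qed simp
  qed
  finally show ?thesis by simp
qed

text \<open>With \<open>F 0 = G 0 = 0\<close> the product \<open>F x * G x\<close> is a product of
  two integrals over \<open>[0, x]\<close>, so cutting the square along its diagonal yields both
  terms of the Leibniz rule.\<close>

lemma prim_mult_zero:
  assumes F: "prim F f" and G: "prim G g" and "F 0 = 0" "G 0 = 0"
  shows "prim (\<lambda>x. F x * G x) (\<lambda>x. f x * G x + F x * g x)"
proof (rule primI[of _ _ 0])
  note half = prim_weighted_integral
  have i1: "(\<lambda>x. G x * f x) absolutely_integrable_on {0..1}" and i2: "(\<lambda>x. F x * g x) absolutely_integrable_on {0..1}"
    using abs_integrable_cont_mult[OF prim_continuous[OF G] prim_abs_integrable[OF F]]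
      abs_integrable_cont_mult[OF prim_continuous[OF F] prim_abs_integrable[OF G]] by auto
  then show ai: "(\<lambda>x. f x * G x + F x * g x) absolutely_integrable_on {0..1}"
    by (simp add: mult.commute[of "f _"] set_integral_add)
  fix x :: real assume x: "0 \<le> x" "x \<le> 1"
  obtain f' where f': "f' \<in> borel_measurable lborel" "AE x in lborel. indicator {0..1} x * f x = f' x"
    using completion_ex_borel_measurable_real[of "\<lambda>x. indicator {0..1} x * f x" lborel] prim_abs_integrable[OF F]
    by (auto simp: set_integrable_def)
  obtain g' where g': "g' \<in> borel_measurable lborel" "AE x in lborel. indicator {0..1} x * g x = g' x"
    using completion_ex_borel_measurable_real[of "\<lambda>x. indicator {0..1} x * g x" lborel] prim_abs_integrable[OF G]
    by (auto simp: set_integrable_def)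
  have Fx: "F t = (LBINT s. indicator {0..t} s * f' s)" if "0 \<le> t" "t \<le> 1" for t
    using integral_eq_LBINT_indicator[OF f' prim_abs_integrable[OF F], of 0 t] primD[OF F that] that assms(3) by simp
  have Gx: "G t = (LBINT s. indicator {0..t} s * g' s)" if "0 \<le> t" "t \<le> 1" for t
    using integral_eq_LBINT_indicator[OF g' prim_abs_integrable[OF G], of 0 t] primD[OF G that] that assms(4) by simp
  define fx where "fx = (\<lambda>s. indicator {0..x} s * f' s)"
  define gx where "gx = (\<lambda>s. indicator {0..x} s * g' s)"
  have fx_ae: "AE s in lborel. fx s = indicator {0..x} s * f s"
    using f'(2) by eventually_elim (use x in \<open>auto simp: fx_def indicator_def split: if_splits\<close>)
  have gx_ae: "AE s in lborel. gx s = indicator {0..x} s * g s"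
    using g'(2) by eventually_elim (use x in \<open>auto simp: gx_def indicator_def split: if_splits\<close>)
  have int: "integrable lborel h'" if "h' \<in> borel_measurable lborel" "AE s in lborel. h' s = indicator {0..x} s * h s"
      "h absolutely_integrable_on {0..1}" for h h' :: "real \<Rightarrow> real"
  proof -
    have "h absolutely_integrable_on {0..x}" using that(3) x by (intro absolutely_integrable_on_subinterval[OF that(3)]) auto
    then have "integrable lebesgue (\<lambda>s. indicator {0..x} s * h s)" by (simp add: set_integrable_def)
    moreover have "AE s in lebesgue. indicator {0..x} s * h s = h' s"
      using AE_completion[OF that(2)] by eventually_elim simp
    moreover have "h' \<in> borel_measurable lebesgue" using that(1) by (rule measurable_completion)
    ultimately have "integrable lebesgue h'" by (intro integrable_cong_AE_imp[of lebesgue _ h'])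
    then show ?thesis using that(1) by (simp add: integrable_completion)
  qed
  have fxm: "fx \<in> borel_measurable lborel" and gxm: "gx \<in> borel_measurable lborel"
    using f' g' by (auto simp: fx_def gx_def)
  have fxi: "integrable lborel fx" by (rule int[OF fxm fx_ae prim_abs_integrable[OF F]])
  have gxi: "integrable lborel gx" by (rule int[OF gxm gx_ae prim_abs_integrable[OF G]])
  have "F x * G x = (LBINT s. fx s) * (LBINT t. gx t)"
    using Fx[OF x] Gx[OF x] by (simp add: fx_def gx_def)
  also have "\<dots> = (LBINT t. (LBINT s. indicator {..t} s * fx s) * gx t)
    + (LBINT s. fx s * (LBINT t. indicator {..s} t * gx t))"
    by (rule integral_mult_eq_iterated[OF fxi gxi])
  also have "(LBINT t. (LBINT s. indicator {..t} s * fx s) * gx t) = integral {0..x} (\<lambda>t. F t * g t)"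
    unfolding fx_def gx_def by (rule half[OF F g' \<open>F 0 = 0\<close> x f' prim_abs_integrable[OF G]])
  also have "(LBINT s. fx s * (LBINT t. indicator {..s} t * gx t)) = integral {0..x} (\<lambda>t. G t * f t)"
    using half[OF G f' \<open>G 0 = 0\<close> x g' prim_abs_integrable[OF F]] unfolding fx_def gx_def by (simp add: mult.commute)
  finally have "F x * G x = integral {0..x} (\<lambda>t. F t * g t) + integral {0..x} (\<lambda>t. G t * f t)" .
  also have "\<dots> = integral {0..x} (\<lambda>t. F t * g t + G t * f t)"
    using absolutely_integrable_on_subinterval[OF i1, of 0 x] absolutely_integrable_on_subinterval[OF i2, of 0 x] x
    by (intro Henstock_Kurzweil_Integration.integral_add[symmetric] set_lebesgue_integral_eq_integral(1)) auto
  finally show "F x * G x = 0 + integral {0..x} (\<lambda>t. f t * G t + F t * g t)"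
    by (simp add: mult.commute add.commute)
qed

lemma prim_mult:
  assumes F: "prim F f" and G: "prim G g"
  shows "prim (\<lambda>x. F x * G x) (\<lambda>x. f x * G x + F x * g x)"
proof -
  have F': "prim (\<lambda>x. F x - F 0) f" and G': "prim (\<lambda>x. G x - G 0) g"
    using prim_diff[OF F prim_const[of "F 0"]] prim_diff[OF G prim_const[of "G 0"]] by simp_all
  \<comment> \<open>The product differs from that of the centred functions only by terms of first
    order in \<open>F\<close> and \<open>G\<close>, for which the rule is already known.\<close>
  have "prim (\<lambda>x. (F x - F 0) * (G x - G 0) + (F 0 * G x + G 0 * (F x - F 0)))
     (\<lambda>x. f x * (G x - G 0) + (F x - F 0) * g x + (F 0 * g x + G 0 * f x))"
    by (intro prim_add prim_mult_zero prim_cmult F F' G G') auto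
  then show ?thesis
    by (rule prim_cong) (simp_all add: algebra_simps)
qed

lemma prim_integral:
  assumes "prim F f" shows "integral {0..1} f = F 1 - F 0"
  using primD[OF assms zero_le_one order_refl] by simp

lemma prim_derivative:
  assumes "prim F f" "continuous_on {0..1} f" "0 \<le> x" "x \<le> 1"
  shows "(F has_real_derivative f x) (at x within {0..1})"
proof -
  have "((\<lambda>x. integral {0..x} f) has_real_derivative f x) (at x within {0..1})"
    using integral_has_real_derivative[OF assms(2), of x] assms by simp
  then have "((\<lambda>x. F 0 + integral {0..x} f) has_real_derivative f x) (at x within {0..1})"
    by (auto intro!: derivative_eq_intros)
  then show ?thesis
  proof (rule has_field_derivative_transform_within[OF _ zero_less_one])
    show "F 0 + integral {0..y} f = F y" if "y \<in> {0..1}" for y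
      by (rule primD[OF assms(1), symmetric]) (use that in auto)
  qed (use assms in auto)
qed

section \<open>Weak derivatives on the unit interval\<close>

text \<open>Weak derivatives are assumed integrable only on compact subsets, so
  \<open>(0, 1)\<close> is exhausted by closed intervals to which
  \<open>negligible_if_integrals_zero\<close> applies.\<close>

lemma negligible_unit_interval_if_integrals_zero:
  fixes f :: "real \<Rightarrow> real"
  assumes f: "\<And>a b. 0 < a \<Longrightarrow> b < 1 \<Longrightarrow> f absolutely_integrable_on {a..b}"
    and z: "\<And>a b. 0 < a \<Longrightarrow> a < b \<Longrightarrow> b < 1 \<Longrightarrow> integral {a..b} f = 0"
  shows "negligible {x \<in> {0<..<1}. f x \<noteq> 0}"
proof -
  define A where "A n = {x \<in> {1 / real (n+2)..1 - 1 / real (n+2)}. f x \<noteq> 0}" for n :: nat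
  have "negligible (A n)" for n
    unfolding A_def
  proof (rule negligible_if_integrals_zero)
    show "f absolutely_integrable_on {1 / real (n+2)..1 - 1 / real (n+2)}" by (rule f) auto
    fix c d assume cd: "1 / real (n+2) \<le> c" "c \<le> d" "d \<le> 1 - 1 / real (n+2)"
    have "0 < 1 / real (n+2)" by simp
    then have "0 < c" "d < 1" using cd by linarith+
    then show "integral {c..d} f = 0" using z[of c d] cd by (cases "c = d") auto
  qed
  then have "negligible (\<Union>n. A n)" by (rule negligible_Union_nat)
  moreover have "{x \<in> {0<..<1}. f x \<noteq> 0} \<subseteq> (\<Union>n. A n)"
  proof
    fix x assume x: "x \<in> {x \<in> {0<..<1}. f x \<noteq> 0}"
    then have "0 < min x (1 - x)" by auto
    then obtain n :: nat where n: "inverse (real (Suc n)) < min x (1 - x)" using reals_Archimedean by blast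
    have "1 / real (n+2) \<le> inverse (real (Suc n))" by (simp add: field_simps)
    then have "1 / real (n+2) \<le> x" "1 / real (n+2) \<le> 1 - x" using n by linarith+
    then have "x \<in> A n" using x by (auto simp: A_def)
    then show "x \<in> (\<Union>n. A n)" by blast
  qed
  ultimately show ?thesis by (rule negligible_subset)
qed

text \<open>Test functions of \<open>(0, 1)\<close> with an ordinary derivative \<open>d\<close> in
  place of a bounded linear map. The interval carrying the support is recorded because
  \<open>has_weak_deriv\<close> provides integrability on compact subsets only.\<close>

definition test01 :: "real \<Rightarrow> real \<Rightarrow> (real \<Rightarrow> real) \<Rightarrow> (real \<Rightarrow> real) \<Rightarrow> bool" where
  "test01 a b \<phi> d \<longleftrightarrow> 0 < a \<and> a \<le> b \<and> b < 1 \<and> (\<forall>x. (\<phi> has_real_derivative d x) (at x)) \<and>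
     continuous_on UNIV d \<and> (\<forall>x. x \<notin> {a..b} \<longrightarrow> \<phi> x = 0 \<and> d x = 0)"

lemma test01_test_function:
  assumes "test01 a b \<phi> d"
  shows "test_function {0<..<1} \<phi> (\<lambda>x. blinfun_scaleR_left (d x))"
  unfolding test_function_def C1_on_def
proof (intro conjI ballI exI[of _ "{a..b}"] allI impI)
  show "continuous_on UNIV (\<lambda>x. blinfun_scaleR_left (d x))"
    using assms by (intro bounded_linear.continuous_on[OF bounded_linear_blinfun_scaleR_left]) (auto simp: test01_def)
  show "(\<phi> has_derivative blinfun_apply (blinfun_scaleR_left (d x))) (at x)" for x
  proof -
    have "blinfun_apply (blinfun_scaleR_left (d x)) = (*) (d x)" by (rule ext) (simp add: mult.commute)
    moreover have "(\<phi> has_derivative (*) (d x)) (at x)"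
      using assms unfolding test01_def has_field_derivative_def by blast
    ultimately show ?thesis by metis
  qed
qed (use assms in \<open>auto simp: test01_def\<close>)

lemma lebesgue_on_integral_subset:
  fixes h :: "real \<Rightarrow> real"
  assumes "h absolutely_integrable_on S" "S \<subseteq> U" "U \<in> sets lebesgue" "\<And>x. x \<in> U - S \<Longrightarrow> h x = 0"
  shows "(\<integral>x. h x \<partial>lebesgue_on U) = integral S h"
proof -
  have "(\<integral>x. h x \<partial>lebesgue_on U) = (LINT x|lebesgue. indicator U x *\<^sub>R h x)"
    using assms by (subst integral_restrict_space) auto
  also have "\<dots> = (LINT x:S|lebesgue. h x)"
    unfolding set_lebesgue_integral_def
    by (rule Bochner_Integration.integral_cong) (use assms in \<open>auto simp: indicator_def\<close>)
  finally show ?thesis using set_lebesgue_integral_eq_integral(2)[OF assms(1)] by simp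
qed

lemma has_weak_derivD:
  assumes w: "has_weak_deriv {0<..<1::real} 1 f g" and t: "test01 a b \<phi> d"
  shows "integral {a..b} (\<lambda>x. f x * d x) = - integral {a..b} (\<lambda>x. g x * \<phi> x)"
proof -
  have ab: "0 < a" "b < 1" using t by (auto simp: test01_def)
  then have fg: "f absolutely_integrable_on {a..b}" "g absolutely_integrable_on {a..b}"
    using w unfolding has_weak_deriv_def by (auto simp: subset_eq)
  have cd: "continuous_on {a..b} d" using t by (auto simp: test01_def intro: continuous_on_subset)
  have "\<And>x. isCont \<phi> x" using t by (auto simp: test01_def intro: DERIV_isCont)
  then have c\<phi>: "continuous_on {a..b} \<phi>" by (simp add: continuous_at_imp_continuous_on)
  have "(\<integral>x. f x * d x \<partial>lebesgue_on {0<..<1}) = integral {a..b} (\<lambda>x. f x * d x)"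
    by (rule lebesgue_on_integral_subset)
      (use ab t abs_integrable_cont_mult[OF cd fg(1)] in \<open>auto simp: mult.commute test01_def\<close>)
  moreover have "(\<integral>x. g x * \<phi> x \<partial>lebesgue_on {0<..<1}) = integral {a..b} (\<lambda>x. g x * \<phi> x)"
    by (rule lebesgue_on_integral_subset)
      (use ab t abs_integrable_cont_mult[OF c\<phi> fg(2)] in \<open>auto simp: mult.commute test01_def\<close>)
  moreover have "(\<integral>x. f x * d x \<partial>lebesgue_on {0<..<1}) = - (\<integral>x. g x * \<phi> x \<partial>lebesgue_on {0<..<1})"
  proof -
    have "(\<integral>x. f x * blinfun_apply (blinfun_scaleR_left (d x)) 1 \<partial>lebesgue_on {0<..<1}) = - (\<integral>x. g x * \<phi> x \<partial>lebesgue_on {0<..<1})"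
      using w test01_test_function[OF t] unfolding has_weak_deriv_def by blast
    then show ?thesis by simp
  qed
  ultimately show ?thesis by simp
qed

text \<open>As \<open>n\<close> grows, these \<open>C\<^sup>1\<close> functions increase to the indicator of the open interval.\<close>

definition bump :: "real \<Rightarrow> real \<Rightarrow> nat \<Rightarrow> real \<Rightarrow> real" where
  "bump a b n x = (max 0 ((x - a) * (b - x)))\<^sup>2 / ((max 0 ((x - a) * (b - x)))\<^sup>2 + 1 / real (Suc n))"

text \<open>At \<open>0\<close> the difference quotient of the squared positive part is at most
  \<open>\<bar>h\<bar>\<close>. This makes \<open>bump\<close> continuously differentiable at the
  points where its support ends.\<close>

lemma max0_square_deriv: "((\<lambda>z::real. (max 0 z)\<^sup>2) has_real_derivative 2 * max 0 z) (at z)"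
proof -
  consider "z < 0" | "z = 0" | "z > 0" by linarith
  then show ?thesis
  proof cases
    case 1
    have "((\<lambda>z::real. 0) has_real_derivative 0) (at z)" by simp
    then have "((\<lambda>z::real. (max 0 z)\<^sup>2) has_real_derivative 0) (at z)"
      by (rule has_field_derivative_transform_within_open[of _ _ _ "{..<0}"]) (use 1 in auto)
    then show ?thesis using 1 by simp
  next
    case 3
    have "((\<lambda>z::real. z\<^sup>2) has_real_derivative 2 * z) (at z)" by (auto intro!: derivative_eq_intros)
    then have "((\<lambda>z::real. (max 0 z)\<^sup>2) has_real_derivative 2 * z) (at z)"
      by (rule has_field_derivative_transform_within_open[of _ _ _ "{0<..}"]) (use 3 in auto)
    then show ?thesis using 3 by simp
  next
    case 2
    have "((\<lambda>h. ((max 0 (0+h))\<^sup>2 - (max 0 (0::real))\<^sup>2) / h) \<longlongrightarrow> 0) (at 0)"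
    proof (rule Lim_null_comparison[where g="\<lambda>h. \<bar>h\<bar>"])
      show "\<forall>\<^sub>F h in at 0. norm (((max 0 (0+h))\<^sup>2 - (max 0 (0::real))\<^sup>2) / h) \<le> \<bar>h\<bar>"
        by (rule always_eventually) (auto simp: max_def power2_eq_square)
      show "((\<lambda>h. \<bar>h::real\<bar>) \<longlongrightarrow> 0) (at 0)" by (auto intro!: tendsto_eq_intros)
    qed
    then show ?thesis using 2 by (simp add: DERIV_def)
  qed
qed

lemma bump_bounds: "0 \<le> bump a b n x" "bump a b n x \<le> 1"
proof -
  define m e where "m = (max 0 ((x - a) * (b - x)))\<^sup>2" and "e = 1 / real (Suc n)"
  have "0 \<le> m" "0 < e" by (auto simp: m_def e_def)
  then show "0 \<le> bump a b n x" "bump a b n x \<le> 1"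
    unfolding bump_def m_def[symmetric] e_def[symmetric] by (auto simp: divide_le_eq_1)
qed

lemma bump_outside: "a \<le> b \<Longrightarrow> x \<notin> {a<..<b} \<Longrightarrow> bump a b n x = 0"
proof -
  assume "x \<notin> {a<..<b}" "a \<le> b"
  then have "x \<le> a \<and> x \<le> b \<or> b \<le> x \<and> a \<le> x" by auto
  then have "(x - a) * (b - x) \<le> 0" by (auto simp: mult_nonpos_nonneg mult_nonneg_nonpos)
  then show ?thesis by (simp add: bump_def max_absorb1)
qed

lemma bump_tendsto:
  assumes "a \<le> b" shows "(\<lambda>n. bump a b n x) \<longlonglongrightarrow> indicator {a<..<b} x"
proof (cases "x \<in> {a<..<b}")
  case False then show ?thesis using bump_outside[OF assms False] by simp
next
  case True
  define c where "c = (max 0 ((x - a) * (b - x)))\<^sup>2"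
  have c: "c > 0" using True by (simp add: c_def zero_less_mult_iff max_def)
  have "(\<lambda>n. c / (c + 1 / real (Suc n))) \<longlonglongrightarrow> c / (c + 0)"
    by (intro tendsto_intros LIMSEQ_Suc[OF lim_1_over_n]) (use c in auto)
  then show ?thesis using c True unfolding bump_def c_def[symmetric] by simp
qed

definition bump' :: "real \<Rightarrow> real \<Rightarrow> nat \<Rightarrow> real \<Rightarrow> real" where
  "bump' a b n x = (let m = max 0 ((x - a) * (b - x)); e = 1 / real (Suc n) in
      2 * m * (a + b - 2 * x) * e / (m\<^sup>2 + e)\<^sup>2)"

lemma bump_deriv: "(bump a b n has_real_derivative bump' a b n x) (at x)"
proof -
  define e where "e = 1 / real (Suc n)"
  have e: "e > 0" by (simp add: e_def)
  have q: "((\<lambda>x. (x - a) * (b - x)) has_real_derivative a + b - 2 * x) (at x)"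
    by (auto intro!: derivative_eq_intros)
  have m: "((\<lambda>x. (max 0 ((x - a) * (b - x)))\<^sup>2) has_real_derivative 2 * max 0 ((x - a) * (b - x)) * (a + b - 2 * x)) (at x)"
    by (rule DERIV_chain2[OF max0_square_deriv q])
  have p: "(max 0 ((x - a) * (b - x)))\<^sup>2 + e \<noteq> 0" using e zero_le_power2[of "max 0 ((x - a) * (b - x))"] by linarith
  have "((\<lambda>x. (max 0 ((x - a) * (b - x)))\<^sup>2 / ((max 0 ((x - a) * (b - x)))\<^sup>2 + e)) has_real_derivative
     2 * max 0 ((x - a) * (b - x)) * (a + b - 2 * x) * e / ((max 0 ((x - a) * (b - x)))\<^sup>2 + e)\<^sup>2) (at x)"
    by (rule derivative_eq_intros m p refl)+ (simp add: power2_eq_square algebra_simps)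
  then show ?thesis by (simp add: bump_def[abs_def] bump'_def e_def Let_def)
qed

lemma bump'_continuous: "continuous_on S (bump' a b n)"
proof -
  have "(max 0 ((x - a) * (b - x)))\<^sup>2 + 1 / real (Suc n) > 0" for x by (rule add_nonneg_pos) auto
  then have "(max 0 ((x - a) * (b - x)))\<^sup>2 + 1 / real (Suc n) \<noteq> 0" for x by (metis less_irrefl)
  then show ?thesis unfolding bump'_def[abs_def] Let_def by (intro continuous_intros) auto
qed

lemma bump_continuous: "continuous_on S (bump a b n)"
  by (intro continuous_at_imp_continuous_on ballI DERIV_isCont[OF bump_deriv])

lemma bump_test01: "0 < a \<Longrightarrow> a \<le> b \<Longrightarrow> b < 1 \<Longrightarrow> test01 a b (bump a b n) (bump' a b n)"
  unfolding test01_def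
proof (intro conjI allI impI bump_deriv bump'_continuous)
  fix x assume ab: "a \<le> b" and x: "x \<notin> {a..b}"
  show "bump a b n x = 0" using ab x by (intro bump_outside) auto
  have "x \<le> a \<and> x \<le> b \<or> b \<le> x \<and> a \<le> x" using ab x by auto
  then have "(x - a) * (b - x) \<le> 0" by (auto simp: mult_nonpos_nonneg mult_nonneg_nonpos)
  then show "bump' a b n x = 0" by (simp add: bump'_def max_absorb1 Let_def)
qed

text \<open>Indicators of intervals are not test functions; dominated convergence with majorant
  \<open>\<bar>h\<bar>\<close> reaches them from \<open>bump\<close>.\<close>

lemma bump_integral_tendsto:
  assumes "h absolutely_integrable_on {A..B}" "A \<le> a" "a \<le> b" "b \<le> B"
  shows "(\<lambda>n. integral {A..B} (\<lambda>x. h x * bump a b n x)) \<longlonglongrightarrow> integral {a..b} h"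
proof -
  have "(\<lambda>n. integral {A..B} (\<lambda>x. h x * bump a b n x)) \<longlonglongrightarrow> integral {A..B} (\<lambda>x. h x * indicator {a<..<b} x)"
  proof (rule dominated_convergence(2)[where h="\<lambda>x. \<bar>h x\<bar>"])
    show "(\<lambda>x. h x * bump a b n x) integrable_on {A..B}" for n
      using abs_integrable_cont_mult[OF bump_continuous assms(1), of a b n]
      by (simp add: mult.commute set_lebesgue_integral_eq_integral(1))
    show "(\<lambda>x. \<bar>h x\<bar>) integrable_on {A..B}"
      using assms(1) by (simp add: absolutely_integrable_on_def)
    show "norm (h x * bump a b n x) \<le> \<bar>h x\<bar>" for n x
      using bump_bounds[of a b n x] by (simp add: abs_mult mult_left_le)
    show "(\<lambda>n. h x * bump a b n x) \<longlonglongrightarrow> h x * indicator {a<..<b} x" for x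
      by (intro tendsto_intros bump_tendsto assms)
  qed
  also have "integral {A..B} (\<lambda>x. h x * indicator {a<..<b} x) = integral {A..B} (\<lambda>x. if x \<in> {a<..<b} then h x else 0)"
    by (rule integral_cong) auto
  also have "\<dots> = integral ({a<..<b} \<inter> {A..B}) h"
    by (rule Henstock_Kurzweil_Integration.integral_restrict_Int)
  also have "{a<..<b} \<inter> {A..B} = {a<..<b}" using assms by auto
  also have "integral {a<..<b} h = integral {a..b} h"
    by (rule integral_open_interval_real[symmetric])
  finally show ?thesis .
qed

section \<open>Du Bois-Reymond lemma and absolutely continuous representatives\<close>

lemma integral_eq_on_subset:
  fixes f :: "real \<Rightarrow> real"
  assumes "S \<subseteq> T" "\<And>x. x \<in> T - S \<Longrightarrow> f x = 0"
  shows "integral T f = integral S f"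
proof (rule integral_spike_set)
  have "{x \<in> T - S. f x \<noteq> 0} = {}" "{x \<in> S - T. f x \<noteq> 0} = {}" using assms by auto
  then show "negligible {x \<in> T - S. f x \<noteq> 0}" "negligible {x \<in> S - T. f x \<noteq> 0}" by (simp_all only: negligible_empty)
qed

text \<open>A continuous function with compact support is the derivative of a test function as soon
  as its integral is zero. Subtracting from a bump its integral times a fixed \<open>\<rho>\<close>
  of integral one achieves that, and in the limit the integral of \<open>f\<close> over
  \<open>[a, b]\<close> is \<open>c * (b - a)\<close>, with \<open>c\<close> the integral of
  \<open>f * \<rho>\<close>.\<close>

lemma du_Bois_Reymond:
  assumes f: "\<And>a b. 0 < a \<Longrightarrow> b < 1 \<Longrightarrow> f absolutely_integrable_on {a..b::real}"
    and z: "\<And>a b \<phi> d. test01 a b \<phi> d \<Longrightarrow> integral {a..b} (\<lambda>x. f x * d x) = (0::real)"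
  shows "\<exists>c. negligible {x \<in> {0<..<1}. f x \<noteq> c}"
proof -
  have one: "(\<lambda>x. 1::real) absolutely_integrable_on {A..B::real}" for A B 
    by (rule absolutely_integrable_continuous_real) (rule continuous_on_const)
  \<comment> \<open>Normalising \<open>\<rho>\<close> requires a bump with positive integral. The
    integrals tend to \<open>1/3\<close>, the length of the interval, so some \<open>N\<close>
    serves.\<close>
  have "(\<lambda>n. integral {1/3..2/3} (\<lambda>x. 1 * bump (1/3) (2/3) n x)) \<longlonglongrightarrow> integral {1/3..2/3::real} (\<lambda>x. 1)"
    by (rule bump_integral_tendsto[OF one]) auto
  then have "(\<lambda>n. integral {1/3..2/3} (bump (1/3) (2/3) n)) \<longlonglongrightarrow> 1/3" by simp
  then have "\<forall>\<^sub>F n in sequentially. 0 < integral {1/3..2/3} (bump (1/3) (2/3) n)"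
    by (rule order_tendstoD(1)) simp
  then obtain N where N: "0 < integral {1/3..2/3} (bump (1/3) (2/3) N)" using eventually_happens' sequentially_bot by blast
  define \<rho> where "\<rho> x = bump (1/3) (2/3) N x / integral {1/3..2/3} (bump (1/3) (2/3) N)" for x
  have \<rho>c: "continuous_on S \<rho>" for S
    unfolding \<rho>_def by (intro continuous_intros bump_continuous) (use N in auto)
  have \<rho>0: "\<rho> x = 0" if "x \<notin> {1/3..2/3}" for x
    using that by (auto simp: \<rho>_def bump_outside)
  have \<rho>1: "integral {1/3..2/3} \<rho> = 1" using N by (simp add: \<rho>_def[abs_def])
  define c where "c = integral {1/3..2/3} (\<lambda>x. f x * \<rho> x)"
  have "integral {a..b} f = c * (b - a)" if ab: "0 < a" "a < b" "b < 1" for a b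
  proof -
    define A B where "A = min a (1/3)" and "B = max b (2/3)"
    have AB: "0 < A" "A \<le> B" "B < 1" "A \<le> a" "b \<le> B" "A \<le> 1/3" "2/3 \<le> B" using ab by (auto simp: A_def B_def)
    define m where "m n = integral {A..B} (bump a b n)" for n
    \<comment> \<open>The integral of \<open>d n\<close> vanishes, so its primitive
      \<open>\<phi> n\<close> is zero again beyond \<open>B\<close> and is supported in
      \<open>[A, B]\<close>.\<close>
    define d where "d n x = bump a b n x - m n * \<rho> x" for n x
    define \<phi> where "\<phi> n x = integral {0..x} (d n)" for n x
    have dc: "continuous_on S (d n)" for n S
      unfolding d_def by (intro continuous_intros bump_continuous \<rho>c)
    have d0: "d n x = 0" if "x \<notin> {A..B}" for n x
    proof -
      have "x \<notin> {a<..<b}" "x \<notin> {1/3..2/3}" using that AB by auto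
      then show ?thesis unfolding d_def using bump_outside[of a b x n] \<rho>0[of x] ab by simp
    qed
    have di: "integral {A..B} (d n) = 0" for n
    proof -
      have "integral {A..B} (d n) = m n - m n * integral {A..B} \<rho>"
        unfolding d_def[abs_def] m_def
        by (subst Henstock_Kurzweil_Integration.integral_diff)
          (auto intro!: integrable_continuous_interval bump_continuous continuous_intros \<rho>c)
      moreover have "integral {A..B} \<rho> = integral {1/3..2/3} \<rho>"
        by (rule integral_eq_on_subset) (use AB \<rho>0 in auto)
      ultimately show ?thesis using \<rho>1 by simp
    qed
    have \<phi>A: "\<phi> n x = 0" if "x < A" for n x
    proof -
      have "integral {0..x} (d n) = integral {0..x} (\<lambda>x. 0)"
        by (rule integral_cong) (use that d0 in auto)
      then show ?thesis by (simp add: \<phi>_def)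
    qed
    have \<phi>B: "\<phi> n x = 0" if "x > B" for n x
    proof -
      have "integral {0..x} (d n) = integral {A..B} (d n)"
        by (rule integral_eq_on_subset) (use that d0 AB in auto)
      then show ?thesis by (simp add: \<phi>_def di)
    qed
    have deriv: "(\<phi> n has_real_derivative d n x) (at x)" for n x
    proof (cases "x < A")
      case True
      have "((\<lambda>x. 0::real) has_real_derivative d n x) (at x)" using d0[of x n] True by simp
      then show ?thesis
        by (rule has_field_derivative_transform_within_open[of _ _ _ "{..<A}"]) (use True \<phi>A in auto)
    next
      case False
      have "(\<phi> n has_real_derivative d n x) (at x within {0..x+1})"
        unfolding \<phi>_def[abs_def] by (rule integral_has_real_derivative[OF dc]) (use False AB in auto)
      moreover have "at x within {0..x+1} = at x" using False AB by (intro at_within_interior) auto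
      ultimately show ?thesis by simp
    qed
    have t: "test01 A B (\<phi> n) (d n)" for n
      unfolding test01_def using AB deriv dc d0 \<phi>A \<phi>B by auto
    have fi: "f absolutely_integrable_on {A..B}" by (rule f) (use AB in auto)
    have eq: "integral {A..B} (\<lambda>x. f x * bump a b n x) = m n * c" for n
    proof -
      have i: "(\<lambda>x. f x * bump a b n x) integrable_on {A..B}" "(\<lambda>x. f x * \<rho> x) integrable_on {A..B}"
        using abs_integrable_cont_mult[OF bump_continuous fi] abs_integrable_cont_mult[OF \<rho>c fi]
        by (simp_all add: mult.commute set_lebesgue_integral_eq_integral(1))
      have "0 = integral {A..B} (\<lambda>x. f x * bump a b n x - m n * (f x * \<rho> x))"
        using z[OF t[of n]] unfolding d_def by (simp add: algebra_simps)
      also have "\<dots> = integral {A..B} (\<lambda>x. f x * bump a b n x) - m n * integral {A..B} (\<lambda>x. f x * \<rho> x)"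
        using i by (subst Henstock_Kurzweil_Integration.integral_diff) (auto intro: integrable_on_mult_right)
      also have "integral {A..B} (\<lambda>x. f x * \<rho> x) = c"
        unfolding c_def by (rule integral_eq_on_subset) (use AB \<rho>0 in auto)
      finally show ?thesis by simp
    qed
    have "(\<lambda>n. m n * c) \<longlonglongrightarrow> integral {a..b} f"
      using bump_integral_tendsto[OF fi AB(4) less_imp_le[OF ab(2)] AB(5)] eq by simp
    moreover have "(\<lambda>n. integral {A..B} (\<lambda>x. 1 * bump a b n x)) \<longlonglongrightarrow> integral {a..b} (\<lambda>x. 1)"
      by (rule bump_integral_tendsto[OF one AB(4) less_imp_le[OF ab(2)] AB(5)])
    then have "(\<lambda>n. m n * c) \<longlonglongrightarrow> (b - a) * c" unfolding m_def using ab by (intro tendsto_intros) simp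
    ultimately have "integral {a..b} f = (b - a) * c" by (rule LIMSEQ_unique)
    then show ?thesis by simp
  qed
  note ic = this
  have "negligible {x \<in> {0<..<1}. f x - c \<noteq> 0}"
  proof (rule negligible_unit_interval_if_integrals_zero)
    fix a b :: real assume ab: "0 < a" "b < 1"
    have "(\<lambda>x. c) absolutely_integrable_on {a..b}"
      by (rule absolutely_integrable_continuous_real) (rule continuous_on_const)
    then show "(\<lambda>x. f x - c) absolutely_integrable_on {a..b}"
      using f[OF ab] by (intro set_integral_diff(1))
    assume "a < b"
    then show "integral {a..b} (\<lambda>x. f x - c) = 0"
      using ic[of a b] ab f[OF ab] by (subst Henstock_Kurzweil_Integration.integral_diff) (auto simp: set_lebesgue_integral_eq_integral(1))
  qed
  then show ?thesis by auto
qed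

lemma test01_prim: "test01 a b \<phi> d \<Longrightarrow> prim \<phi> d"
  by (rule prim_deriv) (auto simp: test01_def intro: has_field_derivative_at_within continuous_on_subset)

text \<open>The indefinite integral \<open>Q\<close> of \<open>q\<close> has the same weak
  derivative as \<open>p\<close>, by the Leibniz rule for \<open>prim\<close>; so
  \<open>p - Q\<close> is constant by \<open>du_Bois_Reymond\<close>.\<close>

lemma has_weak_deriv_imp_prim:
  assumes w: "has_weak_deriv {0<..<1::real} 1 p q" and q: "q absolutely_integrable_on {0..1}"
  shows "\<exists>P. prim P q \<and> negligible {x \<in> {0<..<1}. p x \<noteq> P x}"
proof -
  define Q where "Q x = integral {0..x} q" for x
  have Q: "prim Q q" by (rule primI[OF q, of _ 0]) (simp add: Q_def)
  have loc: "p absolutely_integrable_on {a..b}" if "0 < a" "b < 1" for a b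
    using w that unfolding has_weak_deriv_def by (auto simp: subset_eq)
  have locQ: "Q absolutely_integrable_on {a..b}" if "0 < a" "b < 1" for a b
    by (rule absolutely_integrable_continuous_real) (use that in \<open>auto intro: continuous_on_subset[OF prim_continuous[OF Q]]\<close>)
  have "\<exists>c. negligible {x \<in> {0<..<1}. p x - Q x \<noteq> c}"
  proof (rule du_Bois_Reymond)
    show "(\<lambda>x. p x - Q x) absolutely_integrable_on {a..b}" if "0 < a" "b < 1" for a b
      using loc[OF that] locQ[OF that] by (intro set_integral_diff(1))
    fix a b \<phi> d assume t: "test01 a b \<phi> d"
    then have ab: "0 < a" "b < 1" by (auto simp: test01_def)
    have dc: "continuous_on {a..b} d" using t by (auto simp: test01_def intro: continuous_on_subset)
    have "\<phi> 1 = 0" "\<phi> 0 = 0" using t by (auto simp: test01_def)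
    then have "integral {0..1} (\<lambda>x. q x * \<phi> x + Q x * d x) = 0"
      using prim_integral[OF prim_mult[OF Q test01_prim[OF t]]] by simp
    also have "integral {0..1} (\<lambda>x. q x * \<phi> x + Q x * d x) = integral {a..b} (\<lambda>x. q x * \<phi> x + Q x * d x)"
      by (rule integral_eq_on_subset) (use t in \<open>auto simp: test01_def\<close>)
    also have "\<dots> = integral {a..b} (\<lambda>x. q x * \<phi> x) + integral {a..b} (\<lambda>x. Q x * d x)"
    proof (rule Henstock_Kurzweil_Integration.integral_add)
      have "continuous_on {0..1} \<phi>" using test01_prim[OF t] by (rule prim_continuous)
      then have "continuous_on {a..b} \<phi>" by (rule continuous_on_subset) (use ab in auto)
      moreover have "q absolutely_integrable_on {a..b}"
        by (rule absolutely_integrable_on_subinterval[OF q]) (use ab in auto)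
      ultimately have "(\<lambda>x. \<phi> x * q x) absolutely_integrable_on {a..b}" by (rule abs_integrable_cont_mult)
      then show "(\<lambda>x. q x * \<phi> x) integrable_on {a..b}" by (simp add: mult.commute set_lebesgue_integral_eq_integral(1))
      show "(\<lambda>x. Q x * d x) integrable_on {a..b}"
        using abs_integrable_cont_mult[OF dc locQ[OF ab]] by (simp add: mult.commute set_lebesgue_integral_eq_integral(1))
    qed
    also have "integral {a..b} (\<lambda>x. q x * \<phi> x) = - integral {a..b} (\<lambda>x. p x * d x)"
      using has_weak_derivD[OF w t] by simp
    finally have "integral {a..b} (\<lambda>x. p x * d x) - integral {a..b} (\<lambda>x. Q x * d x) = 0" by simp
    moreover have "integral {a..b} (\<lambda>x. (p x - Q x) * d x) = integral {a..b} (\<lambda>x. p x * d x) - integral {a..b} (\<lambda>x. Q x * d x)"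
      using abs_integrable_cont_mult[OF dc locQ[OF ab]] abs_integrable_cont_mult[OF dc loc[OF ab]]
      by (subst Henstock_Kurzweil_Integration.integral_diff[symmetric])
        (simp_all add: mult.commute set_lebesgue_integral_eq_integral(1) algebra_simps)
    ultimately show "integral {a..b} (\<lambda>x. (p x - Q x) * d x) = 0" by simp
  qed
  then obtain c where c: "negligible {x \<in> {0<..<1}. p x - Q x \<noteq> c}" by blast
  have "prim (\<lambda>x. Q x + c) q" using prim_add[OF Q prim_const[of c]] by simp
  moreover have "{x \<in> {0<..<1}. p x - Q x \<noteq> c} = {x \<in> {0<..<1}. p x \<noteq> Q x + c}" by auto
  ultimately show ?thesis using c by auto
qed

text \<open>Matters because \<open>weak_deriv\<close> is an arbitrary choice. Testing with the bumps
  of \<open>[a, b]\<close> gives both candidates the same integral over that interval.\<close>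

lemma has_weak_deriv_unique:
  assumes "has_weak_deriv {0<..<1::real} 1 f g1" "has_weak_deriv {0<..<1} 1 f g2"
  shows "negligible {x \<in> {0<..<1}. g1 x \<noteq> g2 x}"
proof -
  have loc: "g1 absolutely_integrable_on {a..b}" "g2 absolutely_integrable_on {a..b}" if "0 < a" "b < 1" for a b
    using assms that unfolding has_weak_deriv_def by (auto simp: subset_eq)
  have "negligible {x \<in> {0<..<1}. g1 x - g2 x \<noteq> 0}"
  proof (rule negligible_unit_interval_if_integrals_zero)
    fix a b :: real assume ab: "0 < a" "b < 1"
    show "(\<lambda>x. g1 x - g2 x) absolutely_integrable_on {a..b}"
      using loc[OF ab] by (intro set_integral_diff(1))
    assume "a < b"
    then have t: "test01 a b (bump a b n) (bump' a b n)" for n by (intro bump_test01) (use ab in auto)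
    have "integral {a..b} (\<lambda>x. g1 x * bump a b n x) = integral {a..b} (\<lambda>x. g2 x * bump a b n x)" for n
      using has_weak_derivD[OF assms(1) t[of n]] has_weak_derivD[OF assms(2) t[of n]] by simp
    moreover note bump_integral_tendsto[OF loc(1)[OF ab] order_refl less_imp_le[OF \<open>a < b\<close>] order_refl]
      bump_integral_tendsto[OF loc(2)[OF ab] order_refl less_imp_le[OF \<open>a < b\<close>] order_refl]
    ultimately have "integral {a..b} g1 = integral {a..b} g2" using LIMSEQ_unique by auto
    then show "integral {a..b} (\<lambda>x. g1 x - g2 x) = 0"
      using loc[OF ab] by (subst Henstock_Kurzweil_Integration.integral_diff) (auto simp: set_lebesgue_integral_eq_integral(1))
  qed
  then show ?thesis by simp
qed

lemma lebesgue_on_Ioo_eq_integral: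
  fixes h :: "real \<Rightarrow> real"
  assumes "h absolutely_integrable_on {a..b}"
  shows "(\<integral>x. h x \<partial>lebesgue_on {a<..<b}) = integral {a..b} h"
proof -
  have "h absolutely_integrable_on {a<..<b}" using assms absolutely_integrable_on_Icc_iff_Ioo by blast
  then have "(\<integral>x. h x \<partial>lebesgue_on {a<..<b}) = integral {a<..<b} h"
    by (intro lebesgue_integral_eq_integral absolutely_integrable_imp_integrable) auto
  then show ?thesis by (simp add: integral_open_interval_real)
qed

lemma lebesgue_on_Icc_eq_integral:
  fixes h :: "real \<Rightarrow> real"
  assumes "h absolutely_integrable_on {a..b}"
  shows "(\<integral>x. h x \<partial>lebesgue_on {a..b}) = integral {a..b} h"
  using assms by (intro lebesgue_integral_eq_integral absolutely_integrable_imp_integrable) auto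

text \<open>Integration by parts against a test function, by the Leibniz rule for
  \<open>prim\<close>; the end terms vanish because the support lies inside
  \<open>(0, 1)\<close>.\<close>

lemma prim_has_weak_deriv:
  assumes P: "prim P q"
  shows "has_weak_deriv {0<..<1} 1 P q"
  unfolding has_weak_deriv_def
proof (intro conjI allI impI)
  fix K :: "real set" assume K: "compact K \<and> K \<subseteq> {0<..<1}"
  have Pi: "P absolutely_integrable_on {0..1}"
    by (intro absolutely_integrable_continuous_real prim_continuous[OF P])
  have "K \<in> sets lebesgue" using K lmeasurable_compact fmeasurableD by blast
  moreover have "K \<subseteq> {0..1}" using K by force
  ultimately show "P absolutely_integrable_on K" "q absolutely_integrable_on K"
    using set_integrable_subset[OF Pi] set_integrable_subset[OF prim_abs_integrable[OF P]] by auto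
next
  fix \<phi> \<phi>' assume "test_function {0<..<1::real} \<phi> \<phi>'"
  then obtain K where c: "continuous_on UNIV \<phi>'" and d: "\<And>x. (\<phi> has_derivative blinfun_apply (\<phi>' x)) (at x)"
    and K: "K \<subseteq> {0<..<1}" "\<And>x. x \<notin> K \<Longrightarrow> \<phi> x = 0"
    unfolding test_function_def C1_on_def by auto
  have r: "(\<phi> has_real_derivative blinfun_apply (\<phi>' x) 1) (at x)" for x
  proof -
    have "blinfun_apply (\<phi>' x) = (*) (blinfun_apply (\<phi>' x) 1)"
    proof
      fix h :: real
      show "blinfun_apply (\<phi>' x) h = blinfun_apply (\<phi>' x) 1 * h"
        using blinfun.scaleR_right[of "\<phi>' x" h 1] by (simp add: mult.commute)
    qed
    then show ?thesis using d[of x] unfolding has_field_derivative_def by metis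
  qed
  have "continuous_on {0..1} (\<lambda>x. blinfun_apply (\<phi>' x) 1)"
    by (intro continuous_intros continuous_on_subset[OF c]) auto
  then have \<phi>: "prim \<phi> (\<lambda>x. blinfun_apply (\<phi>' x) 1)"
    by (intro prim_deriv has_field_derivative_at_within[OF r]) auto
  have i1: "(\<lambda>x. P x * blinfun_apply (\<phi>' x) 1) absolutely_integrable_on {0..1}"
    by (intro abs_integrable_cont_mult prim_continuous[OF P] prim_abs_integrable[OF \<phi>])
  have i2: "(\<lambda>x. q x * \<phi> x) absolutely_integrable_on {0..1}"
    using abs_integrable_cont_mult[OF prim_continuous[OF \<phi>] prim_abs_integrable[OF P]] by (simp add: mult.commute)
  have "\<phi> 0 = 0" "\<phi> 1 = 0" using K by force+
  then have "integral {0..1} (\<lambda>x. q x * \<phi> x + P x * blinfun_apply (\<phi>' x) 1) = 0"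
    using prim_integral[OF prim_mult[OF P \<phi>]] by simp
  then have "integral {0..1} (\<lambda>x. q x * \<phi> x) + integral {0..1} (\<lambda>x. P x * blinfun_apply (\<phi>' x) 1) = 0"
    using i1 i2 by (subst (asm) Henstock_Kurzweil_Integration.integral_add) (auto simp: set_lebesgue_integral_eq_integral(1))
  then show "(\<integral>x. P x * blinfun_apply (\<phi>' x) 1 \<partial>lebesgue_on {0<..<1}) = - (\<integral>x. q x * \<phi> x \<partial>lebesgue_on {0<..<1})"
    using i1 i2 by (simp add: lebesgue_on_Ioo_eq_integral)
qed

lemma continuous_zero_if_negligible:
  fixes h :: "real \<Rightarrow> real"
  assumes c: "continuous_on {0..1} h" and n: "negligible {x \<in> {0<..<1}. h x \<noteq> 0}" and x: "x \<in> {0..1}"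
  shows "h x = 0"
proof -
  have "open ({0<..<1} \<inter> h -` (- {0}))"
    by (rule continuous_open_preimage) (auto intro: continuous_on_subset[OF c])
  moreover have "{0<..<1} \<inter> h -` (- {0}) = {x \<in> {0<..<1}. h x \<noteq> 0}" by auto
  ultimately have "{x \<in> {0<..<1}. h x \<noteq> 0} = {}" using n open_not_negligible by auto
  then have "\<And>x. x \<in> {0<..<1} \<Longrightarrow> h x = 0" by blast
  moreover have "closure {0<..<1::real} = {0..1}" by simp
  ultimately show ?thesis using continuous_constant_on_closure[of "{0<..<1}" h 0 x] c x by simp
qed

lemma negligible_iff_AE_lebesgue_on:
  assumes "S \<in> sets lebesgue"
  shows "(AE x in lebesgue_on S. P x) \<longleftrightarrow> negligible {x \<in> S. \<not> P x}"
  using assms by (subst AE_restrict_space_iff) (auto simp: negligible_iff_null_sets completion.null_sets_iff_AE)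

lemma L2_norm_square_continuous:
  fixes f g :: "real \<Rightarrow> real"
  assumes "continuous_on {0..1} g" "negligible {x \<in> {0<..<1}. f x \<noteq> g x}"
  shows "(L2_norm {0<..<1} f)\<^sup>2 = integral {0..1} (\<lambda>x. (g x)\<^sup>2)"
proof -
  have gi: "(\<lambda>x. (g x)\<^sup>2) absolutely_integrable_on {0..1}"
    by (rule absolutely_integrable_continuous_real) (intro continuous_intros assms)
  define N where "N = {x \<in> {0<..<1}. f x \<noteq> g x} \<union> {0,1}"
  have N: "negligible N" unfolding N_def using assms(2) by (intro negligible_Un) auto
  have eq: "f x = g x" if "x \<in> {0..1} - N" for x using that by (auto simp: N_def)
  have fi: "(\<lambda>x. (f x)\<^sup>2) absolutely_integrable_on {0..1}"
    by (rule absolutely_integrable_spike[OF gi N]) (simp add: eq)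
  have "(\<integral>x. (f x)\<^sup>2 \<partial>lebesgue_on {0<..<1}) = integral {0..1} (\<lambda>x. (f x)\<^sup>2)"
    by (rule lebesgue_on_Ioo_eq_integral[OF fi])
  moreover have "integral {0..1} (\<lambda>x. (f x)\<^sup>2) = integral {0..1} (\<lambda>x. (g x)\<^sup>2)"
    by (rule integral_spike[OF N]) (simp add: eq)
  moreover have "0 \<le> integral {0..1} (\<lambda>x. (g x)\<^sup>2)"
    using gi by (intro integral_nonneg) (auto simp: set_lebesgue_integral_eq_integral(1))
  ultimately show ?thesis unfolding L2_norm_def by simp
qed

text \<open>The derivative inside \<open>H1_norm\<close> is a chosen one, but it agrees with
  \<open>q\<close> almost everywhere, and the norm sees no more than that.\<close>

lemma H1_norm_square_prim:
  assumes P: "prim P q" and c: "continuous_on {0..1} q"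
  shows "(H1_norm {0<..<1} P)\<^sup>2 = integral {0..1} (\<lambda>x. (P x)\<^sup>2) + integral {0..1} (\<lambda>x. (q x)\<^sup>2)"
proof -
  have "has_weak_deriv {0<..<1} 1 P (weak_deriv {0<..<1} 1 P)"
    unfolding weak_deriv_def by (rule someI[of "has_weak_deriv {0<..<1} 1 P", OF prim_has_weak_deriv[OF P]])
  then have "negligible {x \<in> {0<..<1}. weak_deriv {0<..<1} 1 P x \<noteq> q x}"
    by (rule has_weak_deriv_unique[OF _ prim_has_weak_deriv[OF P]])
  then have "(L2_norm {0<..<1} (weak_deriv {0<..<1} 1 P))\<^sup>2 = integral {0..1} (\<lambda>x. (q x)\<^sup>2)"
    by (rule L2_norm_square_continuous[OF c])
  moreover have "(L2_norm {0<..<1} P)\<^sup>2 = integral {0..1} (\<lambda>x. (P x)\<^sup>2)"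
    by (rule L2_norm_square_continuous[OF prim_continuous[OF P]]) simp
  moreover have "(H1_norm {0<..<1} P)\<^sup>2 = (L2_norm {0<..<1} P)\<^sup>2 + (L2_norm {0<..<1} (weak_deriv {0<..<1} 1 P))\<^sup>2"
    unfolding H1_norm_def by simp
  ultimately show ?thesis by simp
qed

lemma L2_imp_absolutely_integrable_square:
  assumes "L2 {0<..<1::real} f" shows "(\<lambda>x. (f x)\<^sup>2) absolutely_integrable_on {0..1}"
proof -
  have "(\<lambda>x. (f x)\<^sup>2) absolutely_integrable_on {0<..<1}"
    using assms unfolding L2_def by (subst absolutely_integrable_measurable) (auto simp: comp_def)
  then show ?thesis using absolutely_integrable_on_Icc_iff_Ioo by blast
qed

lemma L2_imp_absolutely_integrable:
  assumes "L2 {0<..<1::real} f" shows "f absolutely_integrable_on {0..1}"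
proof -
  have f: "f \<in> borel_measurable (lebesgue_on {0<..<1})" using assms by (simp add: L2_def)
  have "f absolutely_integrable_on {0<..<1}"
  proof (rule measurable_bounded_by_integrable_imp_absolutely_integrable[OF f])
    have "(\<lambda>x. 1 + (f x)\<^sup>2) absolutely_integrable_on {0..1}"
      using L2_imp_absolutely_integrable_square[OF assms]
      by (intro set_integral_add(1)) (auto intro: absolutely_integrable_continuous_real continuous_on_const)
    then show "(\<lambda>x. 1 + (f x)\<^sup>2) integrable_on {0<..<1}"
      using absolutely_integrable_on_Icc_iff_Ioo set_lebesgue_integral_eq_integral(1) by blast
    show "norm (f x) \<le> 1 + (f x)\<^sup>2" for x
    proof -
      have "0 \<le> (\<bar>f x\<bar> - 1)\<^sup>2" "0 \<le> (f x)\<^sup>2" by simp_all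
      then show ?thesis by (simp add: power2_eq_square algebra_simps abs_if split: if_splits)
    qed
  qed simp
  then show ?thesis using absolutely_integrable_on_Icc_iff_Ioo by blast
qed

text \<open>Weak becomes classical in two rounds of \<open>has_weak_deriv_imp_prim\<close>. The
  equation makes \<open>q\<close> integrable, so \<open>p\<close> has a continuous representative
  \<open>P\<close>; then \<open>v t\<close> agrees almost everywhere with some \<open>V\<close>
  whose derivative is \<open>P\<close>, and since \<open>v t\<close> and \<open>V\<close> are
  continuous they agree at every point of \<open>[0, 1]\<close>.\<close>

lemma is_velocity_prim:
  assumes v: "is_velocity T \<kappa> vl vr y v" and y: "L2 {0<..<1} (y t)" and t: "t \<in> {0..T}"
  shows "\<exists>P. prim (v t) P \<and> prim P (\<lambda>x. v t x - y t x + \<kappa>)"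
proof -
  obtain p q where p: "has_weak_deriv {0<..<1} 1 (v t) p" and q: "has_weak_deriv {0<..<1} 1 p q"
    and ae: "AE x in lebesgue_on {0<..<1}. v t x - q x = y t x - \<kappa>"
    and c: "continuous_on {0..1} (v t)"
    using v t unfolding is_velocity_def by blast
  define N where "N = {x \<in> {0<..<1}. v t x - q x \<noteq> y t x - \<kappa>} \<union> {0,1}"
  have "negligible {x \<in> {0<..<1}. v t x - q x \<noteq> y t x - \<kappa>}"
    using iffD1[OF negligible_iff_AE_lebesgue_on ae] by simp
  then have N: "negligible N" unfolding N_def by (rule negligible_Un) simp
  have eq: "q x = v t x - y t x + \<kappa>" if "x \<in> {0..1} - N" for x
  proof -
    have "x \<in> {0<..<1}" "x \<notin> N" using that by (auto simp: N_def less_le)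
    then have "v t x - q x = y t x - \<kappa>" unfolding N_def by blast
    then show ?thesis by linarith
  qed
  have g: "(\<lambda>x. v t x - y t x + \<kappa>) absolutely_integrable_on {0..1}"
    using L2_imp_absolutely_integrable[OF y] c
    by (intro set_integral_add(1) set_integral_diff(1)) (auto intro: absolutely_integrable_continuous_real)
  have qi: "q absolutely_integrable_on {0..1}"
    by (rule absolutely_integrable_spike[OF g N]) (rule eq)
  obtain P where P: "prim P q" "negligible {x \<in> {0<..<1}. p x \<noteq> P x}"
    using has_weak_deriv_imp_prim[OF q qi] by blast
  have Pg: "prim P (\<lambda>x. v t x - y t x + \<kappa>)"
    by (rule prim_cong_AE[OF P(1) N]) (rule eq[symmetric], simp)
  have N2: "negligible ({x \<in> {0<..<1}. p x \<noteq> P x} \<union> {0,1})" by (rule negligible_Un[OF P(2)]) simp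
  have Pi: "P absolutely_integrable_on {0..1}"
    by (intro absolutely_integrable_continuous_real prim_continuous[OF P(1)])
  have pi: "p absolutely_integrable_on {0..1}"
    by (rule absolutely_integrable_spike[OF Pi N2]) auto
  obtain V where V: "prim V p" "negligible {x \<in> {0<..<1}. v t x \<noteq> V x}"
    using has_weak_deriv_imp_prim[OF p pi] by blast
  have "v t x = V x" if "x \<in> {0..1}" for x
    using continuous_zero_if_negligible[OF continuous_on_diff[OF c prim_continuous[OF V(1)]] _ that] V(2) by simp
  moreover have "prim V P"
    by (rule prim_cong_AE[OF V(1) N2]) auto
  ultimately have "prim (v t) P" using prim_cong[of V P "v t" P] atLeastAtMost_iff by blast
  then show ?thesis using Pg by blast
qed

section \<open>Square integrable functions and the elliptic problem\<close>

lemma L2_mult_absolutely_integrable: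
  fixes f g :: "real \<Rightarrow> real"
  assumes "L2 {0<..<1} f" "L2 {0<..<1} g"
  shows "(\<lambda>x. f x * g x) absolutely_integrable_on {0..1}"
proof -
  have "(\<lambda>x. f x * g x) absolutely_integrable_on {0<..<1}"
  proof (rule measurable_bounded_by_integrable_imp_absolutely_integrable)
    show "(\<lambda>x. f x * g x) \<in> borel_measurable (lebesgue_on {0<..<1})"
      using assms by (auto simp: L2_def)
    have "(\<lambda>x. (f x)\<^sup>2 + (g x)\<^sup>2) absolutely_integrable_on {0..1}"
      using assms by (intro set_integral_add(1) L2_imp_absolutely_integrable_square)
    then show "(\<lambda>x. (f x)\<^sup>2 + (g x)\<^sup>2) integrable_on {0<..<1}"
      using absolutely_integrable_on_Icc_iff_Ioo set_lebesgue_integral_eq_integral(1) by blast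
    show "norm (f x * g x) \<le> (f x)\<^sup>2 + (g x)\<^sup>2" for x
    proof -
      have "0 \<le> \<bar>f x\<bar> * \<bar>g x\<bar>" by simp
      moreover have "2 * (\<bar>f x\<bar> * \<bar>g x\<bar>) \<le> (f x)\<^sup>2 + (g x)\<^sup>2"
        using sum_squares_bound[of "\<bar>f x\<bar>" "\<bar>g x\<bar>"] by (simp add: mult.assoc)
      moreover have "norm (f x * g x) = \<bar>f x\<bar> * \<bar>g x\<bar>" by (simp add: abs_mult)
      ultimately show ?thesis by linarith
    qed
  qed simp
  then show ?thesis using absolutely_integrable_on_Icc_iff_Ioo by blast
qed

lemma L2_continuous: "continuous_on {0..1} f \<Longrightarrow> L2 {0<..<1::real} f"
  unfolding L2_def
proof
  assume c: "continuous_on {0..1} f"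
  show "f \<in> borel_measurable (lebesgue_on {0<..<1})"
    by (rule continuous_imp_measurable_on_sets_lebesgue) (auto intro: continuous_on_subset[OF c])
  have "(\<lambda>x. (f x)\<^sup>2) absolutely_integrable_on {0..1}"
    by (rule absolutely_integrable_continuous_real) (intro continuous_intros c)
  then have "(\<lambda>x. (f x)\<^sup>2) absolutely_integrable_on {0<..<1}"
    using absolutely_integrable_on_Icc_iff_Ioo by blast
  then show "integrable (lebesgue_on {0<..<1}) (\<lambda>x. (f x)\<^sup>2)"
    by (rule absolutely_integrable_imp_integrable) simp
qed

lemma L2_norm_square:
  assumes "L2 {0<..<1::real} f"
  shows "(L2_norm {0<..<1} f)\<^sup>2 = integral {0..1} (\<lambda>x. (f x)\<^sup>2)"
proof -
  have "0 \<le> integral {0..1} (\<lambda>x. (f x)\<^sup>2)"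
    using L2_imp_absolutely_integrable_square[OF assms] by (intro integral_nonneg) (auto simp: set_lebesgue_integral_eq_integral(1))
  then show ?thesis
    unfolding L2_norm_def lebesgue_on_Ioo_eq_integral[OF L2_imp_absolutely_integrable_square[OF assms]] by simp
qed

lemma L2_norm_nonneg: "0 \<le> L2_norm S f"
  by (simp add: L2_norm_def)

lemma L2_diff: 
  assumes "L2 {0<..<1::real} f" "L2 {0<..<1} g" shows "L2 {0<..<1} (\<lambda>x. f x - g x)"
  unfolding L2_def
proof
  show "(\<lambda>x. f x - g x) \<in> borel_measurable (lebesgue_on {0<..<1})" using assms by (auto simp: L2_def)
  have "(\<lambda>x. (f x)\<^sup>2 - 2 * (f x * g x) + (g x)\<^sup>2) absolutely_integrable_on {0..1}"
    using assms by (intro set_integral_add(1) set_integral_diff(1) L2_imp_absolutely_integrable_square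
       set_integrable_mult_right L2_mult_absolutely_integrable)
  then have "(\<lambda>x. (f x - g x)\<^sup>2) absolutely_integrable_on {0..1}"
    by (simp add: power2_diff algebra_simps)
  then have "(\<lambda>x. (f x - g x)\<^sup>2) absolutely_integrable_on {0<..<1}"
    using absolutely_integrable_on_Icc_iff_Ioo by blast
  then show "integrable (lebesgue_on {0<..<1}) (\<lambda>x. (f x - g x)\<^sup>2)"
    by (rule absolutely_integrable_imp_integrable) simp
qed

lemma Cauchy_Schwarz_L2:
  assumes f: "L2 {0<..<1::real} f" and g: "L2 {0<..<1} g"
  shows "\<bar>integral {0..1} (\<lambda>x. f x * g x)\<bar> \<le> L2_norm {0<..<1} f * L2_norm {0<..<1} g"
proof -
  define A B C where "A = integral {0..1} (\<lambda>x. (f x)\<^sup>2)" and "B = integral {0..1} (\<lambda>x. f x * g x)"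
    and "C = integral {0..1} (\<lambda>x. (g x)\<^sup>2)"
  note i = L2_imp_absolutely_integrable_square[OF f] L2_imp_absolutely_integrable_square[OF g] L2_mult_absolutely_integrable[OF f g]
  note i' = i[THEN set_lebesgue_integral_eq_integral(1)]
  have q: "0 \<le> A - 2 * l * B + l\<^sup>2 * C" for l
  proof -
    have "((\<lambda>x. (f x)\<^sup>2 - 2 * l * (f x * g x) + l\<^sup>2 * (g x)\<^sup>2) has_integral A - 2 * l * B + l\<^sup>2 * C) {0..1}"
      unfolding A_def B_def C_def
      by (intro has_integral_add has_integral_diff has_integral_mult_right integrable_integral i')
    then show ?thesis
    proof (rule has_integral_nonneg)
      fix x
      have "(f x)\<^sup>2 - 2 * l * (f x * g x) + l\<^sup>2 * (g x)\<^sup>2 = (f x - l * g x)\<^sup>2" by (simp add: power2_eq_square algebra_simps)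
      then show "0 \<le> (f x)\<^sup>2 - 2 * l * (f x * g x) + l\<^sup>2 * (g x)\<^sup>2" by simp
    qed
  qed
  have C: "0 \<le> C" unfolding C_def using i' by (intro integral_nonneg) auto
  have "B\<^sup>2 \<le> A * C"
  proof (cases "C = 0")
    case True
    have "B = 0"
    proof (rule ccontr)
      assume "B \<noteq> 0"
      \<comment> \<open>With \<open>C = 0\<close> the quadratic is affine in \<open>l\<close>, and
        this \<open>l\<close> gives it the value \<open>A - (A + 1)\<close>, which is
        negative.\<close>
      then show False using q[of "(A + 1) / (2 * B)"] True by (simp add: field_simps)
    qed
    then show ?thesis using True by simp
  next
    case False
    then have "C > 0" using C by simp
    then show ?thesis using q[of "B / C"] by (simp add: field_simps power2_eq_square)
  qed
  then have "B\<^sup>2 \<le> (L2_norm {0<..<1} f * L2_norm {0<..<1} g)\<^sup>2"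
    using L2_norm_square[OF f] L2_norm_square[OF g] by (simp add: A_def C_def power_mult_distrib)
  then show ?thesis unfolding B_def[symmetric]
    by (rule abs_le_square_iff[THEN iffD2, THEN order_trans]) (simp add: L2_norm_nonneg)
qed

lemma integral_abs_le_L2_norm:
  assumes f: "L2 {0<..<1::real} f"
  shows "integral {0..1} (\<lambda>x. \<bar>f x\<bar>) \<le> L2_norm {0<..<1} f"
proof -
  have fa: "L2 {0<..<1} (\<lambda>x. \<bar>f x\<bar>)" using f by (auto simp: L2_def)
  have "L2_norm {0<..<1::real} (\<lambda>x. 1) = 1"
    using L2_norm_square[OF L2_continuous[OF continuous_on_const[of _ 1]]] L2_norm_nonneg[of "{0<..<1::real}" "\<lambda>x. 1"]
    by (simp add: power2_eq_1_iff)
  moreover have "L2_norm {0<..<1} (\<lambda>x. \<bar>f x\<bar>) = L2_norm {0<..<1} f" by (simp add: L2_norm_def)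
  ultimately show ?thesis
    using Cauchy_Schwarz_L2[OF fa L2_continuous[OF continuous_on_const[of _ 1]]] by simp
qed

lemma abs_integral_mult_le:
  fixes f c :: "real \<Rightarrow> real"
  assumes f: "f absolutely_integrable_on {0..1::real}" and c: "continuous_on {0..1} c" 
    and K: "\<And>x. x \<in> {0..1} \<Longrightarrow> \<bar>c x\<bar> \<le> K"
  shows "\<bar>integral {0..1} (\<lambda>x. f x * c x)\<bar> \<le> K * integral {0..1} (\<lambda>x. \<bar>f x\<bar>)"
proof -
  have i: "(\<lambda>x. f x * c x) absolutely_integrable_on {0..1}"
    using abs_integrable_cont_mult[OF c f] by (simp add: mult.commute)
  have "\<bar>integral {0..1} (\<lambda>x. f x * c x)\<bar> \<le> integral {0..1} (\<lambda>x. K * \<bar>f x\<bar>)"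
    unfolding real_norm_def[symmetric]
  proof (rule integral_norm_bound_integral)
    show "(\<lambda>x. f x * c x) integrable_on {0..1}" using i by (rule set_lebesgue_integral_eq_integral(1))
    show "(\<lambda>x. K * norm (f x)) integrable_on {0..1}"
      using f unfolding absolutely_integrable_on_def by (auto intro: integrable_on_mult_right)
    show "norm (f x * c x) \<le> K * norm (f x)" if "x \<in> {0..1}" for x
      using mult_right_mono[OF K[OF that], of "\<bar>f x\<bar>"] by (simp add: abs_mult mult.commute)
  qed
  then show ?thesis by simp
qed

lemma abs_integrable_mult_cont:
  fixes c f :: "real \<Rightarrow> real"
  shows "f absolutely_integrable_on {a..b} \<Longrightarrow> continuous_on {a..b} c \<Longrightarrow> (\<lambda>x. f x * c x) absolutely_integrable_on {a..b}"
  using abs_integrable_cont_mult[of a b c f] by (simp add: mult.commute)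

lemma cosh_1_le: "cosh (1::real) \<le> 2"
proof -
  have "exp (-1::real) \<le> 1" by simp
  then have "exp 1 + exp (-1::real) \<le> 4" using exp_le by linarith
  then show ?thesis by (simp add: cosh_def)
qed

text \<open>Keeps \<open>1 / sinh 1\<close> at most one, so that the elliptic and trace bounds carry
  numerical constants.\<close>

lemma sinh_1_ge: "1 \<le> sinh (1::real)"
proof -
  have e: "5/2 \<le> exp (1::real)" using exp_lower_Taylor_quadratic[of 1] by simp
  then have "exp (-1::real) \<le> 2/5" by (simp add: exp_minus field_simps)
  then show ?thesis using e by (simp add: sinh_def)
qed

text \<open>Green's formula: \<open>u - u'' = g\<close> and \<open>\<phi>'' = \<phi>\<close>, so all
  terms without \<open>g\<close> cancel. It turns integrals of \<open>g\<close> against such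
  \<open>\<phi>\<close> into end values of \<open>u\<close> and \<open>p\<close>.\<close>

lemma green_prim:
  assumes u: "prim u p" and p: "prim p (\<lambda>x. u x - g x)" and \<phi>: "prim \<phi> \<phi>'" "prim \<phi>' \<phi>"
  shows "prim (\<lambda>x. u x * \<phi>' x - p x * \<phi> x) (\<lambda>x. g x * \<phi> x)"
  by (rule prim_cong[OF prim_diff[OF prim_mult[OF u \<phi>(2)] prim_mult[OF p \<phi>(1)]]]) (simp_all add: algebra_simps)

lemma sinh_prim:
  assumes "d \<noteq> 0"
  shows "prim (\<lambda>z. sinh (c - z) / d) (\<lambda>z. - cosh (c - z) / d)" "prim (\<lambda>z. - cosh (c - z) / d) (\<lambda>z. sinh (c - z) / (d::real))"
  "prim (\<lambda>z. sinh z / d) (\<lambda>z. cosh z / d)" "prim (\<lambda>z. cosh z / d) (\<lambda>z. sinh z / d)"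
  by (rule prim_deriv; use assms in \<open>auto intro!: derivative_eq_intros continuous_intros\<close>)+

text \<open>All is read off from the formula that \<open>u b\<close> equals
  \<open>u 0 * cosh b + p 0 * sinh b\<close> minus the integral of \<open>g z * sinh (b - z)\<close>
  over \<open>[0, b]\<close>. At \<open>b = 1\<close> it bounds \<open>p 0\<close> by
  \<open>2 * S\<close>; then \<open>u\<close> is at most \<open>2 * S + 4 * S + 2 * S\<close>, and
  integrating \<open>p' = u - g\<close> from \<open>0\<close> gives \<open>2 * S + 8 * S + S\<close>
  for \<open>p\<close>.\<close>

lemma elliptic_bound:
  assumes u: "prim u p" and p: "prim p (\<lambda>x. u x - g x)" and g: "g absolutely_integrable_on {0..1}"
    and S: "S = \<bar>u 0\<bar> + \<bar>u 1\<bar> + integral {0..1} (\<lambda>x. \<bar>g x\<bar>)" and x: "x \<in> {0..1}"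
  shows "\<bar>u x\<bar> \<le> 11 * S" "\<bar>p x\<bar> \<le> 11 * S"
proof -
  define G where "G = integral {0..1} (\<lambda>x. \<bar>g x\<bar>)"
  have gi: "(\<lambda>x. \<bar>g x\<bar>) integrable_on {0..1}" using g by (simp add: absolutely_integrable_on_def)
  have G0: "0 \<le> G" unfolding G_def using gi by (intro integral_nonneg) auto
  have sinh_le: "\<bar>sinh z\<bar> \<le> 2" "sinh z \<le> sinh 1" if "\<bar>z\<bar> \<le> 1" for z :: real
  proof -
    have "cosh \<bar>z\<bar> \<le> cosh 1" using that by (subst cosh_real_nonneg_le_iff) auto
    then have "cosh z \<le> cosh 1" by simp
    moreover have "\<bar>sinh z\<bar> \<le> cosh z" using sinh_le_cosh_real[of z] sinh_le_cosh_real[of "-z"] by simp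
    ultimately show "\<bar>sinh z\<bar> \<le> 2" using cosh_1_le by linarith
    show "sinh z \<le> sinh 1" using that by simp
  qed
  have gb: "\<bar>integral {0..b} (\<lambda>z. g z * sinh (b - z))\<bar> \<le> K * G" if b: "0 \<le> b" "b \<le> 1" and K: "\<And>z. 0 \<le> z \<Longrightarrow> z \<le> b \<Longrightarrow> \<bar>sinh (b - z)\<bar> \<le> K" "0 \<le> K" for b K
  proof -
    have gs: "g absolutely_integrable_on {0..b}" by (rule absolutely_integrable_on_subinterval[OF g]) (use b in auto)
    have gsi: "(\<lambda>z. \<bar>g z\<bar>) integrable_on {0..b}"
      using gs unfolding absolutely_integrable_on_def by simp
    have "(\<lambda>z. sinh (b - z) * g z) absolutely_integrable_on {0..b}"
      by (rule abs_integrable_cont_mult[OF _ gs]) (intro continuous_intros)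
    then have i: "(\<lambda>z. g z * sinh (b - z)) integrable_on {0..b}"
      using set_lebesgue_integral_eq_integral(1) by (simp add: mult.commute)
    have "norm (integral {0..b} (\<lambda>z. g z * sinh (b - z))) \<le> integral {0..b} (\<lambda>z. K * \<bar>g z\<bar>)"
    proof (rule integral_norm_bound_integral[OF i])
      show "(\<lambda>z. K * \<bar>g z\<bar>) integrable_on {0..b}" using gsi by (rule integrable_on_mult_right)
      fix z assume "z \<in> {0..b}"
      then have "\<bar>sinh (b - z)\<bar> * \<bar>g z\<bar> \<le> K * \<bar>g z\<bar>" using K(1)[of z] by (intro mult_right_mono) auto
      then show "norm (g z * sinh (b - z)) \<le> K * \<bar>g z\<bar>" by (simp only: real_norm_def abs_mult mult.commute)
    qed
    also have "\<dots> = K * integral {0..b} (\<lambda>z. \<bar>g z\<bar>)" by simp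
    also have "\<dots> \<le> K * G"
      unfolding G_def by (rule mult_left_mono[OF integral_subset_le[OF _ gsi gi] K(2)]) (use b in auto)
    finally show ?thesis by simp
  qed
  \<comment> \<open>Green's formula with \<open>sinh (b - z)\<close>, which vanishes at
    \<open>z = b\<close>, so that \<open>p b\<close> drops out.\<close>
  have rep: "- u b + u 0 * cosh b + p 0 * sinh b = integral {0..b} (\<lambda>z. g z * sinh (b - z))" if b: "0 \<le> b" "b \<le> 1" for b
    using prim_diff_eq[OF green_prim[OF u p sinh_prim(1)[OF one_neq_zero, of b] sinh_prim(2)[OF one_neq_zero, of b]], of 0 b] b by simp
  have p0: "\<bar>p 0\<bar> \<le> 2 * S"
  proof -
    have "\<bar>integral {0..1} (\<lambda>z. g z * sinh (1 - z))\<bar> \<le> sinh 1 * G"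
      by (rule gb) (use sinh_1_ge in auto)
    moreover have "p 0 * sinh 1 = integral {0..1} (\<lambda>z. g z * sinh (1 - z)) + u 1 - u 0 * cosh 1" using rep[of 1] by simp
    moreover have "\<bar>u 0 * cosh 1\<bar> \<le> \<bar>u 0\<bar> * 2" using cosh_1_le by (simp add: abs_mult mult_left_mono)
    ultimately have "\<bar>p 0 * sinh 1\<bar> \<le> sinh 1 * G + \<bar>u 1\<bar> + 2 * \<bar>u 0\<bar>" by linarith
    also have "\<dots> \<le> sinh 1 * G + sinh 1 * \<bar>u 1\<bar> + sinh 1 * (2 * \<bar>u 0\<bar>)"
      using mult_right_mono[OF sinh_1_ge, of "\<bar>u 1\<bar>"] mult_right_mono[OF sinh_1_ge, of "2 * \<bar>u 0\<bar>"] by simp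
    also have "\<dots> \<le> sinh 1 * (2 * S)"
      unfolding S G_def[symmetric] using G0 sinh_1_ge by (simp add: algebra_simps)
    finally have "sinh 1 * \<bar>p 0\<bar> \<le> sinh 1 * (2 * S)" using sinh_1_ge by (simp add: abs_mult mult.commute)
    then show ?thesis using sinh_1_ge by simp
  qed
  have S0: "\<bar>u 0\<bar> \<le> S" "G \<le> S" "0 \<le> S" using G0 by (auto simp: S G_def[symmetric])
  have ub: "\<bar>u b\<bar> \<le> 8 * S" if b: "0 \<le> b" "b \<le> 1" for b
  proof -
    have "\<bar>integral {0..b} (\<lambda>z. g z * sinh (b - z))\<bar> \<le> 2 * G"
      by (rule gb[OF b sinh_le(1)]) (use b in auto)
    moreover have "\<bar>u 0 * cosh b\<bar> \<le> \<bar>u 0\<bar> * 2"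
    proof -
      have "cosh b \<le> cosh 1" using b by (subst cosh_real_nonneg_le_iff) auto
      then show ?thesis using cosh_1_le by (simp add: abs_mult mult_left_mono)
    qed
    moreover have "\<bar>p 0 * sinh b\<bar> \<le> \<bar>p 0\<bar> * 2" using sinh_le[of b] b by (simp add: abs_mult mult_left_mono)
    ultimately show ?thesis using rep[OF b] p0 S0 by linarith
  qed
  show "\<bar>u x\<bar> \<le> 11 * S" using ub[of x] x S0 by auto
  have "p x - p 0 = integral {0..x} (\<lambda>z. u z - g z)"
    using prim_diff_eq[OF p, of 0 x] x by simp
  also have "norm \<dots> \<le> integral {0..x} (\<lambda>z. 8 * S + \<bar>g z\<bar>)"
  proof (rule integral_norm_bound_integral)
    show "(\<lambda>z. u z - g z) integrable_on {0..x}"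
      using prim_abs_integrable_sub[OF p, of 0 x] x by (auto intro: set_lebesgue_integral_eq_integral(1))
    show "(\<lambda>z. 8 * S + \<bar>g z\<bar>) integrable_on {0..x}"
      using integrable_on_subinterval[OF gi, of 0 x] x by (intro integrable_add) auto
    show "norm (u z - g z) \<le> 8 * S + \<bar>g z\<bar>" if "z \<in> {0..x}" for z
      using ub[of z] that x by auto
  qed
  also have "\<dots> = 8 * S * x + integral {0..x} (\<lambda>z. \<bar>g z\<bar>)"
    using integrable_on_subinterval[OF gi, of 0 x] x by (subst Henstock_Kurzweil_Integration.integral_add) auto
  also have "\<dots> \<le> 8 * S * 1 + G"
    unfolding G_def using gi integrable_on_subinterval[OF gi, of 0 x] x S0
    by (intro add_mono mult_left_mono integral_subset_le) auto
  finally have "\<bar>p x - p 0\<bar> \<le> 8 * S + G" by simp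
  then show "\<bar>p x\<bar> \<le> 11 * S" using p0 S0 by linarith
qed

section \<open>Energy and trace inequalities at a fixed time\<close>

text \<open>Integration by parts as it is used below: \<open>f\<close> is the integrand that
  contains \<open>g\<close>, \<open>F\<close> is a primitive of \<open>k - f\<close>, and
  \<open>k\<close> is free of \<open>g\<close>.\<close>

lemma prim_integral_split:
  assumes "prim F h" "\<And>x. x \<in> {0..1} \<Longrightarrow> h x = k x - f x" "f absolutely_integrable_on {0..1}" "k absolutely_integrable_on {0..1}"
  shows "integral {0..1} f = integral {0..1} k - (F 1 - F 0)"
proof -
  have "F 1 - F 0 = integral {0..1} h" using prim_integral[OF assms(1)] by simp
  also have "\<dots> = integral {0..1} (\<lambda>x. k x - f x)" by (rule integral_cong) (rule assms(2))
  also have "\<dots> = integral {0..1} k - integral {0..1} f"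
    using assms(3,4) by (intro Henstock_Kurzweil_Integration.integral_diff set_lebesgue_integral_eq_integral(1))
  finally show ?thesis by simp
qed

text \<open>Multiply \<open>u1 - p1' = g1\<close> by \<open>u2\<close>, which vanishes at both ends.
  The result is the H1 inner product, hence symmetric; the two functions will be taken at different
  times.\<close>

lemma prim_pairing:
  assumes "prim u1 p1" "prim p1 (\<lambda>x. u1 x - g1 x)" "prim u2 p2" "u2 0 = 0" "u2 1 = 0"
    and c: "continuous_on {0..1} p2" and g: "g1 absolutely_integrable_on {0..1}"
  shows "integral {0..1} (\<lambda>x. g1 x * u2 x) = integral {0..1} (\<lambda>x. u1 x * u2 x + p1 x * p2 x)"
proof -
  note cont = prim_continuous[OF assms(1)] prim_continuous[OF assms(2)] prim_continuous[OF assms(3)]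
  have "integral {0..1} (\<lambda>x. g1 x * u2 x) = integral {0..1} (\<lambda>x. u1 x * u2 x + p1 x * p2 x) - (p1 1 * u2 1 - p1 0 * u2 0)"
  proof (rule prim_integral_split[OF prim_mult[OF assms(2,3)]])
    show "(\<lambda>x. g1 x * u2 x) absolutely_integrable_on {0..1}" by (rule abs_integrable_mult_cont[OF g cont(3)])
    show "(\<lambda>x. u1 x * u2 x + p1 x * p2 x) absolutely_integrable_on {0..1}"
      by (rule absolutely_integrable_continuous_real) (intro continuous_intros cont c)
  qed (simp add: algebra_simps)
  then show ?thesis using assms by simp
qed

text \<open>
  Here \<open>u = v\<^sup>1 - v\<^sup>2\<close>, \<open>g = y\<^sup>1 - y\<^sup>2\<close>, \<open>w = v\<^sup>2\<close> and \<open>f = y\<^sup>2 - \<kappa>\<close>; the left-hand side is half the time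
  derivative of \<open>\<parallel>u\<parallel>\<^sup>2\<close> in \<open>H\<^sup>1\<close>.  The right-hand side involves no derivative of \<open>p = \<partial>\<^sub>x u\<close>.
\<close>

lemma energy_identity:
  assumes u: "prim u p" and p: "prim p (\<lambda>x. u x - g x)" and u0: "u 0 = 0" "u 1 = 0"
    and w: "prim w r" and r: "prim r (\<lambda>x. w x - f x)"
    and g: "g absolutely_integrable_on {0..1}" and f: "f absolutely_integrable_on {0..1}"
  shows "integral {0..1} (\<lambda>x. g x * (w x * p x - r x * u x)) =
    integral {0..1} (\<lambda>x. p x * u x * f x - (p x)\<^sup>2 * r x / 2 - r x * (u x)\<^sup>2) - ((p 1)\<^sup>2 * w 1 - (p 0)\<^sup>2 * w 0) / 2"
proof -
  note cont = prim_continuous[OF u] prim_continuous[OF p] prim_continuous[OF w] prim_continuous[OF r]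
  \<comment> \<open>With \<open>g = u - p'\<close>, the first term of this primitive disposes of
    \<open>g * w * p\<close> and the second of \<open>g * r * u\<close>. The products
    \<open>u * p * w\<close> arising from both cancel.\<close>
  have P: "prim (\<lambda>x. 1/2 * (p x * p x * w x) - p x * r x * u x)
     (\<lambda>x. 1/2 * (((u x - g x) * p x + p x * (u x - g x)) * w x + p x * p x * r x)
         - (((u x - g x) * r x + p x * (w x - f x)) * u x + p x * r x * p x))"
    by (intro prim_diff prim_cmult prim_mult u p w r)
  have "integral {0..1} (\<lambda>x. g x * (w x * p x - r x * u x)) =
    integral {0..1} (\<lambda>x. p x * u x * f x - (p x)\<^sup>2 * r x / 2 - r x * (u x)\<^sup>2)
     - ((1/2 * (p 1 * p 1 * w 1) - p 1 * r 1 * u 1) - (1/2 * (p 0 * p 0 * w 0) - p 0 * r 0 * u 0))"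
  proof (rule prim_integral_split[OF P])
    show "(\<lambda>x. g x * (w x * p x - r x * u x)) absolutely_integrable_on {0..1}"
      by (rule abs_integrable_mult_cont[OF g]) (intro continuous_intros cont)
    have "(\<lambda>x. f x * (p x * u x)) absolutely_integrable_on {0..1}"
      by (rule abs_integrable_mult_cont[OF f]) (intro continuous_intros cont)
    moreover have "(\<lambda>x. (p x)\<^sup>2 * r x / 2 + r x * (u x)\<^sup>2) absolutely_integrable_on {0..1}"
      by (rule absolutely_integrable_continuous_real) (intro continuous_intros cont, simp)
    ultimately have "(\<lambda>x. f x * (p x * u x) - ((p x)\<^sup>2 * r x / 2 + r x * (u x)\<^sup>2)) absolutely_integrable_on {0..1}"
      by (rule set_integral_diff(1))
    then show "(\<lambda>x. p x * u x * f x - (p x)\<^sup>2 * r x / 2 - r x * (u x)\<^sup>2) absolutely_integrable_on {0..1}"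
      by (simp add: algebra_simps)
  qed (simp add: algebra_simps power2_eq_square)
  moreover have "(1/2 * (p 1 * p 1 * w 1) - p 1 * r 1 * u 1) - (1/2 * (p 0 * p 0 * w 0) - p 0 * r 0 * u 0)
    = ((p 1)\<^sup>2 * w 1 - (p 0)\<^sup>2 * w 0) / 2"
    using u0 by (simp add: power2_eq_square field_simps)
  ultimately show ?thesis by (simp only:)
qed

text \<open>Sobolev embedding with constant one: \<open>u 0 = 0\<close>, and the derivative
  \<open>2 * u * p\<close> of the square is at most \<open>u^2 + p^2\<close>.\<close>

lemma square_le_H1:
  assumes u: "prim u p" and c: "continuous_on {0..1} p" and u0: "u 0 = 0" and x: "x \<in> {0..1}"
  shows "(u x)\<^sup>2 \<le> integral {0..1} (\<lambda>x. (u x)\<^sup>2) + integral {0..1} (\<lambda>x. (p x)\<^sup>2)"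
proof -
  have i: "(\<lambda>x. (u x)\<^sup>2) integrable_on {0..1}" "(\<lambda>x. (p x)\<^sup>2) integrable_on {0..1}"
    by (intro integrable_continuous_interval continuous_intros prim_continuous[OF u] c)+
  have P: "prim (\<lambda>x. u x * u x) (\<lambda>x. p x * u x + u x * p x)" by (rule prim_mult[OF u u])
  have "(u x)\<^sup>2 = integral {0..x} (\<lambda>x. p x * u x + u x * p x)"
    using prim_diff_eq[OF P, of 0 x] x u0 by (simp add: power2_eq_square)
  also have "\<dots> \<le> integral {0..x} (\<lambda>x. (u x)\<^sup>2 + (p x)\<^sup>2)"
  proof (rule integral_le)
    show "(\<lambda>x. p x * u x + u x * p x) integrable_on {0..x}"
      using prim_abs_integrable_sub[OF P, of 0 x] x by (auto intro: set_lebesgue_integral_eq_integral(1))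
    show "(\<lambda>x. (u x)\<^sup>2 + (p x)\<^sup>2) integrable_on {0..x}"
      using integrable_on_subinterval[OF i(1), of 0 x] integrable_on_subinterval[OF i(2), of 0 x] x by (intro integrable_add) auto
    show "p z * u z + u z * p z \<le> (u z)\<^sup>2 + (p z)\<^sup>2" for z
      using sum_squares_bound[of "u z" "p z"] by (simp add: algebra_simps)
  qed
  also have "\<dots> \<le> integral {0..1} (\<lambda>x. (u x)\<^sup>2 + (p x)\<^sup>2)"
    using i integrable_on_subinterval[OF i(1), of 0 x] integrable_on_subinterval[OF i(2), of 0 x] x
    by (intro integral_subset_le integrable_add) auto
  finally show ?thesis using i by (simp add: Henstock_Kurzweil_Integration.integral_add)
qed

text \<open>Since \<open>f\<close> is only square integrable, the factor \<open>u^2\<close> obtained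
  from \<open>2 * p * u * f\<close> is estimated by \<open>E\<close> uniformly in \<open>x\<close>,
  which leaves \<open>p^2 + E * f^2\<close>. This gives \<open>1 + Y\<close> in the constant;
  \<open>2 * R\<close> comes from the terms with \<open>r\<close>.\<close>

lemma energy_bound:
  assumes u: "prim u p" and p: "prim p (\<lambda>x. u x - g x)" and u0: "u 0 = 0" "u 1 = 0"
    and w: "prim w r" and r: "prim r (\<lambda>x. w x - f x)"
    and g: "g absolutely_integrable_on {0..1}" and f: "L2 {0<..<1} f"
    and R: "\<And>x. x \<in> {0..1} \<Longrightarrow> \<bar>r x\<bar> \<le> R" and Y: "integral {0..1} (\<lambda>x. (f x)\<^sup>2) \<le> Y"
    and E: "E = integral {0..1} (\<lambda>x. (u x)\<^sup>2) + integral {0..1} (\<lambda>x. (p x)\<^sup>2)"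
  shows "2 * integral {0..1} (\<lambda>x. g x * (w x * p x - r x * u x)) \<le> (2 * R + 1 + Y) * E - ((p 1)\<^sup>2 * w 1 - (p 0)\<^sup>2 * w 0)"
proof -
  note cont = prim_continuous[OF u] prim_continuous[OF p] prim_continuous[OF w] prim_continuous[OF r]
  note fi = L2_imp_absolutely_integrable[OF f]
  have i: "(\<lambda>x. (u x)\<^sup>2) integrable_on {0..1}" "(\<lambda>x. (p x)\<^sup>2) integrable_on {0..1}"
    by (intro integrable_continuous_interval continuous_intros cont)+
  have f2: "(\<lambda>x. (f x)\<^sup>2) integrable_on {0..1}"
    by (rule set_lebesgue_integral_eq_integral(1)[OF L2_imp_absolutely_integrable_square[OF f]])
  have E0: "0 \<le> E" unfolding E using i by (intro add_nonneg_nonneg integral_nonneg) auto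
  have R0: "0 \<le> R" using R[of 0] by simp
  have i1: "(\<lambda>x. p x * u x * f x - (p x)\<^sup>2 * r x / 2 - r x * (u x)\<^sup>2) integrable_on {0..1}"
  proof -
    have "(\<lambda>x. f x * (p x * u x)) absolutely_integrable_on {0..1}"
      by (rule abs_integrable_mult_cont[OF fi]) (intro continuous_intros cont)
    then have "(\<lambda>x. f x * (p x * u x)) integrable_on {0..1}" by (rule set_lebesgue_integral_eq_integral(1))
    moreover have "(\<lambda>x. (p x)\<^sup>2 * r x / 2 + r x * (u x)\<^sup>2) integrable_on {0..1}"
      by (rule integrable_continuous_interval) (intro continuous_intros cont, simp)
    ultimately have "(\<lambda>x. f x * (p x * u x) - ((p x)\<^sup>2 * r x / 2 + r x * (u x)\<^sup>2)) integrable_on {0..1}"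
      by (rule integrable_diff)
    then show ?thesis by (simp add: algebra_simps)
  qed
  have "2 * integral {0..1} (\<lambda>x. p x * u x * f x - (p x)\<^sup>2 * r x / 2 - r x * (u x)\<^sup>2)
    = integral {0..1} (\<lambda>x. 2 * (p x * u x * f x - (p x)\<^sup>2 * r x / 2 - r x * (u x)\<^sup>2))"
    by (rule Henstock_Kurzweil_Integration.integral_mult_right[symmetric])
  also have "\<dots> \<le> integral {0..1} (\<lambda>x. (2 * R + 1) * ((u x)\<^sup>2 + (p x)\<^sup>2) + E * (f x)\<^sup>2)"
  proof (rule integral_le)
    show "(\<lambda>x. 2 * (p x * u x * f x - (p x)\<^sup>2 * r x / 2 - r x * (u x)\<^sup>2)) integrable_on {0..1}"
      using i1 by (rule integrable_on_mult_right)
    show "(\<lambda>x. (2 * R + 1) * ((u x)\<^sup>2 + (p x)\<^sup>2) + E * (f x)\<^sup>2) integrable_on {0..1}"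
      by (intro integrable_add integrable_on_mult_right i f2)
    fix x :: real assume x: "x \<in> {0..1}"
    have "2 * p x * (u x * f x) \<le> (p x)\<^sup>2 + (u x)\<^sup>2 * (f x)\<^sup>2"
      using sum_squares_bound[of "p x" "u x * f x"] by (simp add: power_mult_distrib)
    moreover have "(u x)\<^sup>2 * (f x)\<^sup>2 \<le> E * (f x)\<^sup>2"
      using square_le_H1[OF u cont(2) u0(1) x] unfolding E by (intro mult_right_mono) auto
    moreover have "- ((p x)\<^sup>2 * r x) \<le> R * (p x)\<^sup>2"
      using mult_right_mono[of "- r x" R "(p x)\<^sup>2"] R[OF x] by (simp add: mult.commute)
    moreover have "- (r x * (u x)\<^sup>2) \<le> R * (u x)\<^sup>2"
      using mult_right_mono[of "- r x" R "(u x)\<^sup>2"] R[OF x] by simp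
    moreover have "0 \<le> R * (p x)\<^sup>2" "0 \<le> (u x)\<^sup>2" using R0 by simp_all
    moreover have "2 * (p x * u x * f x - (p x)\<^sup>2 * r x / 2 - r x * (u x)\<^sup>2)
        = 2 * p x * (u x * f x) - (p x)\<^sup>2 * r x - 2 * (r x * (u x)\<^sup>2)" by (simp add: algebra_simps)
    moreover have "(2 * R + 1) * ((u x)\<^sup>2 + (p x)\<^sup>2) + E * (f x)\<^sup>2
        = 2 * (R * (u x)\<^sup>2) + 2 * (R * (p x)\<^sup>2) + (u x)\<^sup>2 + (p x)\<^sup>2 + E * (f x)\<^sup>2" by (simp add: algebra_simps)
    ultimately show "2 * (p x * u x * f x - (p x)\<^sup>2 * r x / 2 - r x * (u x)\<^sup>2) \<le> (2 * R + 1) * ((u x)\<^sup>2 + (p x)\<^sup>2) + E * (f x)\<^sup>2"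
      by linarith
  qed
  also have "\<dots> = (2 * R + 1) * E + E * integral {0..1} (\<lambda>x. (f x)\<^sup>2)"
    unfolding E using i f2
    by (simp add: Henstock_Kurzweil_Integration.integral_add integrable_add integrable_on_mult_right)
  also have "\<dots> \<le> (2 * R + 1) * E + E * Y" using Y E0 by (intro add_left_mono mult_left_mono)
  finally have "2 * integral {0..1} (\<lambda>x. p x * u x * f x - (p x)\<^sup>2 * r x / 2 - r x * (u x)\<^sup>2) \<le> (2 * R + 1) * E + E * Y" .
  moreover have "(2 * R + 1) * E + E * Y = (2 * R + 1 + Y) * E" by (simp add: algebra_simps)
  moreover have "2 * (a - b / 2) = 2 * a - b" for a b :: real by simp
  ultimately show ?thesis
    unfolding energy_identity[OF u p u0 w r g fi] by (simp only: diff_right_mono)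
qed

text \<open>Integrate \<open>g = u - p'\<close> by parts against
  \<open>w * \<phi>' - r * \<phi>\<close>. The derivative of this multiplier is just
  \<open>f * \<phi>\<close>, because \<open>\<phi>'' = \<phi>\<close> and
  \<open>r' = w - f\<close>.\<close>

lemma boundary_identity:
  assumes u: "prim u p" and p: "prim p (\<lambda>x. u x - g x)" and w: "prim w r" and r: "prim r (\<lambda>x. w x - f x)"
    and \<phi>: "prim \<phi> \<phi>'" "prim \<phi>' \<phi>"
    and g: "g absolutely_integrable_on {0..1}" and f: "f absolutely_integrable_on {0..1}"
  shows "integral {0..1} (\<lambda>x. g x * (w x * \<phi>' x - r x * \<phi> x)) =
    integral {0..1} (\<lambda>x. u x * (w x * \<phi>' x - r x * \<phi> x) + f x * (p x * \<phi> x))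
     - (p 1 * (w 1 * \<phi>' 1 - r 1 * \<phi> 1) - p 0 * (w 0 * \<phi>' 0 - r 0 * \<phi> 0))"
proof -
  note cont = prim_continuous[OF u] prim_continuous[OF p] prim_continuous[OF w] prim_continuous[OF r]
    prim_continuous[OF \<phi>(1)] prim_continuous[OF \<phi>(2)]
  have P: "prim (\<lambda>x. p x * (w x * \<phi>' x - r x * \<phi> x))
     (\<lambda>x. (u x - g x) * (w x * \<phi>' x - r x * \<phi> x) + p x * ((r x * \<phi>' x + w x * \<phi> x) - ((w x - f x) * \<phi> x + r x * \<phi>' x)))"
    by (intro prim_diff prim_mult u p w r \<phi>)
  show ?thesis
  proof (rule prim_integral_split[OF P])
    show "(\<lambda>x. g x * (w x * \<phi>' x - r x * \<phi> x)) absolutely_integrable_on {0..1}"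
      by (rule abs_integrable_mult_cont[OF g]) (intro continuous_intros cont)
    show "(\<lambda>x. u x * (w x * \<phi>' x - r x * \<phi> x) + f x * (p x * \<phi> x)) absolutely_integrable_on {0..1}"
    proof (rule set_integral_add(1))
      show "(\<lambda>x. u x * (w x * \<phi>' x - r x * \<phi> x)) absolutely_integrable_on {0..1}"
        by (rule absolutely_integrable_continuous_real) (intro continuous_intros cont)
      show "(\<lambda>x. f x * (p x * \<phi> x)) absolutely_integrable_on {0..1}"
        by (rule abs_integrable_mult_cont[OF f]) (intro continuous_intros cont)
    qed
  qed (simp add: algebra_simps)
qed

text \<open>For the square of a trace: \<open>z\<close> becomes \<open>p t 0\<close> or
  \<open>- p t 1\<close>, so that the left-hand side is the derivative of \<open>z^2\<close> at an
  inflow end. Each product is split by \<open>2 * a * b \<le> a^2 + b^2\<close> with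
  \<open>z\<close>, and \<open>y\<close> or \<open>f\<close> where present, on one side; as
  \<open>z\<close> does not depend on \<open>x\<close>, only the L2 norms of \<open>y\<close> and
  \<open>f\<close> enter.\<close>

lemma boundary_bound:
  assumes u: "prim u p" and p: "prim p (\<lambda>x. u x - g x)"
    and w: "prim w r" and r: "prim r (\<lambda>x. w x - f x)"
    and \<phi>: "prim \<phi> \<phi>'" "prim \<phi>' \<phi>" and \<phi>_le: "\<And>x. x \<in> {0..1} \<Longrightarrow> \<bar>\<phi> x\<bar> \<le> 1 \<and> \<bar>\<phi>' x\<bar> \<le> 2"
    and g: "g absolutely_integrable_on {0..1}" and f: "L2 {0<..<1} f" and y: "L2 {0<..<1} y"
    and R: "\<And>x. x \<in> {0..1} \<Longrightarrow> \<bar>w x\<bar> \<le> R \<and> \<bar>r x\<bar> \<le> R"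
    and Y: "integral {0..1} (\<lambda>x. (f x)\<^sup>2) \<le> Y" "integral {0..1} (\<lambda>x. (y x)\<^sup>2) \<le> Y"
    and E: "E = integral {0..1} (\<lambda>x. (u x)\<^sup>2) + integral {0..1} (\<lambda>x. (p x)\<^sup>2)"
  shows "2 * z * integral {0..1} (\<lambda>x. y x * (u x * \<phi>' x - p x * \<phi> x) + g x * (w x * \<phi>' x - r x * \<phi> x))
    \<le> (2 * Y + 9 * R\<^sup>2 + 10) * (E + z\<^sup>2)
     - 2 * z * (p 1 * (w 1 * \<phi>' 1 - r 1 * \<phi> 1) - p 0 * (w 0 * \<phi>' 0 - r 0 * \<phi> 0))"
proof -
  note cont = prim_continuous[OF u] prim_continuous[OF p] prim_continuous[OF w] prim_continuous[OF r]
    prim_continuous[OF \<phi>(1)] prim_continuous[OF \<phi>(2)]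
  note fi = L2_imp_absolutely_integrable[OF f] and yi = L2_imp_absolutely_integrable[OF y]
  note li = set_lebesgue_integral_eq_integral(1)
  define B where "B = p 1 * (w 1 * \<phi>' 1 - r 1 * \<phi> 1) - p 0 * (w 0 * \<phi>' 0 - r 0 * \<phi> 0)"
  have i: "(\<lambda>x. (u x)\<^sup>2) integrable_on {0..1}" "(\<lambda>x. (p x)\<^sup>2) integrable_on {0..1}"
    by (intro integrable_continuous_interval continuous_intros cont)+
  have f2: "(\<lambda>x. (f x)\<^sup>2) integrable_on {0..1}" and y2: "(\<lambda>x. (y x)\<^sup>2) integrable_on {0..1}"
    by (rule li[OF L2_imp_absolutely_integrable_square]; fact)+
  have E0: "0 \<le> E" unfolding E using i by (intro add_nonneg_nonneg integral_nonneg) auto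
  have Y0: "0 \<le> Y" using Y(1) f2 by (meson integral_nonneg order_trans zero_le_power2)
  have R0: "0 \<le> R" using R[of 0] by force
  have j1: "(\<lambda>x. y x * (u x * \<phi>' x - p x * \<phi> x)) integrable_on {0..1}"
    by (rule li[OF abs_integrable_mult_cont[OF yi]]) (intro continuous_intros cont)
  have j2: "(\<lambda>x. g x * (w x * \<phi>' x - r x * \<phi> x)) integrable_on {0..1}"
    by (rule li[OF abs_integrable_mult_cont[OF g]]) (intro continuous_intros cont)
  have j3: "(\<lambda>x. u x * (w x * \<phi>' x - r x * \<phi> x) + f x * (p x * \<phi> x)) integrable_on {0..1}"
  proof (rule integrable_add)
    show "(\<lambda>x. u x * (w x * \<phi>' x - r x * \<phi> x)) integrable_on {0..1}"
      by (rule integrable_continuous_interval) (intro continuous_intros cont)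
    show "(\<lambda>x. f x * (p x * \<phi> x)) integrable_on {0..1}"
      by (rule li[OF abs_integrable_mult_cont[OF fi]]) (intro continuous_intros cont)
  qed
  have "integral {0..1} (\<lambda>x. y x * (u x * \<phi>' x - p x * \<phi> x) + g x * (w x * \<phi>' x - r x * \<phi> x))
    = integral {0..1} (\<lambda>x. y x * (u x * \<phi>' x - p x * \<phi> x)) + integral {0..1} (\<lambda>x. g x * (w x * \<phi>' x - r x * \<phi> x))"
    by (rule Henstock_Kurzweil_Integration.integral_add[OF j1 j2])
  also have "\<dots> = integral {0..1} (\<lambda>x. y x * (u x * \<phi>' x - p x * \<phi> x))
      + integral {0..1} (\<lambda>x. u x * (w x * \<phi>' x - r x * \<phi> x) + f x * (p x * \<phi> x)) - B"
    unfolding B_def boundary_identity[OF u p w r \<phi> g fi] by simp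
  also have "\<dots> = integral {0..1} (\<lambda>x. y x * (u x * \<phi>' x - p x * \<phi> x) + (u x * (w x * \<phi>' x - r x * \<phi> x) + f x * (p x * \<phi> x))) - B"
    by (subst Henstock_Kurzweil_Integration.integral_add[OF j1 j3]) simp
  finally have eq0: "integral {0..1} (\<lambda>x. y x * (u x * \<phi>' x - p x * \<phi> x) + g x * (w x * \<phi>' x - r x * \<phi> x))
    = integral {0..1} (\<lambda>x. y x * (u x * \<phi>' x - p x * \<phi> x) + (u x * (w x * \<phi>' x - r x * \<phi> x) + f x * (p x * \<phi> x))) - B" .
  have eq: "2 * z * integral {0..1} (\<lambda>x. y x * (u x * \<phi>' x - p x * \<phi> x) + g x * (w x * \<phi>' x - r x * \<phi> x))
    = integral {0..1} (\<lambda>x. 2 * z * (y x * (u x * \<phi>' x - p x * \<phi> x) + (u x * (w x * \<phi>' x - r x * \<phi> x) + f x * (p x * \<phi> x)))) - 2 * z * B"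
    by (subst eq0, subst right_diff_distrib, subst Henstock_Kurzweil_Integration.integral_mult_right) (rule refl)
  \<comment> \<open>The coefficient \<open>9 * R^2 + 9\<close> collects \<open>(3 * R)^2\<close>
    from the multiplier \<open>w * \<phi>' - r * \<phi>\<close>, and \<open>8\<close> and
    \<open>2 + 1\<close> from the remaining terms in \<open>u^2\<close> and \<open>p^2\<close>,
    rounded up to \<open>9\<close>.\<close>
  have "integral {0..1} (\<lambda>x. 2 * z * (y x * (u x * \<phi>' x - p x * \<phi> x) + (u x * (w x * \<phi>' x - r x * \<phi> x) + f x * (p x * \<phi> x))))
    \<le> integral {0..1} (\<lambda>x. z\<^sup>2 * (y x)\<^sup>2 + z\<^sup>2 * (f x)\<^sup>2 + (z\<^sup>2 + (9 * R\<^sup>2 + 9) * ((u x)\<^sup>2 + (p x)\<^sup>2)))"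
  proof (rule integral_le)
    show "(\<lambda>x. 2 * z * (y x * (u x * \<phi>' x - p x * \<phi> x) + (u x * (w x * \<phi>' x - r x * \<phi> x) + f x * (p x * \<phi> x)))) integrable_on {0..1}"
      by (intro integrable_on_mult_right integrable_add[OF j1 j3])
    show "(\<lambda>x. z\<^sup>2 * (y x)\<^sup>2 + z\<^sup>2 * (f x)\<^sup>2 + (z\<^sup>2 + (9 * R\<^sup>2 + 9) * ((u x)\<^sup>2 + (p x)\<^sup>2))) integrable_on {0..1}"
      by (intro integrable_add integrable_on_mult_right i f2 y2 integrable_const_ivl)
    fix x :: real assume x: "x \<in> {0..1}"
    note b = \<phi>_le[OF x] R[OF x]
    have sq: "a\<^sup>2 \<le> c\<^sup>2" if "\<bar>a\<bar> \<le> c" for a c :: real using that by (simp add: abs_le_square_iff[symmetric])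
    have "(u x * \<phi>' x - p x * \<phi> x)\<^sup>2 \<le> 2 * ((u x * \<phi>' x)\<^sup>2 + (p x * \<phi> x)\<^sup>2)"
      using sum_squares_bound[of "u x * \<phi>' x" "- (p x * \<phi> x)"] by (simp add: power2_eq_square algebra_simps)
    also have "\<dots> \<le> 2 * ((u x)\<^sup>2 * 2\<^sup>2 + (p x)\<^sup>2 * 1\<^sup>2)"
      unfolding power_mult_distrib using b by (intro mult_left_mono add_mono sq) auto
    finally have 1: "(u x * \<phi>' x - p x * \<phi> x)\<^sup>2 \<le> 8 * (u x)\<^sup>2 + 2 * (p x)\<^sup>2" by simp
    have "\<bar>w x * \<phi>' x - r x * \<phi> x\<bar> \<le> R * 2 + R * 1"
    proof -
      have "\<bar>w x * \<phi>' x\<bar> \<le> R * 2" "\<bar>r x * \<phi> x\<bar> \<le> R * 1"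
        unfolding abs_mult using b R0 by (intro mult_mono; simp)+
      then show ?thesis using abs_triangle_ineq4[of "w x * \<phi>' x" "r x * \<phi> x"] by linarith
    qed
    then have "(w x * \<phi>' x - r x * \<phi> x)\<^sup>2 \<le> (3 * R)\<^sup>2" by (intro sq) simp
    then have 2: "(u x)\<^sup>2 * (w x * \<phi>' x - r x * \<phi> x)\<^sup>2 \<le> (u x)\<^sup>2 * (9 * R\<^sup>2)"
      by (intro mult_left_mono) (auto simp: power_mult_distrib)
    have 3: "(p x)\<^sup>2 * (\<phi> x)\<^sup>2 \<le> (p x)\<^sup>2 * 1\<^sup>2" using b by (intro mult_left_mono sq) auto
    have "2 * z * (y x * (u x * \<phi>' x - p x * \<phi> x)) \<le> z\<^sup>2 * (y x)\<^sup>2 + (u x * \<phi>' x - p x * \<phi> x)\<^sup>2"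
      using sum_squares_bound[of "z * y x" "u x * \<phi>' x - p x * \<phi> x"] by (simp only: power_mult_distrib mult.assoc)
    moreover have "2 * z * (u x * (w x * \<phi>' x - r x * \<phi> x)) \<le> z\<^sup>2 + (u x)\<^sup>2 * (w x * \<phi>' x - r x * \<phi> x)\<^sup>2"
      using sum_squares_bound[of z "u x * (w x * \<phi>' x - r x * \<phi> x)"] by (simp only: power_mult_distrib mult.assoc)
    moreover have "2 * z * (f x * (p x * \<phi> x)) \<le> z\<^sup>2 * (f x)\<^sup>2 + (p x)\<^sup>2 * (\<phi> x)\<^sup>2"
      using sum_squares_bound[of "z * f x" "p x * \<phi> x"] by (simp only: power_mult_distrib mult.assoc)
    moreover have "0 \<le> R\<^sup>2 * (p x)\<^sup>2" "0 \<le> (p x)\<^sup>2" "0 \<le> (u x)\<^sup>2" by simp_all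
    moreover have "(u x)\<^sup>2 * (9 * R\<^sup>2) = 9 * (R\<^sup>2 * (u x)\<^sup>2)" by simp
    moreover have "(9 * R\<^sup>2 + 9) * ((u x)\<^sup>2 + (p x)\<^sup>2)
        = 9 * (R\<^sup>2 * (u x)\<^sup>2) + 9 * (R\<^sup>2 * (p x)\<^sup>2) + 9 * (u x)\<^sup>2 + 9 * (p x)\<^sup>2" by (simp add: algebra_simps)
    moreover have "2 * z * (y x * (u x * \<phi>' x - p x * \<phi> x) + (u x * (w x * \<phi>' x - r x * \<phi> x) + f x * (p x * \<phi> x)))
      = 2 * z * (y x * (u x * \<phi>' x - p x * \<phi> x)) + (2 * z * (u x * (w x * \<phi>' x - r x * \<phi> x)) + 2 * z * (f x * (p x * \<phi> x)))"
      by (simp only: distrib_left)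
    ultimately show "2 * z * (y x * (u x * \<phi>' x - p x * \<phi> x) + (u x * (w x * \<phi>' x - r x * \<phi> x) + f x * (p x * \<phi> x)))
      \<le> z\<^sup>2 * (y x)\<^sup>2 + z\<^sup>2 * (f x)\<^sup>2 + (z\<^sup>2 + (9 * R\<^sup>2 + 9) * ((u x)\<^sup>2 + (p x)\<^sup>2))"
      using 1 2 3 unfolding one_power2 mult_1_right by linarith
  qed
  also have "\<dots> = z\<^sup>2 * integral {0..1} (\<lambda>x. (y x)\<^sup>2) + z\<^sup>2 * integral {0..1} (\<lambda>x. (f x)\<^sup>2) + (z\<^sup>2 + (9 * R\<^sup>2 + 9) * E)"
  proof -
    have "((\<lambda>x. z\<^sup>2 * (y x)\<^sup>2 + z\<^sup>2 * (f x)\<^sup>2 + (z\<^sup>2 + (9 * R\<^sup>2 + 9) * ((u x)\<^sup>2 + (p x)\<^sup>2))) has_integral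
      z\<^sup>2 * integral {0..1} (\<lambda>x. (y x)\<^sup>2) + z\<^sup>2 * integral {0..1} (\<lambda>x. (f x)\<^sup>2) + (z\<^sup>2 * (1 - 0) + (9 * R\<^sup>2 + 9) * E)) {0..1}"
      unfolding E using has_integral_const_real[of "z\<^sup>2" 0 1]
      by (intro has_integral_add has_integral_mult_right integrable_integral i f2 y2) simp
    then show ?thesis by (simp add: integral_unique)
  qed
  also have "\<dots> \<le> z\<^sup>2 * Y + z\<^sup>2 * Y + (z\<^sup>2 + (9 * R\<^sup>2 + 9) * E)"
    using Y by (intro add_mono mult_left_mono) auto
  also have "\<dots> \<le> (2 * Y + 9 * R\<^sup>2 + 10) * (E + z\<^sup>2)"
  proof -
    have "0 \<le> Y * E" "0 \<le> R\<^sup>2 * z\<^sup>2" "0 \<le> z\<^sup>2" using Y0 E0 by simp_all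
    then show ?thesis using E0 by (simp add: algebra_simps)
  qed
  finally show ?thesis unfolding eq B_def by simp
qed

section \<open>Continuity in time of the velocity\<close>

lemma is_velocity_prim_dx:
  assumes v: "is_velocity T \<kappa> vl vr y v" and y: "L2 {0<..<1} (y t)" and t: "t \<in> {0..T}"
  shows "prim (v t) (dx v t)" "prim (dx v t) (\<lambda>x. v t x - (y t x - \<kappa>))"
proof -
  obtain P where P: "prim (v t) P" "prim P (\<lambda>x. v t x - y t x + \<kappa>)"
    using is_velocity_prim[OF assms] by blast
  have eq: "dx v t x = P x" if "0 \<le> x" "x \<le> 1" for x
    unfolding dx_def
    by (rule vector_derivative_within_closed_interval)
      (use that prim_derivative[OF P(1) prim_continuous[OF P(2)]] in \<open>auto simp: has_real_derivative_iff_has_vector_derivative\<close>)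
  show "prim (v t) (dx v t)" by (rule prim_cong[OF P(1)]) (simp_all add: eq)
  show "prim (dx v t) (\<lambda>x. v t x - (y t x - \<kappa>))" by (rule prim_cong[OF P(2)]) (simp_all add: eq)
qed

text \<open>Continuity in time with values in the continuous functions on \<open>[0, 1]\<close>
  under the sup norm. This is what the elliptic bound delivers, and with continuity of the slices it
  amounts to joint continuity.\<close>

definition sup_continuous_on :: "real \<Rightarrow> (real \<Rightarrow> real \<Rightarrow> real) \<Rightarrow> bool" where
  "sup_continuous_on T f \<longleftrightarrow> (\<forall>t\<in>{0..T}. \<forall>e>0. \<exists>d>0. \<forall>s\<in>{0..T}. dist s t < d \<longrightarrow> (\<forall>x\<in>{0..1}. \<bar>f s x - f t x\<bar> < e))"

text \<open>Continuity on the compact rectangle is uniform, which gives one direction; the other is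
  the triangle inequality through \<open>f (fst p) (snd q)\<close>.\<close>

lemma continuous_on_rectangle_iff:
  fixes f :: "real \<Rightarrow> real \<Rightarrow> real"
  shows "continuous_on ({0..T} \<times> {0..1}) (\<lambda>p. f (fst p) (snd p)) \<longleftrightarrow>
     sup_continuous_on T f \<and> (\<forall>t\<in>{0..T}. continuous_on {0..1} (f t))"
proof safe
  assume c: "continuous_on ({0..T} \<times> {0..1}) (\<lambda>p. f (fst p) (snd p))"
  then have u: "uniformly_continuous_on ({0..T} \<times> {0..1}) (\<lambda>p. f (fst p) (snd p))"
    by (intro compact_uniformly_continuous compact_Times compact_Icc)
  show "sup_continuous_on T f"
    unfolding sup_continuous_on_def
  proof (intro ballI allI impI)
    fix t e :: real assume t: "t \<in> {0..T}" and e: "e > 0"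
    obtain d where d: "d > 0" "\<And>p q. p \<in> {0..T} \<times> {0..1} \<Longrightarrow> q \<in> {0..T} \<times> {0..1} \<Longrightarrow> dist q p < d \<Longrightarrow>
        dist (f (fst q) (snd q)) (f (fst p) (snd p)) < e"
      using u e unfolding uniformly_continuous_on_def by metis
    have "\<bar>f s x - f t x\<bar> < e" if "s \<in> {0..T}" "dist s t < d" "x \<in> {0..1}" for s x
      using d(2)[of "(t,x)" "(s,x)"] that t by (auto simp: dist_Pair_Pair dist_real_def)
    then show "\<exists>d>0. \<forall>s\<in>{0..T}. dist s t < d \<longrightarrow> (\<forall>x\<in>{0..1}. \<bar>f s x - f t x\<bar> < e)" using d(1) by blast
  qed
  fix t assume t: "t \<in> {0..T}"
  have "continuous_on {0..1} ((\<lambda>p. f (fst p) (snd p)) \<circ> (\<lambda>x. (t, x)))"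
    by (rule continuous_on_compose) (use t in \<open>auto intro!: continuous_intros continuous_on_subset[OF c]\<close>)
  then show "continuous_on {0..1} (f t)" by (simp add: comp_def)
next
  assume s: "sup_continuous_on T f" and c: "\<forall>t\<in>{0..T}. continuous_on {0..1} (f t)"
  show "continuous_on ({0..T} \<times> {0..1}) (\<lambda>p. f (fst p) (snd p))"
    unfolding continuous_on_iff
  proof (intro ballI allI impI)
    fix p :: "real \<times> real" and e :: real assume p: "p \<in> {0..T} \<times> {0..1}" and e: "e > 0"
    then have t: "fst p \<in> {0..T}" and x: "snd p \<in> {0..1}" by auto
    obtain d1 where d1: "d1 > 0" "\<And>s z. s \<in> {0..T} \<Longrightarrow> dist s (fst p) < d1 \<Longrightarrow> z \<in> {0..1} \<Longrightarrow> \<bar>f s z - f (fst p) z\<bar> < e/2"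
      using s[unfolded sup_continuous_on_def, rule_format, OF t, of "e/2"] e by auto
    obtain d2 where d2: "d2 > 0" "\<And>z. z \<in> {0..1} \<Longrightarrow> dist z (snd p) < d2 \<Longrightarrow> \<bar>f (fst p) z - f (fst p) (snd p)\<bar> < e/2"
      using c[rule_format, OF t, unfolded continuous_on_iff, rule_format, OF x, of "e/2"] e by (auto simp: dist_real_def)
    show "\<exists>d>0. \<forall>q\<in>{0..T} \<times> {0..1}. dist q p < d \<longrightarrow> dist (f (fst q) (snd q)) (f (fst p) (snd p)) < e"
    proof (intro exI[of _ "min d1 d2"] conjI ballI impI)
      fix q assume q: "q \<in> {0..T} \<times> {0..1}" "dist q p < min d1 d2"
      then have "dist (fst q) (fst p) < d1" "dist (snd q) (snd p) < d2"
        using dist_fst_le[of q p] dist_snd_le[of q p] by linarith+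
      then have "\<bar>f (fst q) (snd q) - f (fst p) (snd q)\<bar> < e/2" "\<bar>f (fst p) (snd q) - f (fst p) (snd p)\<bar> < e/2"
        using d1(2)[of "fst q" "snd q"] d2(2)[of "snd q"] q by auto
      then show "dist (f (fst q) (snd q)) (f (fst p) (snd p)) < e" unfolding dist_real_def by linarith
    qed (use d1 d2 in auto)
  qed
qed

lemma C0_L2_D: "C0_L2 T y \<Longrightarrow> t \<in> {0..T} \<Longrightarrow> L2 {0<..<1} (y t)"
  by (auto simp: C0_L2_def)

lemma C0_L2_tendsto: "C0_L2 T y \<Longrightarrow> t \<in> {0..T} \<Longrightarrow> ((\<lambda>s. L2_norm {0<..<1} (\<lambda>x. y s x - y t x)) \<longlongrightarrow> 0) (at t within {0..T})"
  by (auto simp: C0_L2_def)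

text \<open>The difference of two time slices solves the elliptic problem for the differences of the
  data, so \<open>elliptic_bound\<close> turns continuity of \<open>vl\<close>, of \<open>vr\<close>
  and of \<open>y\<close> in L2 into sup-norm continuity.\<close>

lemma velocity_sup_continuous:
  assumes v: "is_velocity T \<kappa> vl vr y v" and y: "C0_L2 T y"
    and vl: "continuous_on {0..T} vl" and vr: "continuous_on {0..T} vr"
  shows "sup_continuous_on T v" "sup_continuous_on T (dx v)"
proof -
  have key: "\<exists>d>0. \<forall>s\<in>{0..T}. dist s t < d \<longrightarrow> (\<forall>x\<in>{0..1}. \<bar>v s x - v t x\<bar> < e \<and> \<bar>dx v s x - dx v t x\<bar> < e)"
    if t: "t \<in> {0..T}" and e: "e > 0" for t e
  proof -
    define m where "m s = 11 * (\<bar>vl s - vl t\<bar> + \<bar>vr s - vr t\<bar> + L2_norm {0<..<1} (\<lambda>x. y s x - y t x))" for s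
    have "(m \<longlongrightarrow> 11 * (\<bar>vl t - vl t\<bar> + \<bar>vr t - vr t\<bar> + 0)) (at t within {0..T})"
      unfolding m_def using vl vr t by (intro tendsto_intros C0_L2_tendsto[OF y]) (auto simp: continuous_on)
    then have "\<forall>\<^sub>F s in at t within {0..T}. m s < e"
      by (rule order_tendstoD(2)) (use e in simp)
    then obtain d where d: "d > 0" "\<And>s. s \<in> {0..T} \<Longrightarrow> s \<noteq> t \<Longrightarrow> dist s t < d \<Longrightarrow> m s < e"
      unfolding eventually_at by auto
    have bd: "\<bar>v s x - v t x\<bar> \<le> m s \<and> \<bar>dx v s x - dx v t x\<bar> \<le> m s" if s: "s \<in> {0..T}" and x: "x \<in> {0..1}" for s x
    proof -
      note ps = is_velocity_prim_dx[OF v C0_L2_D[OF y s] s] and pt = is_velocity_prim_dx[OF v C0_L2_D[OF y t] t]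
      have u: "prim (\<lambda>x. v s x - v t x) (\<lambda>x. dx v s x - dx v t x)" by (rule prim_diff[OF ps(1) pt(1)])
      have p: "prim (\<lambda>x. dx v s x - dx v t x) (\<lambda>x. (v s x - v t x) - (y s x - y t x))"
        by (rule prim_cong[OF prim_diff[OF ps(2) pt(2)]]) (simp_all add: algebra_simps)
      have L: "L2 {0<..<1} (\<lambda>x. y s x - y t x)" by (intro L2_diff C0_L2_D[OF y] s t)
      have b: "v s 0 - v t 0 = vl s - vl t" "v s 1 - v t 1 = vr s - vr t"
        using v s t by (auto simp: is_velocity_def)
      note eb = elliptic_bound[OF u p L2_imp_absolutely_integrable[OF L] refl x]
      have "11 * (\<bar>v s 0 - v t 0\<bar> + \<bar>v s 1 - v t 1\<bar> + integral {0..1} (\<lambda>x. \<bar>y s x - y t x\<bar>)) \<le> m s"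
        unfolding b m_def using integral_abs_le_L2_norm[OF L] by simp
      then show ?thesis using eb by linarith
    qed
    show ?thesis
    proof (intro exI[of _ d] conjI ballI impI d(1))
      fix s x assume s: "s \<in> {0..T}" "dist s t < d" and x: "x \<in> {0..1::real}"
      show "\<bar>v s x - v t x\<bar> < e" "\<bar>dx v s x - dx v t x\<bar> < e"
        using d(2)[OF s(1) _ s(2)] bd[OF s(1) x] e by (cases "s = t"; simp)+
    qed
  qed
  show "sup_continuous_on T v" "sup_continuous_on T (dx v)"
    unfolding sup_continuous_on_def using key by blast+
qed

lemma velocity_jointly_continuous:
  assumes v: "is_velocity T \<kappa> vl vr y v" and y: "C0_L2 T y"
    and vl: "continuous_on {0..T} vl" and vr: "continuous_on {0..T} vr"
  shows "continuous_on ({0..T} \<times> {0..1}) (\<lambda>p. v (fst p) (snd p))"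
    "continuous_on ({0..T} \<times> {0..1}) (\<lambda>p. dx v (fst p) (snd p))"
  unfolding continuous_on_rectangle_iff
  using velocity_sup_continuous[OF assms] is_velocity_prim_dx[OF v C0_L2_D[OF y]] prim_continuous by blast+

lemma continuous_rectangle_bounded:
  fixes f :: "real \<Rightarrow> real \<Rightarrow> real"
  assumes "continuous_on ({0..T} \<times> {0..1}) (\<lambda>p. f (fst p) (snd p))"
  obtains K where "K \<ge> 0" "\<And>t x. t \<in> {0..T} \<Longrightarrow> x \<in> {0..1} \<Longrightarrow> \<bar>f t x\<bar> \<le> (K::real)"
proof -
  have "bounded ((\<lambda>p. f (fst p) (snd p)) ` ({0..T} \<times> {0..1}))"
    by (intro compact_imp_bounded compact_continuous_image assms compact_Times compact_Icc)
  then obtain K where K: "\<And>p. p \<in> {0..T} \<times> {0..1} \<Longrightarrow> \<bar>f (fst p) (snd p)\<bar> \<le> K"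
    unfolding bounded_iff real_norm_def by blast
  show ?thesis
  proof (rule that[of "max K 0"])
    show "\<bar>f t x\<bar> \<le> max K 0" if "t \<in> {0..T}" "x \<in> {0..1}" for t x
      using K[of "(t,x)"] that by auto
  qed simp
qed

text \<open>Split as \<open>(y s - y t) * c s + y t * (c s - c t)\<close>: the first part is small
  because \<open>y\<close> is continuous into L2, the second because \<open>c\<close> is sup-norm
  continuous. It makes the time integrands of the weak form continuous, so that their integrals are
  differentiable at every interior time.\<close>

lemma pairing_continuous:
  assumes y: "C0_L2 T y" and c: "continuous_on ({0..T} \<times> {0..1}) (\<lambda>p. c (fst p) (snd p))"
  shows "continuous_on {0..T} (\<lambda>t. integral {0..1} (\<lambda>x. y t x * c t x))"
  unfolding continuous_on
proof
  fix t assume t: "t \<in> {0..T}"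
  obtain K where K: "K \<ge> 0" "\<And>t x. t \<in> {0..T} \<Longrightarrow> x \<in> {0..1} \<Longrightarrow> \<bar>c t x\<bar> \<le> K"
    using continuous_rectangle_bounded[OF c] by blast
  have sc: "sup_continuous_on T c" and cc: "\<And>t. t \<in> {0..T} \<Longrightarrow> continuous_on {0..1} (c t)"
    using c unfolding continuous_on_rectangle_iff by auto
  define A where "A = integral {0..1} (\<lambda>x. \<bar>y t x\<bar>)"
  have yi: "y s absolutely_integrable_on {0..1}" if "s \<in> {0..T}" for s
    by (rule L2_imp_absolutely_integrable[OF C0_L2_D[OF y that]])
  have A: "A \<ge> 0" unfolding A_def using yi[OF t] by (intro integral_nonneg) (auto simp: absolutely_integrable_on_def)
  have bd: "\<bar>integral {0..1} (\<lambda>x. y s x * c s x) - integral {0..1} (\<lambda>x. y t x * c t x)\<bar>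
      \<le> K * L2_norm {0<..<1} (\<lambda>x. y s x - y t x) + e * A"
    if s: "s \<in> {0..T}" and e: "\<And>x. x \<in> {0..1} \<Longrightarrow> \<bar>c s x - c t x\<bar> \<le> e" for s e
  proof -
    note li = set_lebesgue_integral_eq_integral(1)
    have L: "L2 {0<..<1} (\<lambda>x. y s x - y t x)" by (intro L2_diff C0_L2_D[OF y] s t)
    note Li = L2_imp_absolutely_integrable[OF L]
    have cd: "continuous_on {0..1} (\<lambda>x. c s x - c t x)" by (intro continuous_intros cc s t)
    have i: "(\<lambda>x. (y s x - y t x) * c s x) integrable_on {0..1}" "(\<lambda>x. y t x * (c s x - c t x)) integrable_on {0..1}"
      "(\<lambda>x. y s x * c s x) integrable_on {0..1}" "(\<lambda>x. y t x * c t x) integrable_on {0..1}"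
      by (rule li[OF abs_integrable_mult_cont]; intro Li cc s t yi cd)+
    have "integral {0..1} (\<lambda>x. y s x * c s x) - integral {0..1} (\<lambda>x. y t x * c t x)
      = integral {0..1} (\<lambda>x. y s x * c s x - y t x * c t x)"
      by (rule Henstock_Kurzweil_Integration.integral_diff[symmetric]; fact)
    also have "\<dots> = integral {0..1} (\<lambda>x. (y s x - y t x) * c s x + y t x * (c s x - c t x))"
      by (rule integral_cong) (simp add: algebra_simps)
    also have "\<dots> = integral {0..1} (\<lambda>x. (y s x - y t x) * c s x) + integral {0..1} (\<lambda>x. y t x * (c s x - c t x))"
      by (rule Henstock_Kurzweil_Integration.integral_add; fact)
    finally have eq: "integral {0..1} (\<lambda>x. y s x * c s x) - integral {0..1} (\<lambda>x. y t x * c t x)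
      = integral {0..1} (\<lambda>x. (y s x - y t x) * c s x) + integral {0..1} (\<lambda>x. y t x * (c s x - c t x))" .
    have "\<bar>integral {0..1} (\<lambda>x. (y s x - y t x) * c s x)\<bar> \<le> K * integral {0..1} (\<lambda>x. \<bar>y s x - y t x\<bar>)"
      by (rule abs_integral_mult_le[OF Li cc[OF s] K(2)[OF s]])
    also have "\<dots> \<le> K * L2_norm {0<..<1} (\<lambda>x. y s x - y t x)"
      by (intro mult_left_mono integral_abs_le_L2_norm[OF L] K)
    finally have 1: "\<bar>integral {0..1} (\<lambda>x. (y s x - y t x) * c s x)\<bar> \<le> K * L2_norm {0<..<1} (\<lambda>x. y s x - y t x)" .
    have "\<bar>integral {0..1} (\<lambda>x. y t x * (c s x - c t x))\<bar> \<le> e * A"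
      unfolding A_def by (rule abs_integral_mult_le[OF yi[OF t] cd e])
    then show ?thesis using 1 unfolding eq by linarith
  qed
  show "((\<lambda>t. integral {0..1} (\<lambda>x. y t x * c t x)) \<longlongrightarrow> integral {0..1} (\<lambda>x. y t x * c t x)) (at t within {0..T})"
  proof (rule tendstoI)
    fix e :: real assume e: "e > 0"
    \<comment> \<open>\<open>A + 1\<close> in place of \<open>A\<close> avoids a division by
      zero.\<close>
    define e' where "e' = e / (2 * (A + 1))"
    have e': "e' > 0" "e' * A < e / 2"
      using e A by (auto simp: e'_def field_simps)
    obtain d where d: "d > 0" "\<And>s x. s \<in> {0..T} \<Longrightarrow> dist s t < d \<Longrightarrow> x \<in> {0..1} \<Longrightarrow> \<bar>c s x - c t x\<bar> < e'"
      using sc[unfolded sup_continuous_on_def, rule_format, OF t e'(1)] by auto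
    have "((\<lambda>s. K * L2_norm {0<..<1} (\<lambda>x. y s x - y t x)) \<longlongrightarrow> K * 0) (at t within {0..T})"
      by (intro tendsto_intros C0_L2_tendsto[OF y t])
    then have "\<forall>\<^sub>F s in at t within {0..T}. K * L2_norm {0<..<1} (\<lambda>x. y s x - y t x) < e / 2"
      by (rule order_tendstoD(2)) (use e in simp)
    moreover have "\<forall>\<^sub>F s in at t within {0..T}. s \<in> {0..T} \<and> dist s t < d"
      unfolding eventually_at using d(1) by auto
    ultimately show "\<forall>\<^sub>F s in at t within {0..T}. dist (integral {0..1} (\<lambda>x. y s x * c s x)) (integral {0..1} (\<lambda>x. y t x * c t x)) < e"
    proof eventually_elim
      case (elim s)
      have "\<bar>c s x - c t x\<bar> \<le> e'" if "x \<in> {0..1}" for x using d(2)[of s x] elim that by auto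
      then show ?case using bd[of s e'] elim e'(2) by (auto simp: dist_real_def)
    qed
  qed
qed

lemma C0_L2_bounded:
  assumes y: "C0_L2 T y" and T: "0 \<le> T"
  obtains Y where "\<And>t. t \<in> {0..T} \<Longrightarrow> integral {0..1} (\<lambda>x. (y t x)\<^sup>2) \<le> Y"
proof -
  have "continuous_on {0..T} (\<lambda>t. integral {0..1} (\<lambda>x. (y t x)\<^sup>2))"
    unfolding continuous_on
  proof
    fix t assume t: "t \<in> {0..T}"
    define N where "N s = L2_norm {0<..<1} (\<lambda>x. y s x - y t x)" for s
    have "(N \<longlongrightarrow> 0) (at t within {0..T})" unfolding N_def by (rule C0_L2_tendsto[OF y t])
    then have "((\<lambda>s. (N s)\<^sup>2 + 2 * (N s * L2_norm {0<..<1} (y t))) \<longlongrightarrow> 0\<^sup>2 + 2 * (0 * L2_norm {0<..<1} (y t))) (at t within {0..T})"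
      by (intro tendsto_intros)
    then have lim: "((\<lambda>s. (N s)\<^sup>2 + 2 * (N s * L2_norm {0<..<1} (y t))) \<longlongrightarrow> 0) (at t within {0..T})" by simp
    have "((\<lambda>s. integral {0..1} (\<lambda>x. (y s x)\<^sup>2) - integral {0..1} (\<lambda>x. (y t x)\<^sup>2)) \<longlongrightarrow> 0) (at t within {0..T})"
    proof (rule Lim_null_comparison[OF _ lim])
      show "\<forall>\<^sub>F s in at t within {0..T}. norm (integral {0..1} (\<lambda>x. (y s x)\<^sup>2) - integral {0..1} (\<lambda>x. (y t x)\<^sup>2)) \<le> (N s)\<^sup>2 + 2 * (N s * L2_norm {0<..<1} (y t))"
        unfolding eventually_at
      proof (intro exI[of _ 1] conjI ballI impI zero_less_one)
        fix s assume s: "s \<in> {0..T}"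
        note Ls = C0_L2_D[OF y s] and Lt = C0_L2_D[OF y t]
        note L = L2_diff[OF Ls Lt]
        note i = L2_imp_absolutely_integrable_square[OF Ls] L2_imp_absolutely_integrable_square[OF Lt]
          L2_imp_absolutely_integrable_square[OF L] L2_mult_absolutely_integrable[OF L Lt]
        note i' = i[THEN set_lebesgue_integral_eq_integral(1)]
        have "integral {0..1} (\<lambda>x. (y s x)\<^sup>2) - integral {0..1} (\<lambda>x. (y t x)\<^sup>2) = integral {0..1} (\<lambda>x. (y s x)\<^sup>2 - (y t x)\<^sup>2)"
          using i' by (simp add: Henstock_Kurzweil_Integration.integral_diff)
        also have "\<dots> = integral {0..1} (\<lambda>x. (y s x - y t x)\<^sup>2 + 2 * ((y s x - y t x) * y t x))"
          by (rule integral_cong) (simp add: power2_eq_square algebra_simps)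
        also have "\<dots> = (N s)\<^sup>2 + 2 * integral {0..1} (\<lambda>x. (y s x - y t x) * y t x)"
          unfolding N_def L2_norm_square[OF L]
          by (subst Henstock_Kurzweil_Integration.integral_add[OF i'(3) integrable_on_mult_right[OF i'(4)]]) simp
        finally have "integral {0..1} (\<lambda>x. (y s x)\<^sup>2) - integral {0..1} (\<lambda>x. (y t x)\<^sup>2) = (N s)\<^sup>2 + 2 * integral {0..1} (\<lambda>x. (y s x - y t x) * y t x)" .
        moreover have "\<bar>integral {0..1} (\<lambda>x. (y s x - y t x) * y t x)\<bar> \<le> N s * L2_norm {0<..<1} (y t)"
          unfolding N_def by (rule Cauchy_Schwarz_L2[OF L Lt])
        moreover have "0 \<le> (N s)\<^sup>2" by simp
        ultimately show "norm (integral {0..1} (\<lambda>x. (y s x)\<^sup>2) - integral {0..1} (\<lambda>x. (y t x)\<^sup>2)) \<le> (N s)\<^sup>2 + 2 * (N s * L2_norm {0<..<1} (y t))"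
          unfolding real_norm_def by linarith
      qed
    qed
    then show "((\<lambda>t. integral {0..1} (\<lambda>x. (y t x)\<^sup>2)) \<longlongrightarrow> integral {0..1} (\<lambda>x. (y t x)\<^sup>2)) (at t within {0..T})"
      by (simp add: LIM_zero_iff)
  qed
  then have "bounded ((\<lambda>t. integral {0..1} (\<lambda>x. (y t x)\<^sup>2)) ` {0..T})"
    by (intro compact_imp_bounded compact_continuous_image compact_Icc)
  then obtain Y where "\<forall>t\<in>{0..T}. \<bar>integral {0..1} (\<lambda>x. (y t x)\<^sup>2)\<bar> \<le> Y" by (auto simp: bounded_iff)
  then show ?thesis by (intro that[of Y]) (meson abs_le_D1)
qed

lemma C0_L2_minus_const: "C0_L2 T y \<Longrightarrow> C0_L2 T (\<lambda>t x. y t x - k)"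
  unfolding C0_L2_def by (auto intro!: L2_diff[OF _ L2_continuous[OF continuous_on_const]])

section \<open>The weak formulation for functions of space only\<close>

text \<open>Fubini for \<open>lebesgue_on\<close>, through a Borel representative whose slices agree
  with those of \<open>f\<close> for almost every \<open>t\<close>. Continuity of the inner integral
  \<open>H\<close> turns the outer one into a gauge integral over the closed interval.\<close>

lemma lebesgue_on_rectangle_eq_iterated:
  fixes f :: "real \<times> real \<Rightarrow> real"
  assumes f: "f absolutely_integrable_on {a<..<b} \<times> {c<..<d}"
    and sl: "\<And>t. t \<in> {a<..<b} \<Longrightarrow> (\<lambda>x. f (t, x)) absolutely_integrable_on {c..d}"
    and H: "\<And>t. t \<in> {a<..<b} \<Longrightarrow> integral {c..d} (\<lambda>x. f (t, x)) = H t" "continuous_on {a..b} H"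
  shows "(\<integral>p. f p \<partial>lebesgue_on ({a<..<b} \<times> {c<..<d})) = integral {a..b} H"
proof -
  let ?R = "{a<..<b} \<times> {c<..<d}"
  have R: "?R \<in> sets lebesgue" by (intro sets_completionI_sets) (simp add: borel_open open_Times)
  define h where "h p = indicator ?R p * f p" for p
  have hl: "integrable lebesgue h" using f by (simp add: set_integrable_def h_def[abs_def])
  then obtain h' where h': "h' \<in> borel_measurable lborel" "AE p in lborel. h p = h' p"
    using completion_ex_borel_measurable_real[of h lborel] by auto
  have ae: "AE p in lebesgue. h p = h' p" using h'(2) by (rule AE_completion)
  have h'm: "h' \<in> borel_measurable lebesgue" using h'(1) by (rule measurable_completion)
  have "integrable lebesgue h'" by (rule integrable_cong_AE_imp[OF hl h'm ae])
  then have h'b: "integrable (lborel \<Otimes>\<^sub>M lborel) h'"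
    using h'(1) by (simp add: integrable_completion lborel_prod)
  have "(\<integral>p. f p \<partial>lebesgue_on ?R) = (LINT p|lebesgue. h p)"
    unfolding h_def using R by (subst integral_restrict_space) auto
  also have "\<dots> = (LINT p|lebesgue. h' p)"
    by (rule integral_cong_AE) (use hl h'm ae in auto)
  also have "\<dots> = (\<integral>p. h' p \<partial>(lborel \<Otimes>\<^sub>M lborel))"
    using h'(1) by (simp add: integral_completion lborel_prod)
  also have "\<dots> = (LINT t|lborel. LINT x|lborel. h' (t, x))"
    by (rule lborel_pair.integral_fst'[OF h'b, symmetric])
  also have "\<dots> = (LINT t|lborel. indicator {a..b} t *\<^sub>R H t)"
  proof (rule integral_cong_AE)
    have "AE t in lborel. AE x in lborel. h (t, x) = h' (t, x)"
      by (rule lborel_pair.AE_pair) (use h'(2) in \<open>simp only: lborel_prod\<close>)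
    then show "AE t in lborel. (LINT x|lborel. h' (t, x)) = indicator {a..b} t *\<^sub>R H t"
      using AE_lborel_singleton[of a] AE_lborel_singleton[of b]
    proof eventually_elim
      case (elim t)
      have m: "(\<lambda>x. h' (t, x)) \<in> borel_measurable lborel"
        using h'(1) by simp
      have ae: "AE x in lebesgue. h (t, x) = h' (t, x)" using elim(1) by (rule AE_completion)
      show ?case
      proof (cases "t \<in> {a<..<b}")
        case True
        have i: "(\<lambda>x. f (t, x)) absolutely_integrable_on {c<..<d}"
          using sl[OF True] absolutely_integrable_on_Icc_iff_Ioo by blast
        have "(LINT x|lborel. h' (t, x)) = (LINT x|lebesgue. h' (t, x))"
          by (rule integral_completion[OF m, symmetric])
        also have "\<dots> = (LINT x|lebesgue. indicator {c<..<d} x *\<^sub>R f (t, x))"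
        proof (rule integral_cong_AE)
          show "(\<lambda>x. h' (t, x)) \<in> borel_measurable lebesgue" using m by (rule measurable_completion)
          show "(\<lambda>x. indicator {c<..<d} x *\<^sub>R f (t, x)) \<in> borel_measurable lebesgue"
            using i unfolding set_integrable_def by (rule borel_measurable_integrable)
          show "AE x in lebesgue. h' (t, x) = indicator {c<..<d} x *\<^sub>R f (t, x)"
            using ae by eventually_elim (use True in \<open>auto simp: h_def indicator_def\<close>)
        qed
        also have "\<dots> = integral {c<..<d} (\<lambda>x. f (t, x))"
          using set_lebesgue_integral_eq_integral(2)[OF i] by (simp add: set_lebesgue_integral_def)
        also have "\<dots> = H t" using H(1)[OF True] by (simp add: integral_open_interval_real)
        finally show ?thesis using True by simp
      next
        case False
        have "(LINT x|lborel. h' (t, x)) = 0"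
        proof (rule integral_eq_zero_AE)
          show "AE x in lborel. h' (t, x) = 0"
            using elim(1) by eventually_elim (use False in \<open>auto simp: h_def\<close>)
        qed
        then show ?thesis using False elim by (auto simp: indicator_def)
      qed
    qed
    show "(\<lambda>t. LINT x|lborel. h' (t, x)) \<in> borel_measurable lborel"
      using lborel_pair.integrable_fst'[OF h'b] by (rule borel_measurable_integrable)
    show "(\<lambda>t. indicat_real {a..b} t *\<^sub>R H t) \<in> borel_measurable lborel"
      using borel_measurable_continuous_on_indicator[OF _ H(2)] by simp
  qed
  also have "\<dots> = integral {a..b} H"
    using set_borel_integral_eq_integral(2)[OF borel_integrable_atLeastAtMost'[OF H(2)]]
    by (simp add: set_lebesgue_integral_def)
  finally show ?thesis .
qed

section \<open>Integrals and test functions on a space-time rectangle\<close>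

lemma rect_lebesgue: "rect t0 t1 \<in> sets lebesgue"
  unfolding rect_def by (intro sets_completionI_sets) (simp add: borel_open open_Times)

lemma continuous_abs_integrable_rect:
  fixes h :: "real \<times> real \<Rightarrow> real"
  assumes "continuous_on ({t0..t1} \<times> {0..1}) h" "S \<in> sets lebesgue" "S \<subseteq> {t0..t1} \<times> {0..1}"
  shows "h absolutely_integrable_on S"
proof -
  have "h absolutely_integrable_on cbox (t0, 0) (t1, 1)"
    by (rule absolutely_integrable_continuous) (use assms(1) in \<open>simp add: cbox_Pair_eq\<close>)
  then show ?thesis
    by (rule set_integrable_subset) (use assms in \<open>auto simp: cbox_Pair_eq\<close>)
qed

lemma rect_subset: "rect t0 t1 \<subseteq> {t0..t1} \<times> {0..1}"
  by (auto simp: rect_def)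

lemma continuous_L2_rect:
  fixes h :: "real \<times> real \<Rightarrow> real"
  assumes c: "continuous_on ({t0..t1} \<times> {0..1}) h"
  shows "L2 (rect t0 t1) h"
  unfolding L2_def
proof
  show "h \<in> borel_measurable (lebesgue_on (rect t0 t1))"
    by (rule absolutely_integrable_imp_borel_measurable[OF continuous_abs_integrable_rect[OF c rect_lebesgue rect_subset] rect_lebesgue])
  have "continuous_on ({t0..t1} \<times> {0..1}) (\<lambda>p. (h p)\<^sup>2)" by (intro continuous_intros c)
  from continuous_abs_integrable_rect[OF this rect_lebesgue rect_subset]
  show "integrable (lebesgue_on (rect t0 t1)) (\<lambda>p. (h p)\<^sup>2)"
    by (rule absolutely_integrable_imp_integrable[OF _ rect_lebesgue])
qed

lemma continuous_rect_iterated: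
  fixes h :: "real \<times> real \<Rightarrow> real"
  assumes c: "continuous_on ({t0..t1} \<times> {0..1}) h"
  shows "(\<integral>p. h p \<partial>lebesgue_on (rect t0 t1)) = integral {t0..t1} (\<lambda>t. integral {0..1} (\<lambda>x. h (t, x)))"
  unfolding rect_def
proof (rule lebesgue_on_rectangle_eq_iterated)
  show "h absolutely_integrable_on {t0<..<t1} \<times> {0<..<1}"
    using continuous_abs_integrable_rect[OF c rect_lebesgue rect_subset] by (simp add: rect_def)
  show "(\<lambda>x. h (t, x)) absolutely_integrable_on {0..1}" if "t \<in> {t0<..<t1}" for t
    by (rule absolutely_integrable_continuous_real, rule continuous_on_compose2[OF c])
      (use that in \<open>auto intro!: continuous_intros\<close>)
  have "continuous_on {t0..t1} (\<lambda>t. integral (cbox 0 1) (\<lambda>x. h (t, x)))"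
    by (rule integral_continuous_on_param) (use c in \<open>simp add: case_prod_unfold\<close>)
  then show "continuous_on {t0..t1} (\<lambda>t. integral {0..1} (\<lambda>x. h (t, x)))" by simp
qed simp

text \<open>Admits time-independent test functions. Being C1 on the closed rectangle, such a
  function is its own trace and its own constant approximating sequence; its weak derivatives follow
  from Fubini and the fundamental theorem along one variable.\<close>

lemma H1_rect_space_function:
  assumes t: "t0 < t1"
    and d: "\<And>x. x \<in> {0..1} \<Longrightarrow> (\<psi> has_real_derivative \<psi>' x) (at x within {0..1})"
    and c': "continuous_on {0..1} \<psi>'"
  shows "H1_rect t0 t1 (\<lambda>p. \<psi> (snd p)) (\<lambda>p. 0) (\<lambda>p. \<psi>' (snd p)) (\<lambda>p. \<psi> (snd p))"
proof -
  let ?B = "{t0..t1} \<times> {0..1::real}"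
  have c: "continuous_on {0..1} \<psi>" using d by (meson DERIV_continuous continuous_on_eq_continuous_within)
  have sB: "snd ` ?B \<subseteq> {0..1}" by auto
  have cB: "continuous_on ?B (\<lambda>p. \<psi> (snd p))" "continuous_on ?B (\<lambda>p. \<psi>' (snd p))"
    using sB by (auto intro!: continuous_on_compose2[OF c] continuous_on_compose2[OF c'] continuous_intros)
  define D where "D p = \<psi>' (snd p) *\<^sub>R (snd_blinfun :: (real \<times> real) \<Rightarrow>\<^sub>L real)" for p :: "real \<times> real"
  have C1: "C1_on ?B (\<lambda>p. \<psi> (snd p)) D"
    unfolding C1_on_def
  proof (intro conjI ballI)
    show "continuous_on ?B D" unfolding D_def by (intro continuous_intros cB)
    fix p assume p: "p \<in> ?B"
    have "(\<psi> has_derivative (*) (\<psi>' (snd p))) (at (snd p) within snd ` ?B)"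
      using has_derivative_subset[OF d[of "snd p", unfolded has_field_derivative_def] sB] p by auto
    then have "((\<lambda>p. \<psi> (snd p)) has_derivative (\<lambda>h. \<psi>' (snd p) * snd h)) (at p within ?B)"
      by (rule has_derivative_in_compose[OF _ , rotated]) (auto intro!: derivative_eq_intros)
    moreover have "blinfun_apply (D p) = (\<lambda>h. \<psi>' (snd p) * snd h)"
      by (auto simp: D_def blinfun.scaleR_left)
    ultimately show "((\<lambda>p. \<psi> (snd p)) has_derivative blinfun_apply (D p)) (at p within ?B)" by simp
  qed
  have test: "\<And>p. p \<notin> rect t0 t1 \<Longrightarrow> \<eta> p = 0" "continuous_on UNIV \<eta>'"
      "\<And>p. (\<eta> has_derivative blinfun_apply (\<eta>' p)) (at p)" "continuous_on UNIV \<eta>"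
    if "test_function (rect t0 t1) \<eta> \<eta>'" for \<eta> \<eta>'
  proof -
    show "\<And>p. p \<notin> rect t0 t1 \<Longrightarrow> \<eta> p = 0" "continuous_on UNIV \<eta>'"
      and d: "\<And>p. (\<eta> has_derivative blinfun_apply (\<eta>' p)) (at p)"
      using that unfolding test_function_def C1_on_def by blast+
    show "continuous_on UNIV \<eta>"
      using d has_derivative_continuous continuous_at_imp_continuous_on by blast
  qed
  have loc: "h absolutely_integrable_on K" if "continuous_on ?B h" "compact K \<and> K \<subseteq> rect t0 t1" for h :: "real \<times> real \<Rightarrow> real" and K
    using that rect_subset[of t0 t1] lmeasurable_compact fmeasurableD by (intro continuous_abs_integrable_rect) blast+
  have wt: "has_weak_deriv (rect t0 t1) (1, 0) (\<lambda>p. \<psi> (snd p)) (\<lambda>p. 0)"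
    unfolding has_weak_deriv_def
  proof (intro conjI allI impI)
    fix \<eta> \<eta>' assume te: "test_function (rect t0 t1) \<eta> \<eta>'"
    note te = test[OF te]
    have ch: "continuous_on ?B (\<lambda>p. \<psi> (snd p) * blinfun_apply (\<eta>' p) (1, 0))"
      by (intro continuous_intros cB continuous_on_subset[OF te(2)]) auto
    have "(\<integral>p. \<psi> (snd p) * blinfun_apply (\<eta>' p) (1, 0) \<partial>lebesgue_on (rect t0 t1)) =
      integral {t0..t1} (\<lambda>t. integral {0..1} (\<lambda>x. \<psi> x * blinfun_apply (\<eta>' (t, x)) (1, 0)))"
      using continuous_rect_iterated[OF ch] by simp
    \<comment> \<open>With \<open>t\<close> as the inner variable, the integral of the time
      derivative of \<open>\<eta>\<close> vanishes, because \<open>\<eta>\<close> is zero on the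
      boundary.\<close>
    also have "\<dots> = integral {0..1} (\<lambda>x. integral {t0..t1} (\<lambda>t. \<psi> x * blinfun_apply (\<eta>' (t, x)) (1, 0)))"
      using integral_swap_continuous[of t0 0 t1 1 "\<lambda>t x. \<psi> x * blinfun_apply (\<eta>' (t, x)) (1, 0)"] ch
      by (simp add: case_prod_unfold cbox_Pair_eq)
    also have "\<dots> = integral {0..1} (\<lambda>x::real. 0)"
    proof (rule integral_cong)
      fix x :: real assume x: "x \<in> {0..1}"
      have "((\<lambda>t. blinfun_apply (\<eta>' (t, x)) (1, 0)) has_integral \<eta> (t1, x) - \<eta> (t0, x)) {t0..t1}"
      proof (rule fundamental_theorem_of_calculus)
        fix t
        have "((\<lambda>t. \<eta> (t, x)) has_derivative (\<lambda>h. blinfun_apply (\<eta>' (t, x)) (h, 0))) (at t within {t0..t1})"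
          by (rule has_derivative_compose[OF has_derivative_Pair[OF has_derivative_ident has_derivative_const] te(3)])
        moreover have "(\<lambda>h. blinfun_apply (\<eta>' (t, x)) (h, 0)) = (\<lambda>h. h *\<^sub>R blinfun_apply (\<eta>' (t, x)) (1, 0))"
        proof
          show "blinfun_apply (\<eta>' (t, x)) (h, 0) = h *\<^sub>R blinfun_apply (\<eta>' (t, x)) (1, 0)" for h
            unfolding blinfun.scaleR_right[symmetric] by simp
        qed
        ultimately show "((\<lambda>t. \<eta> (t, x)) has_vector_derivative blinfun_apply (\<eta>' (t, x)) (1, 0)) (at t within {t0..t1})"
          unfolding has_vector_derivative_def by (simp only:)
      qed (use t in simp)
      moreover have "\<eta> (t1, x) = 0" "\<eta> (t0, x) = 0" by (auto intro!: te(1) simp: rect_def)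
      ultimately show "integral {t0..t1} (\<lambda>t. \<psi> x * blinfun_apply (\<eta>' (t, x)) (1, 0)) = 0"
        by (simp add: integral_unique)
    qed
    finally show "(\<integral>p. \<psi> (snd p) * blinfun_apply (\<eta>' p) (1, 0) \<partial>lebesgue_on (rect t0 t1)) = - (\<integral>p. 0 * \<eta> p \<partial>lebesgue_on (rect t0 t1))"
      by simp
  qed (use loc cB in auto)
  have wx: "has_weak_deriv (rect t0 t1) (0, 1) (\<lambda>p. \<psi> (snd p)) (\<lambda>p. \<psi>' (snd p))"
    unfolding has_weak_deriv_def
  proof (intro conjI allI impI)
    fix \<eta> \<eta>' assume te: "test_function (rect t0 t1) \<eta> \<eta>'"
    note te = test[OF te]
    have ch: "continuous_on ?B (\<lambda>p. \<psi> (snd p) * blinfun_apply (\<eta>' p) (0, 1))" "continuous_on ?B (\<lambda>p. \<psi>' (snd p) * \<eta> p)"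
      by (intro continuous_intros cB continuous_on_subset[OF te(2)] continuous_on_subset[OF te(4)]; simp)+
    have i: "integrable (lebesgue_on (rect t0 t1)) (\<lambda>p. \<psi> (snd p) * blinfun_apply (\<eta>' p) (0, 1))"
       "integrable (lebesgue_on (rect t0 t1)) (\<lambda>p. \<psi>' (snd p) * \<eta> p)"
      by (rule absolutely_integrable_imp_integrable[OF continuous_abs_integrable_rect[OF _ rect_lebesgue rect_subset] rect_lebesgue]; fact ch)+
    have "(\<integral>p. \<psi> (snd p) * blinfun_apply (\<eta>' p) (0, 1) \<partial>lebesgue_on (rect t0 t1)) + (\<integral>p. \<psi>' (snd p) * \<eta> p \<partial>lebesgue_on (rect t0 t1))
      = (\<integral>p. \<psi> (snd p) * blinfun_apply (\<eta>' p) (0, 1) + \<psi>' (snd p) * \<eta> p \<partial>lebesgue_on (rect t0 t1))"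
      using i by simp
    also have "\<dots> = integral {t0..t1} (\<lambda>t. integral {0..1} (\<lambda>x. \<psi> x * blinfun_apply (\<eta>' (t, x)) (0, 1) + \<psi>' x * \<eta> (t, x)))"
      using continuous_rect_iterated[OF continuous_on_add[OF ch]] by simp
    also have "\<dots> = integral {t0..t1} (\<lambda>t::real. 0)"
    proof (rule integral_cong)
      fix t :: real
      have "((\<lambda>x. \<psi> x * blinfun_apply (\<eta>' (t, x)) (0, 1) + \<psi>' x * \<eta> (t, x)) has_integral \<psi> 1 * \<eta> (t, 1) - \<psi> 0 * \<eta> (t, 0)) {0..1}"
      proof (rule fundamental_theorem_of_calculus)
        fix x :: real assume x: "x \<in> {0..1}"
        have "((\<lambda>x. \<eta> (t, x)) has_derivative (\<lambda>h. blinfun_apply (\<eta>' (t, x)) (0, h))) (at x within {0..1})"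
          by (rule has_derivative_compose[OF has_derivative_Pair[OF has_derivative_const has_derivative_ident] te(3)])
        moreover have "(\<lambda>h. blinfun_apply (\<eta>' (t, x)) (0, h)) = (*) (blinfun_apply (\<eta>' (t, x)) (0, 1))"
        proof
          show "blinfun_apply (\<eta>' (t, x)) (0, h) = blinfun_apply (\<eta>' (t, x)) (0, 1) * h" for h
            using blinfun.scaleR_right[of "\<eta>' (t, x)" h "(0, 1)"] by (simp add: mult.commute)
        qed
        ultimately have "((\<lambda>x. \<eta> (t, x)) has_real_derivative blinfun_apply (\<eta>' (t, x)) (0, 1)) (at x within {0..1})"
          unfolding has_field_derivative_def by (simp only:)
        from DERIV_mult[OF d[OF x] this]
        show "((\<lambda>x. \<psi> x * \<eta> (t, x)) has_vector_derivative \<psi> x * blinfun_apply (\<eta>' (t, x)) (0, 1) + \<psi>' x * \<eta> (t, x)) (at x within {0..1})"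
          unfolding has_real_derivative_iff_has_vector_derivative[symmetric] by (simp add: algebra_simps)
      qed simp
      moreover have "\<eta> (t, 1) = 0" "\<eta> (t, 0) = 0" by (auto intro!: te(1) simp: rect_def)
      ultimately show "integral {0..1} (\<lambda>x. \<psi> x * blinfun_apply (\<eta>' (t, x)) (0, 1) + \<psi>' x * \<eta> (t, x)) = 0"
        by (simp add: integral_unique)
    qed
    finally show "(\<integral>p. \<psi> (snd p) * blinfun_apply (\<eta>' p) (0, 1) \<partial>lebesgue_on (rect t0 t1)) = - (\<integral>p. \<psi>' (snd p) * \<eta> p \<partial>lebesgue_on (rect t0 t1))"
      by simp
  qed (use loc cB in auto)
  have L2i: "L2 {a..b} h" if "continuous_on {a..b} h" for a b and h :: "real \<Rightarrow> real"
    unfolding L2_def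
  proof
    show "h \<in> borel_measurable (lebesgue_on {a..b})"
      by (rule continuous_imp_measurable_on_sets_lebesgue[OF that]) simp
    have "continuous_on {a..b} (\<lambda>x. (h x)\<^sup>2)" by (intro continuous_intros that)
    then show "integrable (lebesgue_on {a..b}) (\<lambda>x. (h x)\<^sup>2)"
      by (rule continuous_imp_integrable_real)
  qed
  have sides: "L2_sides t0 t1 (\<lambda>p. \<psi> (snd p))"
    unfolding L2_sides_def using L2i c by auto
  have zero: "L2_norm S (\<lambda>p. 0) = 0" for S :: "'z::euclidean_space set" by (simp add: L2_norm_def)
  show ?thesis
    unfolding H1_rect_def
  proof (intro conjI)
    show "\<exists>\<psi>s \<psi>s'. (\<forall>n::nat. C1_on ?B (\<psi>s n) (\<psi>s' n)) \<and>
        (\<lambda>n. L2_norm (rect t0 t1) (\<lambda>p. \<psi>s n p - \<psi> (snd p))) \<longlonglongrightarrow> 0 \<and>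
        (\<lambda>n. L2_norm (rect t0 t1) (\<lambda>p. blinfun_apply (\<psi>s' n p) (1, 0) - 0)) \<longlonglongrightarrow> 0 \<and>
        (\<lambda>n. L2_norm (rect t0 t1) (\<lambda>p. blinfun_apply (\<psi>s' n p) (0, 1) - \<psi>' (snd p))) \<longlonglongrightarrow> 0 \<and>
        (\<lambda>n. L2_norm_sides t0 t1 (\<lambda>p. \<psi>s n p - \<psi> (snd p))) \<longlonglongrightarrow> 0"
    proof (intro exI conjI allI)
      show "C1_on ?B (\<lambda>p. \<psi> (snd p)) D" by (rule C1)
    qed (simp_all add: D_def blinfun.scaleR_left zero L2_norm_sides_def)
  qed (use wt wx sides cB continuous_L2_rect in auto)
qed

text \<open>The definition of a weak solution asserts its identity for some velocity; this moves it
  to the given one. The difference of two velocities solves the elliptic problem with zero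
  data.\<close>

lemma velocity_unique:
  assumes v: "is_velocity T \<kappa> vl vr y v" and v': "is_velocity T \<kappa> vl vr y v'" and y: "L2 {0<..<1} (y t)"
    and t: "t \<in> {0..T}" and x: "x \<in> {0..1}"
  shows "v' t x = v t x" "dx v' t x = dx v t x"
proof -
  note p = is_velocity_prim_dx[OF v y t] and p' = is_velocity_prim_dx[OF v' y t]
  have u: "prim (\<lambda>x. v' t x - v t x) (\<lambda>x. dx v' t x - dx v t x)" by (rule prim_diff[OF p'(1) p(1)])
  have q: "prim (\<lambda>x. dx v' t x - dx v t x) (\<lambda>x. (v' t x - v t x) - 0)"
    by (rule prim_cong[OF prim_diff[OF p'(2) p(2)]]) simp_all
  have "v' t 0 - v t 0 = 0" "v' t 1 - v t 1 = 0" using v v' t by (auto simp: is_velocity_def)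
  then have "\<bar>v' t x - v t x\<bar> \<le> 0" "\<bar>dx v' t x - dx v t x\<bar> \<le> 0"
    using elliptic_bound[OF u q absolutely_integrable_zero refl x] by (simp_all only: abs_zero integral_0 add_0 mult_zero_right)
  then show "v' t x = v t x" "dx v' t x = dx v t x" by linarith+
qed

lemma Linf_abs_integrable:
  fixes f c :: "'a::euclidean_space \<Rightarrow> real"
  assumes f: "Linf S f" and S: "S \<in> sets lebesgue" and U: "U \<subseteq> S" "U \<in> lmeasurable"
    and c: "c \<in> borel_measurable (lebesgue_on U)" "\<And>x. x \<in> U \<Longrightarrow> \<bar>c x\<bar> \<le> K"
  shows "(\<lambda>x. f x * c x) absolutely_integrable_on U"
proof -
  obtain M where M: "AE x in lebesgue_on S. \<bar>f x\<bar> \<le> M" using f by (auto simp: Linf_def)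
  have Ul: "U \<in> sets lebesgue" using U by (simp add: fmeasurableD)
  have fm: "f \<in> borel_measurable (lebesgue_on U)"
    using f U(1) unfolding Linf_def by (blast intro: measurable_restrict_mono)
  have "AE x in lebesgue. x \<in> S \<longrightarrow> \<bar>f x\<bar> \<le> M" using M S by (subst (asm) AE_restrict_space_iff) auto
  then have "AE x in lebesgue. x \<in> U \<longrightarrow> \<bar>f x\<bar> \<le> M" by eventually_elim (use U in auto)
  then have ae: "AE x in lebesgue_on U. \<bar>f x\<bar> \<le> M" using Ul by (subst AE_restrict_space_iff) auto
  have ci: "integrable (lebesgue_on U) (\<lambda>x. max M 0 * max K 0)"
    by (rule absolutely_integrable_imp_integrable[OF absolutely_integrable_on_const[OF U(2)] Ul])
  have "integrable (lebesgue_on U) (\<lambda>x. f x * c x)"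
  proof (rule Bochner_Integration.integrable_bound[OF ci])
    show "(\<lambda>x. f x * c x) \<in> borel_measurable (lebesgue_on U)" using fm c(1) by simp
    show "AE x in lebesgue_on U. norm (f x * c x) \<le> norm (max M 0 * max K 0)"
      using ae AE_space
    proof eventually_elim
      case (elim x)
      then have "\<bar>f x\<bar> * \<bar>c x\<bar> \<le> max M 0 * max K 0"
        using c(2)[of x] by (intro mult_mono) (auto simp: space_restrict_space)
      then show ?case by (simp add: abs_mult)
    qed
  qed
  then show ?thesis
    unfolding set_integrable_def using integrable_restrict_space[of U lebesgue "\<lambda>x. f x * c x"] Ul by simp
qed

text \<open>Reduces the definition to what is used later: one spatial test function, an iterated
  integral and the given velocity. Continuity in time of the inner integral, by
  \<open>pairing_continuous\<close>, makes the iteration available.\<close>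

lemma weak_solution_identity:
  assumes ws: "weak_solution T \<kappa> y0 vl vr yrc ylc y yr yl" and v: "is_velocity T \<kappa> vl vr y v"
    and vl: "continuous_on {0..T} vl" and vr: "continuous_on {0..T} vr"
    and t: "0 \<le> t0" "t0 < t1" "t1 < T"
    and d: "\<And>x. x \<in> {0..1} \<Longrightarrow> (\<psi> has_real_derivative \<psi>' x) (at x within {0..1})" and c': "continuous_on {0..1} \<psi>'"
  shows "integral {t0..t1} (\<lambda>t. integral {0..1} (\<lambda>x. y t x * (v t x * \<psi>' x - dx v t x * \<psi> x)))
    = integral {t0..t1} (\<lambda>t. yr t * vr t * \<psi> 1 - yl t * vl t * \<psi> 0)
      + integral {0..1} (\<lambda>x. y t1 x * \<psi> x) - integral {0..1} (\<lambda>x. y t0 x * \<psi> x)"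
    (is "?L = ?B + ?I1 - ?I0")
    and "(\<lambda>t. yr t * vr t * \<psi> 1 - yl t * vl t * \<psi> 0) absolutely_integrable_on {t0..t1}"
proof -
  have yL: "Linf ({0..T} \<times> {0<..<1}) (\<lambda>p. y (fst p) (snd p))" and y: "C0_L2 T y" and yr: "Linf {0..T} yr" and yl: "Linf {0..T} yl"
    using ws by (auto simp: weak_solution_def case_prod_unfold)
  obtain v' where v': "is_velocity T \<kappa> vl vr y v'"
    and id: "\<And>t0 t1 \<phi> \<phi>t \<phi>x \<gamma>. 0 \<le> t0 \<and> t0 \<le> t1 \<and> t1 < T \<and> H1_rect t0 t1 \<phi> \<phi>t \<phi>x \<gamma> \<Longrightarrow>
         (\<integral>(t, x). y t x * \<phi>t (t, x) + y t x * v' t x * \<phi>x (t, x) - y t x * dx v' t x * \<phi> (t, x)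
             \<partial>lebesgue_on (rect t0 t1)) =
         (\<integral>t. yr t * vr t * \<gamma> (t, 1) - yl t * vl t * \<gamma> (t, 0) \<partial>lebesgue_on {t0..t1})
         + (\<integral>x. \<gamma> (t1, x) * y t1 x \<partial>lebesgue_on {0<..<1})
         - (\<integral>x. \<gamma> (t0, x) * y t0 x \<partial>lebesgue_on {0<..<1})"
    using ws unfolding weak_solution_def by blast
  have c: "continuous_on {0..1} \<psi>" using d by (meson DERIV_continuous continuous_on_eq_continuous_within)
  note cv = velocity_jointly_continuous[OF v y vl vr]
  let ?c = "\<lambda>t x. v t x * \<psi>' x - dx v t x * \<psi> x"
  have cc: "continuous_on ({0..T} \<times> {0..1}) (\<lambda>p. ?c (fst p) (snd p))"
  proof -
    have "snd ` ({0..T} \<times> {0..1::real}) \<subseteq> {0..1}" by auto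
    then have "continuous_on ({0..T} \<times> {0..1}) (\<lambda>p. \<psi> (snd p))" "continuous_on ({0..T} \<times> {0..1}) (\<lambda>p. \<psi>' (snd p))"
      by (rule continuous_on_compose2[OF c continuous_on_snd[OF continuous_on_id]],
          rule continuous_on_compose2[OF c' continuous_on_snd[OF continuous_on_id]])
    then show ?thesis by (intro continuous_on_diff continuous_on_mult cv)
  qed
  have sub: "rect t0 t1 \<subseteq> {0..T} \<times> {0<..<1}" "rect t0 t1 \<subseteq> {0..T} \<times> {0..1}" using t by (auto simp: rect_def)
  have cR: "continuous_on (rect t0 t1) (\<lambda>p. ?c (fst p) (snd p))"
    by (rule continuous_on_subset[OF cc sub(2)])
  obtain K where K: "\<And>t x. t \<in> {0..T} \<Longrightarrow> x \<in> {0..1} \<Longrightarrow> \<bar>?c t x\<bar> \<le> K"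
    using continuous_rectangle_bounded[where f="?c", OF cc] by blast
  have Tm: "{0..T} \<times> {0<..<1::real} \<in> sets lebesgue" by (intro sets_completionI_sets) (simp add: borel_Times)
  have Rm: "rect t0 t1 \<in> lmeasurable"
  proof (rule bounded_set_imp_lmeasurable)
    have "bounded ({t0..t1} \<times> {0..1::real})" by (intro bounded_Times) auto
    then show "bounded (rect t0 t1)" using rect_subset by (rule bounded_subset)
  qed (rule rect_lebesgue)
  have ai: "(\<lambda>p. y (fst p) (snd p) * ?c (fst p) (snd p)) absolutely_integrable_on rect t0 t1"
  proof (rule Linf_abs_integrable[OF yL Tm sub(1) Rm])
    show "(\<lambda>p. ?c (fst p) (snd p)) \<in> borel_measurable (lebesgue_on (rect t0 t1))"
      by (rule continuous_imp_measurable_on_sets_lebesgue[OF cR rect_lebesgue])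
    show "\<bar>?c (fst p) (snd p)\<bar> \<le> K" if "p \<in> rect t0 t1" for p
    proof (rule K)
      show "fst p \<in> {0..T}" "snd p \<in> {0..1}" using subsetD[OF sub(2) that] by (simp_all only: mem_Times_iff)
    qed
  qed
  have yi: "y t absolutely_integrable_on {0..1}" if "t \<in> {0..T}" for t
    by (rule L2_imp_absolutely_integrable[OF C0_L2_D[OF y that]])
  have sl: "(\<lambda>x. y t x * ?c t x) absolutely_integrable_on {0..1}" if "t \<in> {0..T}" for t
    by (rule abs_integrable_mult_cont[OF yi[OF that]])
      (use cc[unfolded continuous_on_rectangle_iff[where f="?c"]] that in blast)
  have "(\<integral>(t, x). y t x * 0 + y t x * v' t x * \<psi>' (snd (t, x)) - y t x * dx v' t x * \<psi> (snd (t, x)) \<partial>lebesgue_on (rect t0 t1))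
     = (\<integral>p. y (fst p) (snd p) * ?c (fst p) (snd p) \<partial>lebesgue_on (rect t0 t1))"
  proof (rule Bochner_Integration.integral_cong[OF refl])
    fix p assume "p \<in> space (lebesgue_on (rect t0 t1))"
    then have "p \<in> rect t0 t1" by (simp add: space_restrict_space)
    then have p: "fst p \<in> {0..T}" "snd p \<in> {0..1}" using subsetD[OF sub(2)] by (simp_all only: mem_Times_iff)
    show "(case p of (t, x) \<Rightarrow> y t x * 0 + y t x * v' t x * \<psi>' (snd (t, x)) - y t x * dx v' t x * \<psi> (snd (t, x)))
       = y (fst p) (snd p) * ?c (fst p) (snd p)"
      using velocity_unique[OF v v' C0_L2_D[OF y p(1)] p] by (simp add: case_prod_unfold algebra_simps)
  qed
  also have "\<dots> = ?L"
    unfolding rect_def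
  proof (rule lebesgue_on_rectangle_eq_iterated)
    show "(\<lambda>p. y (fst p) (snd p) * ?c (fst p) (snd p)) absolutely_integrable_on {t0<..<t1} \<times> {0<..<1}"
      using ai by (simp add: rect_def)
    show "(\<lambda>x. y (fst (t, x)) (snd (t, x)) * ?c (fst (t, x)) (snd (t, x))) absolutely_integrable_on {0..1}" if "t \<in> {t0<..<t1}" for t
      using sl[of t] that t by simp
    show "continuous_on {t0..t1} (\<lambda>t. integral {0..1} (\<lambda>x. y t x * ?c t x))"
      by (rule continuous_on_subset[OF pairing_continuous[where c="?c", OF y cc]]) (use t in auto)
  qed simp
  finally have L: "(\<integral>(t, x). y t x * 0 + y t x * v' t x * \<psi>' (snd (t, x)) - y t x * dx v' t x * \<psi> (snd (t, x)) \<partial>lebesgue_on (rect t0 t1)) = ?L" .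
  have bdry: "(\<lambda>t. z t * w t) absolutely_integrable_on {t0..t1}" if "Linf {0..T} z" "continuous_on {0..T} w" for z w :: "real \<Rightarrow> real"
  proof -
    have "bounded (w ` {0..T})" by (intro compact_imp_bounded compact_continuous_image that(2) compact_Icc)
    then obtain K where K: "\<And>t. t \<in> {0..T} \<Longrightarrow> \<bar>w t\<bar> \<le> K"
      unfolding bounded_iff real_norm_def by blast
    have "continuous_on {t0..t1} w" by (rule continuous_on_subset[OF that(2)]) (use t in auto)
    then show ?thesis
      using t K by (intro Linf_abs_integrable[OF that(1), where K=K] continuous_imp_measurable_on_sets_lebesgue) auto
  qed
  show B: "(\<lambda>t. yr t * vr t * \<psi> 1 - yl t * vl t * \<psi> 0) absolutely_integrable_on {t0..t1}"
    using bdry[OF yr vr] bdry[OF yl vl] by (intro set_integral_diff(1)) auto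
  have I: "(\<integral>x. \<psi> x * y t x \<partial>lebesgue_on {0<..<1}) = integral {0..1} (\<lambda>x. y t x * \<psi> x)" if "t \<in> {0..T}" for t
    using lebesgue_on_Ioo_eq_integral[OF abs_integrable_mult_cont[OF yi[OF that] c]] by (simp add: mult.commute)
  have "?L = (\<integral>t. yr t * vr t * \<psi> 1 - yl t * vl t * \<psi> 0 \<partial>lebesgue_on {t0..t1})
      + (\<integral>x. \<psi> x * y t1 x \<partial>lebesgue_on {0<..<1}) - (\<integral>x. \<psi> x * y t0 x \<partial>lebesgue_on {0<..<1})"
    using id[of t0 t1 "\<lambda>p. \<psi> (snd p)" "\<lambda>p. 0" "\<lambda>p. \<psi>' (snd p)" "\<lambda>p. \<psi> (snd p)"] H1_rect_space_function[OF t(2) d c'] t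
    unfolding L by simp
  then show "?L = ?B + ?I1 - ?I0"
    using I[of t0] I[of t1] t lebesgue_on_Icc_eq_integral[OF B] by simp
qed

section \<open>The difference of two solutions\<close>

locale two_solutions =
  fixes T \<kappa> :: real
    and vl vr yrc ylc y01 y02 yr1 yl1 yr2 yl2 :: "real \<Rightarrow> real"
    and y1 y2 v1 v2 :: "real \<Rightarrow> real \<Rightarrow> real"
  assumes T: "T > 0"
    and cvl: "continuous_on {0..T} vl" and cvr: "continuous_on {0..T} vr"
    and ws1: "weak_solution T \<kappa> y01 vl vr yrc ylc y1 yr1 yl1"
    and ws2: "weak_solution T \<kappa> y02 vl vr yrc ylc y2 yr2 yl2"
    and iv1: "is_velocity T \<kappa> vl vr y1 v1" and iv2: "is_velocity T \<kappa> vl vr y2 v2"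
begin

definition "u t x = v1 t x - v2 t x"
definition "p t x = dx v1 t x - dx v2 t x"
definition "g t x = y1 t x - y2 t x"
definition "E t = integral {0..1} (\<lambda>x. (u t x)\<^sup>2) + integral {0..1} (\<lambda>x. (p t x)\<^sup>2)"
text \<open>With \<open>\<psi>'\<close> the derivative of \<open>\<psi>\<close>, this is, up to the
  boundary flux, the time derivative of the pairing of \<open>g t\<close> with the fixed function
  \<open>\<psi>\<close>.\<close>

definition "B t \<psi> \<psi>' = integral {0..1} (\<lambda>x. y1 t x * (v1 t x * \<psi>' x - dx v1 t x * \<psi> x))
   - integral {0..1} (\<lambda>x. y2 t x * (v2 t x * \<psi>' x - dx v2 t x * \<psi> x))"

lemma y_C0: "C0_L2 T y1" "C0_L2 T y2"
  using ws1 ws2 by (simp_all add: weak_solution_def)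

lemma y_L2: assumes "t \<in> {0..T}" shows "L2 {0<..<1} (y1 t)" "L2 {0<..<1} (y2 t)"
  using C0_L2_D[OF y_C0(1) assms] C0_L2_D[OF y_C0(2) assms] .

lemma y_abs_int: assumes "t \<in> {0..T}" shows "y1 t absolutely_integrable_on {0..1}" "y2 t absolutely_integrable_on {0..1}"
  "g t absolutely_integrable_on {0..1}"
  using L2_imp_absolutely_integrable[OF y_L2(1)[OF assms]] L2_imp_absolutely_integrable[OF y_L2(2)[OF assms]]
    L2_imp_absolutely_integrable[OF L2_diff[OF y_L2[OF assms]]] unfolding g_def[abs_def] .

lemma velocity_prims:
  assumes "t \<in> {0..T}"
  shows "prim (v1 t) (dx v1 t)" "prim (dx v1 t) (\<lambda>x. v1 t x - (y1 t x - \<kappa>))"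
    "prim (v2 t) (dx v2 t)" "prim (dx v2 t) (\<lambda>x. v2 t x - (y2 t x - \<kappa>))"
  using is_velocity_prim_dx[OF iv1 y_L2(1)[OF assms] assms] is_velocity_prim_dx[OF iv2 y_L2(2)[OF assms] assms] .

lemma u_prim: assumes "t \<in> {0..T}" shows "prim (u t) (p t)"
  unfolding u_def[abs_def] p_def[abs_def] by (intro prim_diff velocity_prims assms)

lemma p_prim: assumes "t \<in> {0..T}" shows "prim (p t) (\<lambda>x. u t x - g t x)"
  unfolding p_def[abs_def]
  by (rule prim_cong[OF prim_diff[OF velocity_prims(2)[OF assms] velocity_prims(4)[OF assms]]]) (simp_all add: u_def g_def)

lemma boundary_values:
  assumes "t \<in> {0..T}"
  shows "v1 t 0 = vl t" "v1 t 1 = vr t" "v2 t 0 = vl t" "v2 t 1 = vr t" "u t 0 = 0" "u t 1 = 0"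
  using iv1 iv2 assms unfolding is_velocity_def u_def by simp_all

lemma jointly_continuous:
  "continuous_on ({0..T} \<times> {0..1}) (\<lambda>q. v1 (fst q) (snd q))" "continuous_on ({0..T} \<times> {0..1}) (\<lambda>q. dx v1 (fst q) (snd q))"
  "continuous_on ({0..T} \<times> {0..1}) (\<lambda>q. v2 (fst q) (snd q))" "continuous_on ({0..T} \<times> {0..1}) (\<lambda>q. dx v2 (fst q) (snd q))"
  "continuous_on ({0..T} \<times> {0..1}) (\<lambda>q. u (fst q) (snd q))" "continuous_on ({0..T} \<times> {0..1}) (\<lambda>q. p (fst q) (snd q))"
proof -
  note c = velocity_jointly_continuous[OF iv1 y_C0(1) cvl cvr] velocity_jointly_continuous[OF iv2 y_C0(2) cvl cvr]
  show "continuous_on ({0..T} \<times> {0..1}) (\<lambda>q. v1 (fst q) (snd q))" "continuous_on ({0..T} \<times> {0..1}) (\<lambda>q. dx v1 (fst q) (snd q))"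
    "continuous_on ({0..T} \<times> {0..1}) (\<lambda>q. v2 (fst q) (snd q))" "continuous_on ({0..T} \<times> {0..1}) (\<lambda>q. dx v2 (fst q) (snd q))"
    using c .
  show "continuous_on ({0..T} \<times> {0..1}) (\<lambda>q. u (fst q) (snd q))" "continuous_on ({0..T} \<times> {0..1}) (\<lambda>q. p (fst q) (snd q))"
    unfolding u_def p_def by (intro continuous_on_diff c)+
qed

lemma slice_continuous:
  assumes "t \<in> {0..T}"
  shows "continuous_on {0..1} (v1 t)" "continuous_on {0..1} (dx v1 t)" "continuous_on {0..1} (v2 t)" "continuous_on {0..1} (dx v2 t)"
    "continuous_on {0..1} (u t)" "continuous_on {0..1} (p t)"
  using velocity_prims[OF assms, THEN prim_continuous] u_prim[OF assms, THEN prim_continuous]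
    p_prim[OF assms, THEN prim_continuous] .

lemma pairing_eq:
  assumes "s \<in> {0..T}" "t \<in> {0..T}"
  shows "integral {0..1} (\<lambda>x. g s x * u t x) = integral {0..1} (\<lambda>x. u s x * u t x + p s x * p t x)"
  by (rule prim_pairing[OF u_prim[OF assms(1)] p_prim[OF assms(1)] u_prim[OF assms(2)]])
    (use assms in \<open>simp_all add: boundary_values slice_continuous y_abs_int\<close>)

lemma E_eq: assumes "t \<in> {0..T}" shows "integral {0..1} (\<lambda>x. g t x * u t x) = E t"
proof -
  have "(\<lambda>x. (u t x)\<^sup>2) integrable_on {0..1}" "(\<lambda>x. (p t x)\<^sup>2) integrable_on {0..1}"
    by (intro integrable_continuous_interval continuous_intros slice_continuous[OF assms])+
  then show ?thesis unfolding pairing_eq[OF assms assms] E_def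
    by (simp add: power2_eq_square Henstock_Kurzweil_Integration.integral_add)
qed

lemma E_nonneg: assumes "t \<in> {0..T}" shows "0 \<le> E t"
  unfolding E_def by (intro add_nonneg_nonneg integral_nonneg integrable_continuous_interval continuous_intros slice_continuous[OF assms]) auto

lemma E_continuous: "continuous_on {0..T} E"
proof -
  have c: "continuous_on ({0..T} \<times> cbox 0 1) (\<lambda>q. (u (fst q) (snd q))\<^sup>2)" "continuous_on ({0..T} \<times> cbox 0 1) (\<lambda>q. (p (fst q) (snd q))\<^sup>2)"
    using jointly_continuous(5,6) by (auto intro!: continuous_on_power)
  have "continuous_on {0..T} (\<lambda>t. integral (cbox 0 1) (\<lambda>x. (u t x)\<^sup>2) + integral (cbox 0 1) (\<lambda>x. (p t x)\<^sup>2))"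
    by (intro continuous_on_add integral_continuous_on_param) (use c in \<open>simp_all add: case_prod_unfold\<close>)
  then show ?thesis by (simp add: E_def[abs_def])
qed

lemma B_integrable:
  assumes "t \<in> {0..T}" "continuous_on {0..1} \<psi>" "continuous_on {0..1} \<psi>'"
  shows "(\<lambda>x. y1 t x * (v1 t x * \<psi>' x - dx v1 t x * \<psi> x)) integrable_on {0..1}"
    "(\<lambda>x. y2 t x * (v2 t x * \<psi>' x - dx v2 t x * \<psi> x)) integrable_on {0..1}"
  by (rule set_lebesgue_integral_eq_integral(1), rule abs_integrable_mult_cont,
      rule y_abs_int[OF assms(1)], intro continuous_intros slice_continuous assms)+

lemma B_continuous:
  assumes "continuous_on {0..1} \<psi>" "continuous_on {0..1} \<psi>'"
  shows "continuous_on {0..T} (\<lambda>t. B t \<psi> \<psi>')"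
proof -
  have s: "snd ` ({0..T} \<times> {0..1::real}) \<subseteq> {0..1}" by auto
  note c = continuous_on_compose2[OF assms(1) continuous_on_snd[OF continuous_on_id] s]
    continuous_on_compose2[OF assms(2) continuous_on_snd[OF continuous_on_id] s]
  show ?thesis unfolding B_def
    by (intro continuous_on_diff pairing_continuous[where c="\<lambda>t x. v1 t x * \<psi>' x - dx v1 t x * \<psi> x"]
        pairing_continuous[where c="\<lambda>t x. v2 t x * \<psi>' x - dx v2 t x * \<psi> x"] y_C0 continuous_on_mult jointly_continuous c)
qed

lemma B_add:
  assumes "t \<in> {0..T}" "continuous_on {0..1} \<psi>" "continuous_on {0..1} \<psi>'" "continuous_on {0..1} \<eta>" "continuous_on {0..1} \<eta>'"
  shows "B t (\<lambda>x. \<psi> x + \<eta> x) (\<lambda>x. \<psi>' x + \<eta>' x) = B t \<psi> \<psi>' + B t \<eta> \<eta>'"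
  unfolding B_def
  using Henstock_Kurzweil_Integration.integral_add[OF B_integrable(1)[OF assms(1-3)] B_integrable(1)[OF assms(1,4,5)]]
    Henstock_Kurzweil_Integration.integral_add[OF B_integrable(2)[OF assms(1-3)] B_integrable(2)[OF assms(1,4,5)]]
  by (simp add: algebra_simps)

definition boundary_flux :: "real \<Rightarrow> real \<Rightarrow> real \<Rightarrow> real" where
  "boundary_flux b0 b1 t = (yr1 t - yr2 t) * vr t * b1 - (yl1 t - yl2 t) * vl t * b0"

lemma difference_identity:
  assumes t: "0 \<le> s" "s < t" "t < T"
    and d: "\<And>x. x \<in> {0..1} \<Longrightarrow> (\<psi> has_real_derivative \<psi>' x) (at x within {0..1})" and c': "continuous_on {0..1} \<psi>'"
  shows "integral {s..t} (\<lambda>\<tau>. B \<tau> \<psi> \<psi>') = integral {s..t} (boundary_flux (\<psi> 0) (\<psi> 1))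
      + integral {0..1} (\<lambda>x. g t x * \<psi> x) - integral {0..1} (\<lambda>x. g s x * \<psi> x)"
    and "boundary_flux (\<psi> 0) (\<psi> 1) absolutely_integrable_on {s..t}"
proof -
  have c: "continuous_on {0..1} \<psi>" using d by (meson DERIV_continuous continuous_on_eq_continuous_within)
  note i1 = weak_solution_identity[OF ws1 iv1 cvl cvr t d c'] and i2 = weak_solution_identity[OF ws2 iv2 cvl cvr t d c']
  have st: "s \<in> {0..T}" "t \<in> {0..T}" using t by auto
  have sn: "snd ` ({0..T} \<times> {0..1::real}) \<subseteq> {0..1}" by auto
  note cs = continuous_on_compose2[OF c continuous_on_snd[OF continuous_on_id] sn]
    continuous_on_compose2[OF c' continuous_on_snd[OF continuous_on_id] sn]
  have "continuous_on {0..T} (\<lambda>t. integral {0..1} (\<lambda>x. y1 t x * (v1 t x * \<psi>' x - dx v1 t x * \<psi> x)))"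
      "continuous_on {0..T} (\<lambda>t. integral {0..1} (\<lambda>x. y2 t x * (v2 t x * \<psi>' x - dx v2 t x * \<psi> x)))"
    by (intro continuous_on_diff pairing_continuous[where c="\<lambda>t x. v1 t x * \<psi>' x - dx v1 t x * \<psi> x"]
        pairing_continuous[where c="\<lambda>t x. v2 t x * \<psi>' x - dx v2 t x * \<psi> x"] y_C0 continuous_on_mult jointly_continuous cs)+
  then have "(\<lambda>t. integral {0..1} (\<lambda>x. y1 t x * (v1 t x * \<psi>' x - dx v1 t x * \<psi> x))) integrable_on {s..t}"
      "(\<lambda>t. integral {0..1} (\<lambda>x. y2 t x * (v2 t x * \<psi>' x - dx v2 t x * \<psi> x))) integrable_on {s..t}"
    using st by (auto intro!: integrable_continuous_interval elim!: continuous_on_subset)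
  then have "integral {s..t} (\<lambda>\<tau>. B \<tau> \<psi> \<psi>') = integral {s..t} (\<lambda>t. integral {0..1} (\<lambda>x. y1 t x * (v1 t x * \<psi>' x - dx v1 t x * \<psi> x)))
      - integral {s..t} (\<lambda>t. integral {0..1} (\<lambda>x. y2 t x * (v2 t x * \<psi>' x - dx v2 t x * \<psi> x)))"
    unfolding B_def by (rule Henstock_Kurzweil_Integration.integral_diff)
  moreover have bf: "boundary_flux (\<psi> 0) (\<psi> 1) = (\<lambda>t. (yr1 t * vr t * \<psi> 1 - yl1 t * vl t * \<psi> 0) - (yr2 t * vr t * \<psi> 1 - yl2 t * vl t * \<psi> 0))"
    by (rule ext) (simp add: boundary_flux_def algebra_simps)
  have "integral {s..t} (boundary_flux (\<psi> 0) (\<psi> 1)) = integral {s..t} (\<lambda>t. yr1 t * vr t * \<psi> 1 - yl1 t * vl t * \<psi> 0)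
      - integral {s..t} (\<lambda>t. yr2 t * vr t * \<psi> 1 - yl2 t * vl t * \<psi> 0)"
    unfolding bf by (intro Henstock_Kurzweil_Integration.integral_diff set_lebesgue_integral_eq_integral(1) i1(2) i2(2))
  moreover have G: "integral {0..1} (\<lambda>x. g t x * \<psi> x) = integral {0..1} (\<lambda>x. y1 t x * \<psi> x) - integral {0..1} (\<lambda>x. y2 t x * \<psi> x)"
    if "t \<in> {0..T}" for t
    unfolding g_def left_diff_distrib
    by (intro Henstock_Kurzweil_Integration.integral_diff set_lebesgue_integral_eq_integral(1) abs_integrable_mult_cont y_abs_int c that)
  ultimately show "integral {s..t} (\<lambda>\<tau>. B \<tau> \<psi> \<psi>') = integral {s..t} (boundary_flux (\<psi> 0) (\<psi> 1))
      + integral {0..1} (\<lambda>x. g t x * \<psi> x) - integral {0..1} (\<lambda>x. g s x * \<psi> x)"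
    using i1(1) i2(1) G[OF st(1)] G[OF st(2)] by linarith
  show "boundary_flux (\<psi> 0) (\<psi> 1) absolutely_integrable_on {s..t}"
    unfolding bf by (intro set_integral_diff(1) i1(2) i2(2))
qed

text \<open>
  Since the pairing of \<open>g s\<close> with \<open>u t\<close> is symmetric in \<open>s\<close> and \<open>t\<close>, the increment of the energy is the
  pairing of \<open>g t - g s\<close> with \<open>u s + u t\<close>, a test function that does not depend on time.
\<close>

lemma E_diff:
  assumes t: "0 \<le> s" "s < t" "t < T"
  shows "E t - E s = integral {s..t} (\<lambda>\<tau>. B \<tau> (\<lambda>x. u s x + u t x) (\<lambda>x. p s x + p t x))"
proof -
  have st: "s \<in> {0..T}" "t \<in> {0..T}" using t by auto
  have d: "((\<lambda>x. u s x + u t x) has_real_derivative p s x + p t x) (at x within {0..1})" if "x \<in> {0..1}" for x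
    using that by (intro DERIV_add prim_derivative u_prim slice_continuous st) auto
  have c: "continuous_on {0..1} (\<lambda>x. p s x + p t x)" by (intro continuous_on_add slice_continuous st)
  \<comment> \<open>The test function vanishes at both ends, so the unknown outflow data do not
    enter the energy.\<close>
  have z: "boundary_flux (u s 0 + u t 0) (u s 1 + u t 1) = (\<lambda>t. 0)"
    using st by (simp add: boundary_flux_def[abs_def] boundary_values)
  note li = set_lebesgue_integral_eq_integral(1)
  have gu: "(\<lambda>x. g a x * u b x) integrable_on {0..1}" if "a \<in> {0..T}" "b \<in> {0..T}" for a b
    by (intro li abs_integrable_mult_cont y_abs_int slice_continuous that)
  have "integral {s..t} (\<lambda>\<tau>. B \<tau> (\<lambda>x. u s x + u t x) (\<lambda>x. p s x + p t x))
    = integral {0..1} (\<lambda>x. g t x * (u s x + u t x)) - integral {0..1} (\<lambda>x. g s x * (u s x + u t x))"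
    using difference_identity(1)[OF t d c] unfolding z by simp
  also have "\<dots> = (integral {0..1} (\<lambda>x. g t x * u s x) + E t) - (E s + integral {0..1} (\<lambda>x. g s x * u t x))"
    using gu st by (simp add: distrib_left Henstock_Kurzweil_Integration.integral_add E_eq)
  also have "integral {0..1} (\<lambda>x. g t x * u s x) = integral {0..1} (\<lambda>x. g s x * u t x)"
    unfolding pairing_eq[OF st] pairing_eq[OF st(2) st(1)] by (simp add: mult.commute)
  finally show ?thesis by simp
qed

text \<open>Boundedness in the C1 norm of \<open>\<psi>\<close>, uniformly in time. It controls the
  error of replacing \<open>u s\<close> by \<open>u t\<close> when the energy is
  differentiated.\<close>

lemma B_bound: obtains K where "K \<ge> 0"
  "\<And>t \<psi> \<psi>' m. t \<in> {0..T} \<Longrightarrow> continuous_on {0..1} \<psi> \<Longrightarrow> continuous_on {0..1} \<psi>' \<Longrightarrow>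
     (\<And>x. x \<in> {0..1} \<Longrightarrow> \<bar>\<psi> x\<bar> \<le> m \<and> \<bar>\<psi>' x\<bar> \<le> m) \<Longrightarrow> \<bar>B t \<psi> \<psi>'\<bar> \<le> K * m"
proof -
  obtain R1 where R1: "R1 \<ge> 0" "\<And>t x. t \<in> {0..T} \<Longrightarrow> x \<in> {0..1} \<Longrightarrow> \<bar>v1 t x\<bar> \<le> R1"
    using continuous_rectangle_bounded[OF jointly_continuous(1)] by blast
  obtain R2 where R2: "R2 \<ge> 0" "\<And>t x. t \<in> {0..T} \<Longrightarrow> x \<in> {0..1} \<Longrightarrow> \<bar>dx v1 t x\<bar> \<le> R2"
    using continuous_rectangle_bounded[OF jointly_continuous(2)] by blast
  obtain R3 where R3: "R3 \<ge> 0" "\<And>t x. t \<in> {0..T} \<Longrightarrow> x \<in> {0..1} \<Longrightarrow> \<bar>v2 t x\<bar> \<le> R3"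
    using continuous_rectangle_bounded[OF jointly_continuous(3)] by blast
  obtain R4 where R4: "R4 \<ge> 0" "\<And>t x. t \<in> {0..T} \<Longrightarrow> x \<in> {0..1} \<Longrightarrow> \<bar>dx v2 t x\<bar> \<le> R4"
    using continuous_rectangle_bounded[OF jointly_continuous(4)] by blast
  obtain Y1 where Y1: "\<And>t. t \<in> {0..T} \<Longrightarrow> integral {0..1} (\<lambda>x. (y1 t x)\<^sup>2) \<le> Y1"
    using C0_L2_bounded[OF y_C0(1)] T by force
  obtain Y2 where Y2: "\<And>t. t \<in> {0..T} \<Longrightarrow> integral {0..1} (\<lambda>x. (y2 t x)\<^sup>2) \<le> Y2"
    using C0_L2_bounded[OF y_C0(2)] T by force
  have L1: "integral {0..1} (\<lambda>x. \<bar>y x\<bar>) \<le> 1 + \<bar>Y\<bar>" if "L2 {0<..<1} y" "integral {0..1} (\<lambda>x. (y x)\<^sup>2) \<le> Y" for y :: "real \<Rightarrow> real" and Y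
  proof -
    define N where "N = L2_norm {0<..<1} y"
    have "N\<^sup>2 \<le> \<bar>Y\<bar>" using that L2_norm_square[OF that(1)] by (simp add: N_def)
    moreover have "2 * N \<le> N\<^sup>2 + 1" using sum_squares_bound[of N 1] by simp
    then have "N \<le> 1 + N\<^sup>2" using zero_le_power2[of N] by linarith
    ultimately show ?thesis using integral_abs_le_L2_norm[OF that(1)] by (simp add: N_def)
  qed
  have part: "\<bar>integral {0..1} (\<lambda>x. y x * (v x * \<psi>' x - w x * \<psi> x))\<bar> \<le> (R + R') * (1 + \<bar>Y\<bar>) * m"
    if "L2 {0<..<1} y" "integral {0..1} (\<lambda>x. (y x)\<^sup>2) \<le> Y" "continuous_on {0..1} v" "continuous_on {0..1} w"
      "continuous_on {0..1} \<psi>" "continuous_on {0..1} \<psi>'" "R \<ge> 0" "R' \<ge> 0"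
      "\<And>x. x \<in> {0..1} \<Longrightarrow> \<bar>v x\<bar> \<le> R" "\<And>x. x \<in> {0..1} \<Longrightarrow> \<bar>w x\<bar> \<le> R'"
      "\<And>x. x \<in> {0..1} \<Longrightarrow> \<bar>\<psi> x\<bar> \<le> m \<and> \<bar>\<psi>' x\<bar> \<le> m" for y v w \<psi> \<psi>' :: "real \<Rightarrow> real" and Y R R' m
  proof -
    have m: "0 \<le> m" using that(11)[of 0] by force
    have "\<bar>integral {0..1} (\<lambda>x. y x * (v x * \<psi>' x - w x * \<psi> x))\<bar> \<le> ((R + R') * m) * integral {0..1} (\<lambda>x. \<bar>y x\<bar>)"
    proof (rule abs_integral_mult_le[OF L2_imp_absolutely_integrable[OF that(1)]])
      show "continuous_on {0..1} (\<lambda>x. v x * \<psi>' x - w x * \<psi> x)" by (intro continuous_intros that)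
      fix x :: real assume x: "x \<in> {0..1}"
      have "\<bar>v x * \<psi>' x\<bar> \<le> R * m" "\<bar>w x * \<psi> x\<bar> \<le> R' * m"
        unfolding abs_mult using that(9,10,11)[OF x] that(7,8) by (auto intro!: mult_mono)
      then show "\<bar>v x * \<psi>' x - w x * \<psi> x\<bar> \<le> (R + R') * m"
        using abs_triangle_ineq4[of "v x * \<psi>' x" "w x * \<psi> x"] by (simp add: distrib_right)
    qed
    also have "\<dots> \<le> ((R + R') * m) * (1 + \<bar>Y\<bar>)"
      using L1[OF that(1,2)] that(7,8) m by (intro mult_left_mono) auto
    also have "\<dots> = (R + R') * (1 + \<bar>Y\<bar>) * m" by (simp add: mult.assoc mult.commute)
    finally show ?thesis .
  qed
  show ?thesis
  proof (rule that[of "(R1 + R2) * (1 + \<bar>Y1\<bar>) + (R3 + R4) * (1 + \<bar>Y2\<bar>)"])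
    show "(R1 + R2) * (1 + \<bar>Y1\<bar>) + (R3 + R4) * (1 + \<bar>Y2\<bar>) \<ge> 0"
      using R1 R2 R3 R4 by (intro add_nonneg_nonneg mult_nonneg_nonneg) auto
    fix t m :: real and \<psi> \<psi>' :: "real \<Rightarrow> real"
    assume t: "t \<in> {0..T}" and c: "continuous_on {0..1} \<psi>" "continuous_on {0..1} \<psi>'"
      and m: "\<And>x. x \<in> {0..1} \<Longrightarrow> \<bar>\<psi> x\<bar> \<le> m \<and> \<bar>\<psi>' x\<bar> \<le> m"
    have 1: "\<bar>integral {0..1} (\<lambda>x. y1 t x * (v1 t x * \<psi>' x - dx v1 t x * \<psi> x))\<bar> \<le> (R1 + R2) * (1 + \<bar>Y1\<bar>) * m"
      by (rule part[OF y_L2(1)[OF t] Y1[OF t] slice_continuous(1,2)[OF t] c R1(1) R2(1) R1(2)[OF t] R2(2)[OF t] m])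
    have 2: "\<bar>integral {0..1} (\<lambda>x. y2 t x * (v2 t x * \<psi>' x - dx v2 t x * \<psi> x))\<bar> \<le> (R3 + R4) * (1 + \<bar>Y2\<bar>) * m"
      by (rule part[OF y_L2(2)[OF t] Y2[OF t] slice_continuous(3,4)[OF t] c R3(1) R4(1) R3(2)[OF t] R4(2)[OF t] m])
    have "\<bar>B t \<psi> \<psi>'\<bar> \<le> (R1 + R2) * (1 + \<bar>Y1\<bar>) * m + (R3 + R4) * (1 + \<bar>Y2\<bar>) * m"
      unfolding B_def using 1 2 by linarith
    then show "\<bar>B t \<psi> \<psi>'\<bar> \<le> ((R1 + R2) * (1 + \<bar>Y1\<bar>) + (R3 + R4) * (1 + \<bar>Y2\<bar>)) * m"
      by (simp only: distrib_right)
  qed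
qed

end

text \<open>The increments of \<open>F\<close> are required only below \<open>b\<close>, in keeping
  with a weak form that stops short of \<open>T\<close>.\<close>

lemma integral_function_derivative:
  fixes F H :: "real \<Rightarrow> real"
  assumes F: "\<And>s t. a \<le> s \<Longrightarrow> s < t \<Longrightarrow> t < b \<Longrightarrow> F t - F s = integral {s..t} H"
    and H: "continuous_on {a..b} H" and t: "a < t" "t < b"
  shows "(F has_real_derivative H t) (at t)"
proof -
  have "((\<lambda>x. integral {a..x} H) has_real_derivative H t) (at t within {a..b})"
    by (rule integral_has_real_derivative[OF H]) (use t in auto)
  moreover have "at t within {a..b} = at t" using t by (intro at_within_interior) auto
  ultimately have "((\<lambda>x. F a + integral {a..x} H) has_real_derivative 0 + H t) (at t)"
    by (intro DERIV_add DERIV_const) simp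
  then have "((\<lambda>x. F a + integral {a..x} H) has_real_derivative H t) (at t)" by simp
  then show ?thesis
  proof (rule has_field_derivative_transform_within_open[of _ _ _ "{a<..<b}"])
    fix x assume "x \<in> {a<..<b}"
    then show "F a + integral {a..x} H = F x" using F[of a x] by simp
  qed (use t in auto)
qed

text \<open>\<open>F t * exp (- C * t)\<close> is nonincreasing. Derivatives are required only in
  the interior and the ends are reached by continuity, so that \<open>b = T\<close> is
  allowed.\<close>

lemma Gronwall:
  fixes F F' :: "real \<Rightarrow> real"
  assumes "a \<le> b" and c: "continuous_on {a..b} F"
    and d: "\<And>t. a < t \<Longrightarrow> t < b \<Longrightarrow> (F has_real_derivative F' t) (at t)"
    and le: "\<And>t. a < t \<Longrightarrow> t < b \<Longrightarrow> F' t \<le> C * F t"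
  shows "F b \<le> F a * exp (C * (b - a))"
proof -
  have "F b * exp (- C * b) \<le> F a * exp (- C * a)"
  proof (rule DERIV_nonpos_imp_decreasing_open[OF \<open>a \<le> b\<close>])
    fix t assume t: "a < t" "t < b"
    have "((\<lambda>t. F t * exp (- C * t)) has_real_derivative (F' t - C * F t) * exp (- C * t)) (at t)"
      by (auto intro!: derivative_eq_intros d[OF t] simp: algebra_simps)
    moreover have "(F' t - C * F t) * exp (- C * t) \<le> 0"
      using le[OF t] by (intro mult_nonpos_nonneg) auto
    ultimately show "\<exists>z. ((\<lambda>t. F t * exp (- C * t)) has_real_derivative z) (at t) \<and> z \<le> 0" by blast
  next
    show "continuous_on {a..b} (\<lambda>t. F t * exp (- C * t))" by (intro continuous_intros c)
  qed
  then have "F b * exp (- C * b) * exp (C * b) \<le> F a * exp (- C * a) * exp (C * b)"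
    by (rule mult_right_mono) simp
  then show ?thesis by (simp add: mult.assoc exp_add[symmetric] algebra_simps)
qed

text \<open>
  The two solutions of \<open>\<phi>'' = \<phi>\<close> that are \<open>1\<close> at one end of the interval and \<open>0\<close> at the other.
  Paired with \<open>y\<^sup>1 - y\<^sup>2\<close> they give the traces of \<open>\<partial>\<^sub>x (v\<^sup>1 - v\<^sup>2)\<close>.
\<close>

definition "\<phi>0 x = sinh (1 - x) / sinh (1::real)"
definition "\<phi>0' x = - cosh (1 - x) / sinh (1::real)"
definition "\<phi>1 x = sinh x / sinh (1::real)"
definition "\<phi>1' x = cosh x / sinh (1::real)"

lemma sinh_1_nz: "sinh (1::real) \<noteq> 0" by simp

lemma \<phi>_prim: "prim \<phi>0 \<phi>0'" "prim \<phi>0' \<phi>0" "prim \<phi>1 \<phi>1'" "prim \<phi>1' \<phi>1"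
  unfolding \<phi>0_def[abs_def] \<phi>0'_def[abs_def] \<phi>1_def[abs_def] \<phi>1'_def[abs_def]
  by (rule sinh_prim[OF sinh_1_nz])+

lemma \<phi>_bound:
  assumes "x \<in> {0..1}"
  shows "\<bar>\<phi>0 x\<bar> \<le> 1 \<and> \<bar>\<phi>0' x\<bar> \<le> 2" "\<bar>\<phi>1 x\<bar> \<le> 1 \<and> \<bar>\<phi>1' x\<bar> \<le> 2"
proof -
  have s: "\<bar>sinh z\<bar> \<le> sinh 1" "cosh z \<le> 2 * sinh 1" if "0 \<le> z" "z \<le> 1" for z :: real
  proof -
    show "\<bar>sinh z\<bar> \<le> sinh 1" using that by simp
    have "cosh z \<le> cosh 1" using that by (subst cosh_real_nonneg_le_iff) auto
    then show "cosh z \<le> 2 * sinh 1" using cosh_1_le sinh_1_ge by linarith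
  qed
  have p: "sinh (1::real) > 0" by simp
  show "\<bar>\<phi>0 x\<bar> \<le> 1 \<and> \<bar>\<phi>0' x\<bar> \<le> 2" "\<bar>\<phi>1 x\<bar> \<le> 1 \<and> \<bar>\<phi>1' x\<bar> \<le> 2"
    using s[of x] s[of "1 - x"] assms p
    by (simp_all add: \<phi>0_def \<phi>0'_def \<phi>1_def \<phi>1'_def abs_divide divide_le_eq)
qed

section \<open>Time derivatives of the energy and of the inflow traces\<close>

context two_solutions
begin

text \<open>In \<open>E_diff\<close> the test function \<open>u s + u t\<close> itself moves with
  \<open>s\<close>, so the fundamental theorem alone does not apply. The integrand is compared with
  its value \<open>h\<close> at time \<open>t\<close> for the test function \<open>2 * u t\<close>:
  freezing the test function costs at most \<open>K * e'\<close> by \<open>B_bound\<close>, as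
  \<open>u s - u t\<close> is small in C1, and freezing the time costs \<open>e / 2\<close> by
  continuity of \<open>B\<close>.\<close>

lemma E_derivative:
  assumes t: "0 < t" "t < T"
  shows "(E has_real_derivative 2 * B t (u t) (p t)) (at t)"
proof -
  have tT: "t \<in> {0..T}" using t by simp
  obtain K where K: "K \<ge> 0" "\<And>t \<psi> \<psi>' m. t \<in> {0..T} \<Longrightarrow> continuous_on {0..1} \<psi> \<Longrightarrow> continuous_on {0..1} \<psi>' \<Longrightarrow>
     (\<And>x. x \<in> {0..1} \<Longrightarrow> \<bar>\<psi> x\<bar> \<le> m \<and> \<bar>\<psi>' x\<bar> \<le> m) \<Longrightarrow> \<bar>B t \<psi> \<psi>'\<bar> \<le> K * m"
    using B_bound by blast
  define \<psi> \<psi>' where "\<psi> x = u t x + u t x" and "\<psi>' x = p t x + p t x" for x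
  have c\<psi>: "continuous_on {0..1} \<psi>" "continuous_on {0..1} \<psi>'"
    unfolding \<psi>_def \<psi>'_def by (intro continuous_on_add slice_continuous[OF tT])+
  define h where "h = B t \<psi> \<psi>'"
  have h: "h = 2 * B t (u t) (p t)"
    unfolding h_def \<psi>_def[abs_def] \<psi>'_def[abs_def] using B_add[OF tT slice_continuous(5,6)[OF tT] slice_continuous(5,6)[OF tT]] by simp
  have sc: "sup_continuous_on T u" "sup_continuous_on T p"
    using jointly_continuous(5,6) continuous_on_rectangle_iff[where f=u] continuous_on_rectangle_iff[where f=p] by blast+
  have key: "\<exists>d>0. \<forall>s. norm (s - t) < d \<longrightarrow> norm (E s - E t - h * (s - t)) \<le> e * norm (s - t)" if e: "e > 0" for e
  proof -
    define e' where "e' = e / (2 * (K + 1))"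
    have e': "e' > 0" "K * e' \<le> e / 2" using e K(1) by (auto simp: e'_def field_simps)
    obtain d1 where d1: "d1 > 0" "\<And>\<tau>. \<tau> \<in> {0..T} \<Longrightarrow> dist \<tau> t < d1 \<Longrightarrow> \<bar>B \<tau> \<psi> \<psi>' - h\<bar> < e / 2"
      using B_continuous[OF c\<psi>, unfolded continuous_on_iff, rule_format, OF tT, of "e / 2"] e
      unfolding h_def dist_real_def by (metis half_gt_zero)
    obtain d2 where d2: "d2 > 0" "\<And>s x. s \<in> {0..T} \<Longrightarrow> dist s t < d2 \<Longrightarrow> x \<in> {0..1} \<Longrightarrow> \<bar>u s x - u t x\<bar> < e'"
      using sc(1)[unfolded sup_continuous_on_def, rule_format, OF tT e'(1)] by blast
    obtain d3 where d3: "d3 > 0" "\<And>s x. s \<in> {0..T} \<Longrightarrow> dist s t < d3 \<Longrightarrow> x \<in> {0..1} \<Longrightarrow> \<bar>p s x - p t x\<bar> < e'"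
      using sc(2)[unfolded sup_continuous_on_def, rule_format, OF tT e'(1)] by blast
    \<comment> \<open>\<open>t\<close> and \<open>T - t\<close> keep \<open>s\<close> inside
      \<open>(0, T)\<close>, where \<open>E_diff\<close> applies.\<close>
    define d where "d = Min {d1, d2, d3, t, T - t}"
    have d: "d > 0" "d \<le> d1" "d \<le> d2" "d \<le> d3" "d \<le> t" "d \<le> T - t"
      using d1 d2 d3 t by (auto simp: d_def)
    have "norm (E s - E t - h * (s - t)) \<le> e * norm (s - t)" if s: "norm (s - t) < d" for s
    proof -
      have sT: "s \<in> {0..T}" "s < T" "0 \<le> s" using s d by auto
      note csu = slice_continuous(5,6)[OF sT(1)] and ctu = slice_continuous(5,6)[OF tT]
      have dc: "continuous_on {0..1} (\<lambda>x. u s x - u t x)" "continuous_on {0..1} (\<lambda>x. p s x - p t x)"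
        by (intro continuous_on_diff csu ctu)+
      have near: "\<bar>B \<tau> (\<lambda>x. u s x + u t x) (\<lambda>x. p s x + p t x) - h\<bar> \<le> e" if \<tau>: "\<tau> \<in> {0..T}" "dist \<tau> t < d" for \<tau>
      proof -
        have eq: "(\<lambda>x. u s x + u t x) = (\<lambda>x. \<psi> x + (u s x - u t x))" "(\<lambda>x. p s x + p t x) = (\<lambda>x. \<psi>' x + (p s x - p t x))"
          by (auto simp: \<psi>_def \<psi>'_def fun_eq_iff)
        have "B \<tau> (\<lambda>x. u s x + u t x) (\<lambda>x. p s x + p t x) = B \<tau> \<psi> \<psi>' + B \<tau> (\<lambda>x. u s x - u t x) (\<lambda>x. p s x - p t x)"
          unfolding eq by (rule B_add[OF \<tau>(1) c\<psi> dc])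
        moreover have "\<bar>B \<tau> (\<lambda>x. u s x - u t x) (\<lambda>x. p s x - p t x)\<bar> \<le> K * e'"
        proof (rule K(2)[OF \<tau>(1) dc])
          fix x :: real assume x: "x \<in> {0..1}"
          have "dist s t < d2" "dist s t < d3" using s d by (auto simp: dist_real_def)
          then show "\<bar>u s x - u t x\<bar> \<le> e' \<and> \<bar>p s x - p t x\<bar> \<le> e'"
            using d2(2)[OF sT(1) _ x] d3(2)[OF sT(1) _ x] by force
        qed
        moreover have "\<bar>B \<tau> \<psi> \<psi>' - h\<bar> < e / 2" using d1(2)[OF \<tau>(1)] \<tau>(2) d by auto
        ultimately show ?thesis using e'(2) by linarith
      qed
      have step: "\<bar>E b - E a - h * (b - a)\<bar> \<le> e * (b - a)"
        if ab: "a < b" "a \<in> {0..T}" "b < T" "dist a t < d" "dist b t < d"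
          and eq: "E b - E a = integral {a..b} (\<lambda>\<tau>. B \<tau> (\<lambda>x. u s x + u t x) (\<lambda>x. p s x + p t x))" for a b
      proof -
        have c: "continuous_on {a..b} (\<lambda>\<tau>. B \<tau> (\<lambda>x. u s x + u t x) (\<lambda>x. p s x + p t x))"
          by (rule continuous_on_subset[OF B_continuous]) (use ab csu ctu in \<open>auto intro!: continuous_on_add\<close>)
        have "E b - E a - h * (b - a) = integral {a..b} (\<lambda>\<tau>. B \<tau> (\<lambda>x. u s x + u t x) (\<lambda>x. p s x + p t x) - h)"
          unfolding eq using ab c by (subst Henstock_Kurzweil_Integration.integral_diff) (auto intro: integrable_continuous_interval)
        also have "norm \<dots> \<le> e * (b - a)"
        proof (rule integral_bound)
          fix \<tau> assume \<tau>: "\<tau> \<in> {a..b}"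
          then have "\<tau> \<in> {0..T}" "dist \<tau> t < d" using ab by (auto simp: dist_real_def)
          then show "norm (B \<tau> (\<lambda>x. u s x + u t x) (\<lambda>x. p s x + p t x) - h) \<le> e" using near by simp
        qed (use ab c in \<open>auto intro!: continuous_on_diff\<close>)
        finally show ?thesis by simp
      qed
      consider "s = t" | "s < t" | "t < s" by linarith
      then show ?thesis
      proof cases
        case 2
        have "\<bar>E t - E s - h * (t - s)\<bar> \<le> e * (t - s)"
          by (rule step) (use 2 sT t s d E_diff[OF sT(3) 2 t(2)] in \<open>auto simp: dist_real_def\<close>)
        moreover have "\<bar>E s - E t - h * (s - t)\<bar> = \<bar>E t - E s - h * (t - s)\<bar>" by (simp add: algebra_simps)
        ultimately show ?thesis using 2 by simp
      next
        case 3
        have "E s - E t = integral {t..s} (\<lambda>\<tau>. B \<tau> (\<lambda>x. u s x + u t x) (\<lambda>x. p s x + p t x))"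
          using E_diff[of t s] t 3 sT by (simp add: add.commute)
        then have "\<bar>E s - E t - h * (s - t)\<bar> \<le> e * (s - t)"
          by (intro step) (use 3 sT t s d in \<open>auto simp: dist_real_def\<close>)
        then show ?thesis using 3 by simp
      qed simp
    qed
    then show ?thesis using d(1) by blast
  qed
  have "(E has_derivative (*) h) (at t)"
    unfolding has_derivative_at_alt using key by (auto intro: bounded_linear_mult_right)
  then show ?thesis unfolding h has_field_derivative_def .
qed

text \<open>A single term of Green's formula survives: \<open>u\<close> vanishes at both ends, and
  each of \<open>\<phi>0\<close> and \<open>\<phi>1\<close> at one of them.\<close>

lemma trace_identity:
  assumes "t \<in> {0..T}"
  shows "integral {0..1} (\<lambda>x. g t x * \<phi>0 x) = p t 0" "integral {0..1} (\<lambda>x. g t x * \<phi>1 x) = - p t 1"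
  using prim_integral[OF green_prim[OF u_prim[OF assms] p_prim[OF assms] \<phi>_prim(1,2)]]
    prim_integral[OF green_prim[OF u_prim[OF assms] p_prim[OF assms] \<phi>_prim(3,4)]] boundary_values[OF assms]
  by (simp_all add: \<phi>0_def \<phi>1_def)

lemma Gamma_lebesgue: "Gamma_l T vl \<in> sets lebesgue" "Gamma_r T vr \<in> sets lebesgue"
proof -
  have "openin (top_of_set {0..T}) ({0..T} \<inter> vl -` {0<..})" "openin (top_of_set {0..T}) ({0..T} \<inter> vr -` {..<0})"
    using cvl cvr by (auto intro!: continuous_openin_preimage_gen)
  then obtain U V where "open U" "{0..T} \<inter> vl -` {0<..} = {0..T} \<inter> U" "open V" "{0..T} \<inter> vr -` {..<0} = {0..T} \<inter> V"
    unfolding openin_open by blast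
  moreover have "Gamma_l T vl = {0..T} \<inter> vl -` {0<..}" "Gamma_r T vr = {0..T} \<inter> vr -` {..<0}"
    by (auto simp: Gamma_l_def Gamma_r_def)
  ultimately show "Gamma_l T vl \<in> sets lebesgue" "Gamma_r T vr \<in> sets lebesgue"
    by (auto intro!: sets_completionI_sets sets.Int borel_open)
qed

lemma inflow_data_equal:
  obtains N where "negligible N"
    "\<And>t. t \<in> Gamma_l T vl \<Longrightarrow> t \<notin> N \<Longrightarrow> yl1 t = yl2 t" "\<And>t. t \<in> Gamma_r T vr \<Longrightarrow> t \<notin> N \<Longrightarrow> yr1 t = yr2 t"
proof -
  have ae: "AE t in lebesgue_on (Gamma_r T vr). yr1 t = yrc t" "AE t in lebesgue_on (Gamma_l T vl). yl1 t = ylc t"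
    "AE t in lebesgue_on (Gamma_r T vr). yr2 t = yrc t" "AE t in lebesgue_on (Gamma_l T vl). yl2 t = ylc t"
    using ws1 ws2 by (simp_all add: weak_solution_def)
  define N where "N = {t \<in> Gamma_r T vr. \<not> yr1 t = yrc t} \<union> {t \<in> Gamma_l T vl. \<not> yl1 t = ylc t}
     \<union> {t \<in> Gamma_r T vr. \<not> yr2 t = yrc t} \<union> {t \<in> Gamma_l T vl. \<not> yl2 t = ylc t}"
  have "negligible N"
    unfolding N_def
    by (intro negligible_Un iffD1[OF negligible_iff_AE_lebesgue_on[OF Gamma_lebesgue(1)]]
        iffD1[OF negligible_iff_AE_lebesgue_on[OF Gamma_lebesgue(2)]] ae)
  then show ?thesis by (rule that) (auto simp: N_def)
qed

text \<open>At an inflow end either the velocity vanishes or both solutions carry the same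
  prescribed data. The arguments \<open>1 0\<close> and \<open>0 1\<close> are the end values of
  \<open>\<phi>0\<close> and \<open>\<phi>1\<close>, each of which sees one end only.\<close>

lemma boundary_flux_zero:
  assumes st: "0 \<le> s" "t \<le> T"
  shows "(\<And>\<tau>. \<tau> \<in> {s..t} \<Longrightarrow> 0 \<le> vl \<tau>) \<Longrightarrow> integral {s..t} (boundary_flux 1 0) = 0"
    and "(\<And>\<tau>. \<tau> \<in> {s..t} \<Longrightarrow> vr \<tau> \<le> 0) \<Longrightarrow> integral {s..t} (boundary_flux 0 1) = 0"
proof -
  obtain N where N: "negligible N"
    "\<And>t. t \<in> Gamma_l T vl \<Longrightarrow> t \<notin> N \<Longrightarrow> yl1 t = yl2 t" "\<And>t. t \<in> Gamma_r T vr \<Longrightarrow> t \<notin> N \<Longrightarrow> yr1 t = yr2 t"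
    using inflow_data_equal by blast
  show "integral {s..t} (boundary_flux 1 0) = 0" if pos: "\<And>\<tau>. \<tau> \<in> {s..t} \<Longrightarrow> 0 \<le> vl \<tau>"
  proof -
    have "integral {s..t} (boundary_flux 1 0) = integral {s..t} (\<lambda>t. 0)"
    proof (rule integral_spike[OF N(1)])
      fix \<tau> assume \<tau>: "\<tau> \<in> {s..t} - N"
      then have "vl \<tau> = 0 \<or> \<tau> \<in> Gamma_l T vl" using pos[of \<tau>] st by (auto simp: Gamma_l_def)
      then show "0 = boundary_flux 1 0 \<tau>" using N(2)[of \<tau>] \<tau> by (auto simp: boundary_flux_def)
    qed
    then show ?thesis by simp
  qed
  show "integral {s..t} (boundary_flux 0 1) = 0" if neg: "\<And>\<tau>. \<tau> \<in> {s..t} \<Longrightarrow> vr \<tau> \<le> 0"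
  proof -
    have "integral {s..t} (boundary_flux 0 1) = integral {s..t} (\<lambda>t. 0)"
    proof (rule integral_spike[OF N(1)])
      fix \<tau> assume \<tau>: "\<tau> \<in> {s..t} - N"
      then have "vr \<tau> = 0 \<or> \<tau> \<in> Gamma_r T vr" using neg[of \<tau>] st by (auto simp: Gamma_r_def)
      then show "0 = boundary_flux 0 1 \<tau>" using N(3)[of \<tau>] \<tau> by (auto simp: boundary_flux_def)
    qed
    then show ?thesis by simp
  qed
qed

lemma \<phi>_continuous: "continuous_on {0..1} \<phi>0" "continuous_on {0..1} \<phi>0'" "continuous_on {0..1} \<phi>1" "continuous_on {0..1} \<phi>1'"
  using \<phi>_prim by (auto intro: prim_continuous)

text \<open>By \<open>trace_identity\<close> the traces are pairings of \<open>g\<close> with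
  \<open>\<phi>0\<close> and \<open>\<phi>1\<close>, so \<open>difference_identity\<close>
  differentiates them. The sign of the velocity enters because each of these functions is
  \<open>1\<close> at its own end, where outflow data would be unknown.\<close>

lemma trace_derivative:
  assumes T01: "0 \<le> T0" "T1 \<le> T" and t: "T0 < t" "t < T1"
  shows "(\<And>\<tau>. \<tau> \<in> {T0..T1} \<Longrightarrow> 0 \<le> vl \<tau>) \<Longrightarrow> ((\<lambda>t. p t 0) has_real_derivative B t \<phi>0 \<phi>0') (at t)"
    and "(\<And>\<tau>. \<tau> \<in> {T0..T1} \<Longrightarrow> vr \<tau> \<le> 0) \<Longrightarrow> ((\<lambda>t. p t 1) has_real_derivative - B t \<phi>1 \<phi>1') (at t)"
proof -
  have sub: "{T0..T1} \<subseteq> {0..T}" using T01 by auto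
  show "((\<lambda>t. p t 0) has_real_derivative B t \<phi>0 \<phi>0') (at t)" if pos: "\<And>\<tau>. \<tau> \<in> {T0..T1} \<Longrightarrow> 0 \<le> vl \<tau>"
  proof (rule integral_function_derivative[of T0 T1])
    show "continuous_on {T0..T1} (\<lambda>t. B t \<phi>0 \<phi>0')"
      by (rule continuous_on_subset[OF B_continuous sub]) (rule \<phi>_continuous)+
    fix s t assume st: "T0 \<le> s" "s < t" "t < T1"
    have "integral {s..t} (boundary_flux (\<phi>0 0) (\<phi>0 1)) = 0"
      using boundary_flux_zero(1)[of s t] st T01 pos by (simp add: \<phi>0_def)
    moreover have "integral {s..t} (\<lambda>\<tau>. B \<tau> \<phi>0 \<phi>0') = integral {s..t} (boundary_flux (\<phi>0 0) (\<phi>0 1))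
        + integral {0..1} (\<lambda>x. g t x * \<phi>0 x) - integral {0..1} (\<lambda>x. g s x * \<phi>0 x)"
      by (rule difference_identity(1)) (use st T01 in \<open>auto intro!: prim_derivative \<phi>_prim \<phi>_continuous\<close>)
    ultimately show "p t 0 - p s 0 = integral {s..t} (\<lambda>t. B t \<phi>0 \<phi>0')"
      using trace_identity(1)[of s] trace_identity(1)[of t] st T01 by simp
  qed (use t in auto)
  show "((\<lambda>t. p t 1) has_real_derivative - B t \<phi>1 \<phi>1') (at t)" if neg: "\<And>\<tau>. \<tau> \<in> {T0..T1} \<Longrightarrow> vr \<tau> \<le> 0"
  proof -
    have "((\<lambda>t. - p t 1) has_real_derivative B t \<phi>1 \<phi>1') (at t)"
    proof (rule integral_function_derivative[of T0 T1])
      show "continuous_on {T0..T1} (\<lambda>t. B t \<phi>1 \<phi>1')"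
        by (rule continuous_on_subset[OF B_continuous sub]) (rule \<phi>_continuous)+
      fix s t assume st: "T0 \<le> s" "s < t" "t < T1"
      have "integral {s..t} (boundary_flux (\<phi>1 0) (\<phi>1 1)) = 0"
        using boundary_flux_zero(2)[of s t] st T01 neg by (simp add: \<phi>1_def)
      moreover have "integral {s..t} (\<lambda>\<tau>. B \<tau> \<phi>1 \<phi>1') = integral {s..t} (boundary_flux (\<phi>1 0) (\<phi>1 1))
          + integral {0..1} (\<lambda>x. g t x * \<phi>1 x) - integral {0..1} (\<lambda>x. g s x * \<phi>1 x)"
        by (rule difference_identity(1)) (use st T01 in \<open>auto intro!: prim_derivative \<phi>_prim \<phi>_continuous\<close>)
      ultimately show "- p t 1 - - p s 1 = integral {s..t} (\<lambda>t. B t \<phi>1 \<phi>1')"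
        using trace_identity(2)[of s] trace_identity(2)[of t] st T01 by simp
    qed (use t in auto)
    from DERIV_minus[OF this] show ?thesis by simp
  qed
qed

text \<open>The products are subtracted as \<open>y1 * (v1 - v2) + (y1 - y2) * v2\<close>:
  \<open>y1\<close> meets only \<open>u\<close> and \<open>p\<close>, which the energy controls,
  while \<open>g\<close> meets \<open>v2\<close> and is removed by integration by parts.\<close>

lemma B_alt:
  assumes t: "t \<in> {0..T}" and c: "continuous_on {0..1} \<psi>" "continuous_on {0..1} \<psi>'"
  shows "B t \<psi> \<psi>' = integral {0..1} (\<lambda>x. y1 t x * (u t x * \<psi>' x - p t x * \<psi> x) + g t x * (v2 t x * \<psi>' x - dx v2 t x * \<psi> x))"
  unfolding B_def Henstock_Kurzweil_Integration.integral_diff[OF B_integrable[OF t c], symmetric]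
  by (rule integral_cong) (simp add: u_def p_def g_def algebra_simps)

text \<open>For \<open>\<psi> = u\<close> and \<open>\<psi>' = p\<close> the part with
  \<open>y1\<close> cancels pointwise, as \<open>u * p - p * u\<close>.\<close>

lemma B_energy:
  assumes t: "t \<in> {0..T}"
  shows "B t (u t) (p t) = integral {0..1} (\<lambda>x. g t x * (v2 t x * p t x - dx v2 t x * u t x))"
  unfolding B_alt[OF t slice_continuous(5,6)[OF t]] by (simp add: mult.commute)

lemma trace_continuous: "continuous_on {0..T} (\<lambda>t. p t 0)" "continuous_on {0..T} (\<lambda>t. p t 1)"
proof -
  have "continuous_on {0..T} (\<lambda>t. p (fst (t, z)) (snd (t, z)))" if "z \<in> {0..1}" for z
    by (rule continuous_on_compose2[OF jointly_continuous(6), of _ "\<lambda>t. (t, z)"]) (use that in \<open>auto intro!: continuous_intros\<close>)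
  from this[of 0] this[of 1] show "continuous_on {0..T} (\<lambda>t. p t 0)" "continuous_on {0..T} (\<lambda>t. p t 1)" by simp_all
qed

end

section \<open>Weights at the two ends, and intervals of constant sign\<close>

lemma two_mult_le_abs:
  fixes a b c k :: real
  assumes "\<bar>k\<bar> \<le> 1"
  shows "2 * a * b * (c * k) \<le> \<bar>c\<bar> * (a\<^sup>2 + b\<^sup>2)"
proof -
  have ab: "\<bar>2 * a * b\<bar> \<le> a\<^sup>2 + b\<^sup>2"
    using sum_squares_bound[of "\<bar>a\<bar>" "\<bar>b\<bar>"] by (simp add: abs_mult)
  have "2 * a * b * (c * k) \<le> \<bar>2 * a * b\<bar> * (\<bar>c\<bar> * \<bar>k\<bar>)"
    using abs_ge_self[of "2 * a * b * (c * k)"] by (simp only: abs_mult[of "2 * a * b"] abs_mult[of c])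
  also have "\<dots> \<le> (a\<^sup>2 + b\<^sup>2) * (\<bar>c\<bar> * 1)"
    using assms ab by (intro mult_mono mult_left_mono) auto
  finally show ?thesis by (simp add: mult.commute)
qed

lemma weighted_square_le:
  fixes a q R :: real
  assumes "\<bar>q\<bar> \<le> 3 * R" shows "2 * a\<^sup>2 * q \<le> 6 * (R * a\<^sup>2)"
proof -
  have "a\<^sup>2 * q \<le> a\<^sup>2 * (3 * R)" using assms by (intro mult_left_mono) auto
  then show ?thesis by (simp add: mult.commute)
qed

text \<open>
  The weights \<open>\<alpha>\<close> and \<open>\<beta>\<close> are \<open>1\<close> at an inflow end and \<open>0\<close> at an outflow end.  At an outflow end the
  boundary term of the energy, in \<open>X\<close>, has a good sign and absorbs the cross term of the other end's trace.
\<close>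

lemma weighted_energy_le:
  fixes X Y Z C1 C2 R a b e l r \<alpha> \<beta> :: real
  assumes X: "X \<le> C1 * e - (b * r - a * l)"
    and Y: "Y \<le> C2 * (e + a) + 6 * (R * a) + \<bar>r\<bar> * (a + b)"
    and Z: "Z \<le> C2 * (e + b) + 6 * (R * b) + \<bar>l\<bar> * (a + b)"
    and nn: "0 \<le> a" "0 \<le> b" "0 \<le> e" "0 \<le> C1" "0 \<le> C2" and lr: "\<bar>l\<bar> \<le> R" "\<bar>r\<bar> \<le> R"
    and \<alpha>: "\<alpha> = 1 \<and> 0 \<le> l \<or> \<alpha> = 0 \<and> l \<le> 0" and \<beta>: "\<beta> = 1 \<and> r \<le> 0 \<or> \<beta> = 0 \<and> 0 \<le> r"
  shows "X + \<alpha> * Y + \<beta> * Z \<le> (C1 + 2 * C2 + 9 * R) * (e + \<alpha> * a + \<beta> * b)"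
proof -
  have R: "0 \<le> R" using lr(1) by linarith
  have m: "\<bar>l\<bar> * a \<le> R * a" "\<bar>l\<bar> * b \<le> R * b" "\<bar>r\<bar> * a \<le> R * a" "\<bar>r\<bar> * b \<le> R * b"
    using lr nn by (intro mult_right_mono; simp)+
  have nn2: "0 \<le> R * a" "0 \<le> R * b" "0 \<le> R * e" "0 \<le> C1 * a" "0 \<le> C1 * b" "0 \<le> C2 * a" "0 \<le> C2 * b" "0 \<le> C2 * e"
    "0 \<le> \<bar>r\<bar> * a" "0 \<le> \<bar>r\<bar> * b" "0 \<le> \<bar>l\<bar> * a" "0 \<le> \<bar>l\<bar> * b"
    using R nn by simp_all
  have ex: "C2 * (e + a) = C2 * e + C2 * a" "C2 * (e + b) = C2 * e + C2 * b"
    "\<bar>r\<bar> * (a + b) = \<bar>r\<bar> * a + \<bar>r\<bar> * b" "\<bar>l\<bar> * (a + b) = \<bar>l\<bar> * a + \<bar>l\<bar> * b"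
    by (simp_all add: distrib_left)
  have C: "(C1 + 2 * C2 + 9 * R) * x = C1 * x + 2 * (C2 * x) + 9 * (R * x)" for x
    by (simp add: algebra_simps)
  have sum: "(C1 + 2 * C2 + 9 * R) * (x + y + z) = (C1 * x + 2 * (C2 * x) + 9 * (R * x))
      + (C1 * y + 2 * (C2 * y) + 9 * (R * y)) + (C1 * z + 2 * (C2 * z) + 9 * (R * z))" for x y z
    by (simp only: C distrib_left)
  consider (1) "\<alpha> = 1" "\<beta> = 1" "0 \<le> l" "r \<le> 0" | (2) "\<alpha> = 1" "\<beta> = 0" "0 \<le> l" "0 \<le> r"
    | (3) "\<alpha> = 0" "\<beta> = 1" "l \<le> 0" "r \<le> 0" | (4) "\<alpha> = 0" "\<beta> = 0" "l \<le> 0" "0 \<le> r"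
    using \<alpha> \<beta> by auto
  then show ?thesis
  proof cases
    \<comment> \<open>Two inflow ends fix the constants: \<open>e\<close> occurs in both trace
      bounds, which gives \<open>2 * C2\<close>, and \<open>a\<close> has the coefficient
      \<open>6 * R\<close> plus \<open>\<bar>l\<bar>\<close> from \<open>X\<close> and
      \<open>\<bar>l\<bar> + \<bar>r\<bar>\<close> from the cross terms, together at most
      \<open>9 * R\<close>.\<close>
    case 1
    then have "b * r = - (\<bar>r\<bar> * b)" "a * l = \<bar>l\<bar> * a" by simp_all
    then have "X + Y + Z \<le> (C1 + 2 * C2 + 9 * R) * (e + a + b)"
      using X Y Z m nn2 unfolding sum ex by linarith
    then show ?thesis by (simp add: 1)
  next
    case 2
    then have "b * r = \<bar>r\<bar> * b" "a * l = \<bar>l\<bar> * a" by simp_all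
    then have "X + Y \<le> (C1 + 2 * C2 + 9 * R) * (e + a + 0)"
      using X Y m nn2 unfolding sum ex by linarith
    then show ?thesis by (simp add: 2)
  next
    case 3
    then have "b * r = - (\<bar>r\<bar> * b)" "a * l = - (\<bar>l\<bar> * a)" by simp_all
    then have "X + Z \<le> (C1 + 2 * C2 + 9 * R) * (e + b + 0)"
      using X Z m nn2 unfolding sum ex by linarith
    then show ?thesis by (simp add: 3)
  next
    case 4
    then have "b * r = \<bar>r\<bar> * b" "a * l = - (\<bar>l\<bar> * a)" by simp_all
    then have "X \<le> (C1 + 2 * C2 + 9 * R) * (e + 0 + 0)"
      using X m nn2 unfolding sum ex by linarith
    then show ?thesis by (simp add: 4)
  qed
qed

text \<open>Only zeros to the right of \<open>a\<close> count: \<open>c\<close> is halfway to the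
  first of them, or to \<open>b\<close>, so neither function vanishes on \<open>(a, c]\<close>,
  while \<open>a\<close> itself may be a zero. A sign change on \<open>[a, c]\<close> would produce
  a zero in \<open>(a, c]\<close> by the intermediate value theorem.\<close>

lemma exists_no_sign_change_right:
  fixes f h :: "real \<Rightarrow> real"
  assumes "continuous_on {a..b} f" "continuous_on {a..b} h" and ab: "a < b"
    and fin: "finite {t \<in> {a..b}. f t = 0}" "finite {t \<in> {a..b}. h t = 0}"
  obtains c where "a < c" "c \<le> b" "no_sign_change_on {a..c} f" "no_sign_change_on {a..c} h"
proof -
  define Z where "Z = insert b ({t \<in> {a..b}. f t = 0} \<union> {t \<in> {a..b}. h t = 0}) \<inter> {a<..b}"
  have Z: "finite Z" "Z \<noteq> {}" using fin ab by (auto simp: Z_def)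
  define c where "c = (a + Min Z) / 2"
  have "Min Z \<in> Z" using Z by (rule Min_in)
  moreover have "Z \<subseteq> {a<..b}" unfolding Z_def by blast
  ultimately have "Min Z \<in> {a<..b}" by blast
  then have m: "a < Min Z" "Min Z \<le> b" by (simp_all only: greaterThanAtMost_iff)
  then have c: "a < c" "c < Min Z" "c \<le> b" by (auto simp: c_def)
  have nz: "f t \<noteq> 0" "h t \<noteq> 0" if "a < t" "t \<le> c" for t
  proof -
    have "t \<notin> Z" using Min_le[OF Z(1), of t] that c by auto
    then show "f t \<noteq> 0" "h t \<noteq> 0" using that c by (auto simp: Z_def)
  qed
  have sign: "no_sign_change_on {a..c} k" if k: "continuous_on {a..b} k" and nz: "\<And>t. a < t \<Longrightarrow> t \<le> c \<Longrightarrow> k t \<noteq> 0" for k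
  proof (rule ccontr)
    assume "\<not> no_sign_change_on {a..c} k"
    then obtain s t where st: "s \<in> {a..c}" "t \<in> {a..c}" "k s < 0" "0 < k t"
      unfolding no_sign_change_on_def by (meson not_le)
    have ck: "continuous_on {min s t..max s t} k" by (rule continuous_on_subset[OF k]) (use st c in auto)
    have "\<exists>z. min s t \<le> z \<and> z \<le> max s t \<and> k z = 0"
    proof (cases "s \<le> t")
      case True
      then show ?thesis using IVT'[of k s 0 t] st ck by (auto simp: min_def max_def)
    next
      case False
      then show ?thesis using IVT2'[of k s 0 t] st ck by (auto simp: min_def max_def)
    qed
    then obtain z where z: "min s t \<le> z" "z \<le> max s t" "k z = 0" by blast
    have "z \<noteq> s" "z \<noteq> t" using z(3) st by auto
    then have "a < z" "z \<le> c" using z st by (auto simp: min_def max_def split: if_splits)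
    then show False using nz z(3) by blast
  qed
  show ?thesis by (rule that[OF c(1) c(3) sign[OF assms(1) nz(1)] sign[OF assms(2) nz(2)]])
qed

section \<open>The energy estimate\<close>

context two_solutions
begin

lemma uniform_bounds:
  obtains R Y where "R \<ge> 0" "Y \<ge> 0"
    "\<And>t x. t \<in> {0..T} \<Longrightarrow> x \<in> {0..1} \<Longrightarrow> \<bar>v2 t x\<bar> \<le> R \<and> \<bar>dx v2 t x\<bar> \<le> R"
    "\<And>t. t \<in> {0..T} \<Longrightarrow> integral {0..1} (\<lambda>x. (y2 t x - \<kappa>)\<^sup>2) \<le> Y"
    "\<And>t. t \<in> {0..T} \<Longrightarrow> integral {0..1} (\<lambda>x. (y1 t x)\<^sup>2) \<le> Y"
proof -
  obtain R3 where R3: "R3 \<ge> 0" "\<And>t x. t \<in> {0..T} \<Longrightarrow> x \<in> {0..1} \<Longrightarrow> \<bar>v2 t x\<bar> \<le> R3"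
    using continuous_rectangle_bounded[OF jointly_continuous(3)] by blast
  obtain R4 where R4: "R4 \<ge> 0" "\<And>t x. t \<in> {0..T} \<Longrightarrow> x \<in> {0..1} \<Longrightarrow> \<bar>dx v2 t x\<bar> \<le> R4"
    using continuous_rectangle_bounded[OF jointly_continuous(4)] by blast
  obtain Y1 where Y1: "\<And>t. t \<in> {0..T} \<Longrightarrow> integral {0..1} (\<lambda>x. (y1 t x)\<^sup>2) \<le> Y1"
    using C0_L2_bounded[OF y_C0(1) less_imp_le[OF T]] by blast
  obtain Y2 where Y2: "\<And>t. t \<in> {0..T} \<Longrightarrow> integral {0..1} (\<lambda>x. (y2 t x - \<kappa>)\<^sup>2) \<le> Y2"
    using C0_L2_bounded[OF C0_L2_minus_const[OF y_C0(2), of \<kappa>] less_imp_le[OF T]] by blast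
  show ?thesis
  proof (rule that[of "max R3 R4" "max 0 (max Y1 Y2)"])
    show "\<bar>v2 t x\<bar> \<le> max R3 R4 \<and> \<bar>dx v2 t x\<bar> \<le> max R3 R4" if "t \<in> {0..T}" "x \<in> {0..1}" for t x
      using R3(2)[OF that] R4(2)[OF that] by auto
    show "integral {0..1} (\<lambda>x. (y2 t x - \<kappa>)\<^sup>2) \<le> max 0 (max Y1 Y2)" if "t \<in> {0..T}" for t
      using Y2[OF that] by simp
    show "integral {0..1} (\<lambda>x. (y1 t x)\<^sup>2) \<le> max 0 (max Y1 Y2)" if "t \<in> {0..T}" for t
      using Y1[OF that] by simp
  qed (use R3 in auto)
qed

lemma energy_estimate:
  obtains C where "C > 0"
    "\<And>T0 T1. 0 \<le> T0 \<Longrightarrow> T0 < T1 \<Longrightarrow> T1 \<le> T \<Longrightarrow> no_sign_change_on {T0..T1} vl \<Longrightarrow> no_sign_change_on {T0..T1} vr \<Longrightarrow>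
      E T1 \<le> (E T0 + (p T0 0)\<^sup>2 + (p T0 1)\<^sup>2) * exp (C * (T1 - T0))"
proof -
  obtain R Y where R: "R \<ge> 0" and Y: "Y \<ge> 0"
    and Rb: "\<And>t x. t \<in> {0..T} \<Longrightarrow> x \<in> {0..1} \<Longrightarrow> \<bar>v2 t x\<bar> \<le> R \<and> \<bar>dx v2 t x\<bar> \<le> R"
    and Y2: "\<And>t. t \<in> {0..T} \<Longrightarrow> integral {0..1} (\<lambda>x. (y2 t x - \<kappa>)\<^sup>2) \<le> Y"
    and Y1: "\<And>t. t \<in> {0..T} \<Longrightarrow> integral {0..1} (\<lambda>x. (y1 t x)\<^sup>2) \<le> Y"
    using uniform_bounds by blast
  \<comment> \<open>\<open>C1\<close> comes from \<open>energy_bound\<close>, \<open>C2\<close> from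
    \<open>boundary_bound\<close> and their combination from \<open>weighted_energy_le\<close>. All
    are fixed before \<open>T0\<close> and \<open>T1\<close> are chosen.\<close>
  define C1 C2 C where "C1 = 2 * R + 1 + Y" and "C2 = 2 * Y + 9 * R\<^sup>2 + 10" and "C = C1 + 2 * C2 + 9 * R"
  have Cp: "C1 > 0" "C2 > 0" "C > 0"
  proof -
    show c: "C1 > 0" "C2 > 0" using R Y zero_le_power2[of R] unfolding C1_def C2_def by linarith+
    show "C > 0" using c R unfolding C_def by linarith
  qed
  have sinh_inv: "\<bar>1 / sinh (1::real)\<bar> \<le> 1" using sinh_1_ge by simp
  have b1: "2 * B t (u t) (p t) \<le> C1 * E t - ((p t 1)\<^sup>2 * vr t - (p t 0)\<^sup>2 * vl t)" if t: "t \<in> {0..T}" for t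
    unfolding B_energy[OF t] C1_def boundary_values(3,4)[OF t, symmetric]
    by (rule energy_bound[OF u_prim[OF t] p_prim[OF t] boundary_values(5,6)[OF t] velocity_prims(3,4)[OF t] y_abs_int(3)[OF t]
          L2_diff[OF y_L2(2)[OF t] L2_continuous[OF continuous_on_const]] _ Y2[OF t] E_def])
      (use Rb[OF t] in auto)
  have bb: "2 * z * B t \<phi> \<phi>' \<le> C2 * (E t + z\<^sup>2) - 2 * z * (p t 1 * (vr t * \<phi>' 1 - dx v2 t 1 * \<phi> 1) - p t 0 * (vl t * \<phi>' 0 - dx v2 t 0 * \<phi> 0))"
    if t: "t \<in> {0..T}" and \<phi>: "prim \<phi> \<phi>'" "prim \<phi>' \<phi>" "\<And>x. x \<in> {0..1} \<Longrightarrow> \<bar>\<phi> x\<bar> \<le> 1 \<and> \<bar>\<phi>' x\<bar> \<le> 2" for t z \<phi> \<phi>'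
    unfolding B_alt[OF t prim_continuous[OF \<phi>(1)] prim_continuous[OF \<phi>(2)]] C2_def boundary_values(3,4)[OF t, symmetric]
    by (rule boundary_bound[OF u_prim[OF t] p_prim[OF t] velocity_prims(3,4)[OF t] \<phi> y_abs_int(3)[OF t]
          L2_diff[OF y_L2(2)[OF t] L2_continuous[OF continuous_on_const]] y_L2(1)[OF t] Rb[OF t] Y2[OF t] Y1[OF t] E_def])
  have b2: "2 * p t 0 * B t \<phi>0 \<phi>0' \<le> C2 * (E t + (p t 0)\<^sup>2) + 6 * (R * (p t 0)\<^sup>2) + \<bar>vr t\<bar> * ((p t 0)\<^sup>2 + (p t 1)\<^sup>2)"
    if t: "t \<in> {0..T}" for t
  proof -
    \<comment> \<open>At the far end \<open>\<phi>0\<close> vanishes but its slope is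
      \<open>- 1 / sinh 1\<close>; hence the cross term of the two traces, with factor
      \<open>vr t\<close>.\<close>
    have e: "\<phi>0 1 = 0" "\<phi>0 0 = 1" "\<phi>0' 1 = - (1 / sinh 1)" by (simp_all add: \<phi>0_def \<phi>0'_def)
    have r: "\<bar>vl t\<bar> \<le> R" "\<bar>dx v2 t 0\<bar> \<le> R" using Rb[OF t, of 0] boundary_values(3)[OF t] by auto
    have "\<bar>vl t * \<phi>0' 0\<bar> \<le> R * 2" unfolding abs_mult using r R \<phi>_bound(1)[of 0] by (intro mult_mono) auto
    then have "\<bar>vl t * \<phi>0' 0 - dx v2 t 0\<bar> \<le> 3 * R" using r(2) abs_triangle_ineq4[of "vl t * \<phi>0' 0" "dx v2 t 0"] by linarith
    from weighted_square_le[OF this, of "p t 0"]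
    have 1: "2 * (p t 0)\<^sup>2 * (vl t * \<phi>0' 0 - dx v2 t 0) \<le> 6 * (R * (p t 0)\<^sup>2)" .
    have 2: "2 * p t 0 * p t 1 * (vr t * (1 / sinh 1)) \<le> \<bar>vr t\<bar> * ((p t 0)\<^sup>2 + (p t 1)\<^sup>2)"
      by (rule two_mult_le_abs[OF sinh_inv])
    have "2 * p t 0 * B t \<phi>0 \<phi>0' \<le> C2 * (E t + (p t 0)\<^sup>2) - 2 * p t 0 * (p t 1 * (vr t * \<phi>0' 1 - dx v2 t 1 * \<phi>0 1) - p t 0 * (vl t * \<phi>0' 0 - dx v2 t 0 * \<phi>0 0))"
      by (rule bb[OF t \<phi>_prim(1,2) \<phi>_bound(1)])
    also have "2 * p t 0 * (p t 1 * (vr t * \<phi>0' 1 - dx v2 t 1 * \<phi>0 1) - p t 0 * (vl t * \<phi>0' 0 - dx v2 t 0 * \<phi>0 0))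
      = - (2 * p t 0 * p t 1 * (vr t * (1 / sinh 1))) - 2 * (p t 0)\<^sup>2 * (vl t * \<phi>0' 0 - dx v2 t 0)"
      unfolding e by (simp add: algebra_simps power2_eq_square)
    finally show ?thesis using 1 2 by linarith
  qed
  have b3: "2 * p t 1 * (- B t \<phi>1 \<phi>1') \<le> C2 * (E t + (p t 1)\<^sup>2) + 6 * (R * (p t 1)\<^sup>2) + \<bar>vl t\<bar> * ((p t 0)\<^sup>2 + (p t 1)\<^sup>2)"
    if t: "t \<in> {0..T}" for t
  proof -
    have e: "\<phi>1 1 = 1" "\<phi>1 0 = 0" "\<phi>1' 0 = 1 / sinh 1" by (simp_all add: \<phi>1_def \<phi>1'_def)
    have r: "\<bar>vr t\<bar> \<le> R" "\<bar>dx v2 t 1\<bar> \<le> R" using Rb[OF t, of 1] boundary_values(4)[OF t] by auto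
    have "\<bar>vr t * \<phi>1' 1\<bar> \<le> R * 2" unfolding abs_mult using r R \<phi>_bound(2)[of 1] by (intro mult_mono) auto
    then have "\<bar>vr t * \<phi>1' 1 - dx v2 t 1\<bar> \<le> 3 * R" using r(2) abs_triangle_ineq4[of "vr t * \<phi>1' 1" "dx v2 t 1"] by linarith
    from weighted_square_le[OF this, of "p t 1"]
    have 1: "2 * (p t 1)\<^sup>2 * (vr t * \<phi>1' 1 - dx v2 t 1) \<le> 6 * (R * (p t 1)\<^sup>2)" .
    have 2: "2 * p t 0 * p t 1 * (- vl t * (1 / sinh 1)) \<le> \<bar>- vl t\<bar> * ((p t 0)\<^sup>2 + (p t 1)\<^sup>2)"
      by (rule two_mult_le_abs[OF sinh_inv])
    have "2 * (- p t 1) * B t \<phi>1 \<phi>1' \<le> C2 * (E t + (- p t 1)\<^sup>2) - 2 * (- p t 1) * (p t 1 * (vr t * \<phi>1' 1 - dx v2 t 1 * \<phi>1 1) - p t 0 * (vl t * \<phi>1' 0 - dx v2 t 0 * \<phi>1 0))"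
      by (rule bb[OF t \<phi>_prim(3,4) \<phi>_bound(2)])
    also have "2 * (- p t 1) * (p t 1 * (vr t * \<phi>1' 1 - dx v2 t 1 * \<phi>1 1) - p t 0 * (vl t * \<phi>1' 0 - dx v2 t 0 * \<phi>1 0))
      = - (2 * p t 0 * p t 1 * (- vl t * (1 / sinh 1))) - 2 * (p t 1)\<^sup>2 * (vr t * \<phi>1' 1 - dx v2 t 1)"
      unfolding e by (simp add: algebra_simps power2_eq_square)
    finally show ?thesis using 1 2 by simp
  qed
  show ?thesis
  proof (rule that[OF Cp(3)])
    fix T0 T1 assume T01: "0 \<le> T0" "T0 < T1" "T1 \<le> T" and sl: "no_sign_change_on {T0..T1} vl" and sr: "no_sign_change_on {T0..T1} vr"
    \<comment> \<open>A velocity that vanishes throughout counts as inflow. Weight \<open>0\<close>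
      then means that the outflow sign holds on the whole interval, as there is no sign
      change.\<close>
    define \<alpha> \<beta> :: real where "\<alpha> = (if \<forall>t\<in>{T0..T1}. 0 \<le> vl t then 1 else 0)" and "\<beta> = (if \<forall>t\<in>{T0..T1}. vr t \<le> 0 then 1 else 0)"
    have \<alpha>: "\<alpha> = 1 \<and> (\<forall>t\<in>{T0..T1}. 0 \<le> vl t) \<or> \<alpha> = 0 \<and> (\<forall>t\<in>{T0..T1}. vl t \<le> 0)"
      using sl unfolding no_sign_change_on_def \<alpha>_def by auto
    have \<beta>: "\<beta> = 1 \<and> (\<forall>t\<in>{T0..T1}. vr t \<le> 0) \<or> \<beta> = 0 \<and> (\<forall>t\<in>{T0..T1}. 0 \<le> vr t)"
      using sr unfolding no_sign_change_on_def \<beta>_def by auto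
    define F where "F t = E t + \<alpha> * (p t 0)\<^sup>2 + \<beta> * (p t 1)\<^sup>2" for t
    define F' where "F' t = 2 * B t (u t) (p t) + \<alpha> * (2 * p t 0 * B t \<phi>0 \<phi>0') + \<beta> * (2 * p t 1 * (- B t \<phi>1 \<phi>1'))" for t
    have sub: "{T0..T1} \<subseteq> {0..T}" using T01 by auto
    have "F T1 \<le> F T0 * exp (C * (T1 - T0))"
    proof (rule Gronwall)
      show "continuous_on {T0..T1} F"
        unfolding F_def by (intro continuous_intros continuous_on_subset[OF E_continuous sub]
          continuous_on_subset[OF trace_continuous(1) sub] continuous_on_subset[OF trace_continuous(2) sub])
      fix t assume t: "T0 < t" "t < T1"
      then have tT: "t \<in> {0..T}" "t \<in> {T0..T1}" "0 < t" "t < T" using T01 by auto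
      have d0: "((\<lambda>t. \<alpha> * (p t 0)\<^sup>2) has_real_derivative \<alpha> * (2 * p t 0 * B t \<phi>0 \<phi>0')) (at t)"
      proof (cases "\<alpha> = 1")
        case True
        then have "((\<lambda>t. p t 0) has_real_derivative B t \<phi>0 \<phi>0') (at t)"
          using \<alpha> by (intro trace_derivative(1)[OF T01(1,3) t]) auto
        then show ?thesis by (auto intro!: derivative_eq_intros)
      qed (use \<alpha> in auto)
      have d1: "((\<lambda>t. \<beta> * (p t 1)\<^sup>2) has_real_derivative \<beta> * (2 * p t 1 * (- B t \<phi>1 \<phi>1'))) (at t)"
      proof (cases "\<beta> = 1")
        case True
        then have "((\<lambda>t. p t 1) has_real_derivative - B t \<phi>1 \<phi>1') (at t)"
          using \<beta> by (intro trace_derivative(2)[OF T01(1,3) t]) auto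
        then show ?thesis by (auto intro!: derivative_eq_intros)
      qed (use \<beta> in auto)
      show "(F has_real_derivative F' t) (at t)"
        unfolding F_def F'_def by (intro DERIV_add E_derivative tT d0 d1)
      define a b e where "a = (p t 0)\<^sup>2" and "b = (p t 1)\<^sup>2" and "e = E t"
      have nn: "0 \<le> a" "0 \<le> b" "0 \<le> e" using E_nonneg[OF tT(1)] by (auto simp: a_def b_def e_def)
      have r: "\<bar>vl t\<bar> \<le> R" "\<bar>vr t\<bar> \<le> R" using Rb[OF tT(1), of 0] Rb[OF tT(1), of 1] boundary_values(3,4)[OF tT(1)] by auto
      have "2 * B t (u t) (p t) + \<alpha> * (2 * p t 0 * B t \<phi>0 \<phi>0') + \<beta> * (2 * p t 1 * (- B t \<phi>1 \<phi>1')) \<le> C * (e + \<alpha> * a + \<beta> * b)"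
        unfolding C_def
      proof (rule weighted_energy_le[where l="vl t" and r="vr t"])
        show "2 * B t (u t) (p t) \<le> C1 * e - (b * vr t - a * vl t)"
          using b1[OF tT(1)] by (simp only: a_def b_def e_def)
        show "2 * p t 0 * B t \<phi>0 \<phi>0' \<le> C2 * (e + a) + 6 * (R * a) + \<bar>vr t\<bar> * (a + b)"
          using b2[OF tT(1)] by (simp only: a_def b_def e_def)
        show "2 * p t 1 * (- B t \<phi>1 \<phi>1') \<le> C2 * (e + b) + 6 * (R * b) + \<bar>vl t\<bar> * (a + b)"
          using b3[OF tT(1)] by (simp only: a_def b_def e_def)
        show "\<alpha> = 1 \<and> 0 \<le> vl t \<or> \<alpha> = 0 \<and> vl t \<le> 0" "\<beta> = 1 \<and> vr t \<le> 0 \<or> \<beta> = 0 \<and> 0 \<le> vr t"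
          using \<alpha> \<beta> tT(2) by blast+
      qed (use nn r Cp in simp_all)
      then show "F' t \<le> C * F t" unfolding F'_def F_def a_def b_def e_def .
    qed (use T01 in auto)
    \<comment> \<open>The weights are \<open>0\<close> or \<open>1\<close>, so \<open>F\<close> lies
      between \<open>E\<close> and \<open>E\<close> plus both squared traces, and the distinction of
      cases disappears from the estimate.\<close>
    moreover have "E T1 \<le> F T1" using \<alpha> \<beta> by (auto simp: F_def)
    moreover have "F T0 \<le> E T0 + (p T0 0)\<^sup>2 + (p T0 1)\<^sup>2" using \<alpha> \<beta> by (auto simp: F_def)
    then have "F T0 * exp (C * (T1 - T0)) \<le> (E T0 + (p T0 0)\<^sup>2 + (p T0 1)\<^sup>2) * exp (C * (T1 - T0))"
      by (rule mult_right_mono) simp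
    ultimately show "E T1 \<le> (E T0 + (p T0 0)\<^sup>2 + (p T0 1)\<^sup>2) * exp (C * (T1 - T0))" by linarith
  qed
qed

section \<open>Return to the norms of the statement, and uniqueness\<close>

lemma E_eq_H1_norm:
  assumes "t \<in> {0..T}" shows "(H1_norm {0<..<1} (\<lambda>x. v1 t x - v2 t x))\<^sup>2 = E t"
  using H1_norm_square_prim[OF u_prim[OF assms] slice_continuous(6)[OF assms]] unfolding E_def u_def[abs_def] .

lemma dx_difference:
  assumes "t \<in> {0..T}" "x \<in> {0..1}" shows "dx (\<lambda>t x. v1 t x - v2 t x) t x = p t x"
proof -
  have "(u t has_vector_derivative p t x) (at x within {0..1})"
    using prim_derivative[OF u_prim[OF assms(1)] slice_continuous(6)[OF assms(1)]] assms(2)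
    by (simp add: has_real_derivative_iff_has_vector_derivative)
  then show ?thesis
    unfolding dx_def using assms(2) vector_derivative_within_closed_interval[of 0 1 x "u t" "p t x"] by (simp add: u_def[abs_def])
qed

text \<open>\<open>u\<close> and \<open>p\<close> are continuous, so they vanish everywhere. The
  integral of \<open>u - g\<close> over any \<open>[c, d]\<close> is then
  \<open>p d - p c = 0\<close>, which forces \<open>g = u = 0\<close> almost everywhere.\<close>

lemma E_zero_imp:
  assumes t: "t \<in> {0..T}" and z: "E t = 0"
  shows "x \<in> {0..1} \<Longrightarrow> u t x = 0" "x \<in> {0..1} \<Longrightarrow> p t x = 0" "negligible {x \<in> {0..1}. g t x \<noteq> 0}"
proof -
  have i: "0 \<le> integral {0..1} (\<lambda>x. (u t x)\<^sup>2)" "0 \<le> integral {0..1} (\<lambda>x. (p t x)\<^sup>2)"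
    by (intro integral_nonneg integrable_continuous_interval continuous_intros slice_continuous[OF t]; simp)+
  then have "integral {0..1} (\<lambda>x. (u t x)\<^sup>2) = 0" "integral {0..1} (\<lambda>x. (p t x)\<^sup>2) = 0" using z by (simp_all add: E_def)
  then have up: "\<forall>x\<in>{0..1}. (u t x)\<^sup>2 = 0" "\<forall>x\<in>{0..1}. (p t x)\<^sup>2 = 0"
    using integral_eq_0_iff[of 0 1 "\<lambda>x. (u t x)\<^sup>2"] integral_eq_0_iff[of 0 1 "\<lambda>x. (p t x)\<^sup>2"] slice_continuous(5,6)[OF t]
    by (auto intro!: continuous_on_power)
  show u0: "x \<in> {0..1} \<Longrightarrow> u t x = 0" and p0: "x \<in> {0..1} \<Longrightarrow> p t x = 0" for x using up by auto
  have "negligible {x \<in> {0..1}. u t x - g t x \<noteq> 0}"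
  proof (rule negligible_if_integrals_zero[OF prim_abs_integrable[OF p_prim[OF t]]])
    fix c d :: real assume "0 \<le> c" "c \<le> d" "d \<le> 1"
    then show "integral {c..d} (\<lambda>x. u t x - g t x) = 0"
      using prim_diff_eq[OF p_prim[OF t], of c d] p0[of c] p0[of d] by simp
  qed
  moreover have "{x \<in> {0..1}. u t x - g t x \<noteq> 0} = {x \<in> {0..1}. g t x \<noteq> 0}" using u0 by auto
  ultimately show "negligible {x \<in> {0..1}. g t x \<noteq> 0}" by simp
qed

lemma integral_g_zero:
  assumes "negligible {x \<in> {0..1}. g t x \<noteq> 0}"
  shows "integral {0..1} (\<lambda>x. g t x * c x) = 0"
proof -
  have "integral {0..1} (\<lambda>x. g t x * c x) = integral {0..1} (\<lambda>x::real. 0)"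
    by (rule integral_spike[OF assms]) auto
  then show ?thesis by simp
qed

text \<open>In place of an induction over the sign changes, take the last zero \<open>s\<close> of
  \<open>E\<close> in \<open>[0, t]\<close>. At \<open>s\<close> the traces vanish together with
  \<open>E\<close>, so the estimate on a short interval of constant sign to the right of
  \<open>s\<close> produces a later zero.\<close>

lemma E_zero:
  assumes init: "AE x in lebesgue_on {0<..<1}. y01 x = y02 x"
    and fin: "finite {t \<in> {0..T}. vl t = 0}" "finite {t \<in> {0..T}. vr t = 0}"
    and t: "t \<in> {0..T}"
  shows "E t = 0"
proof (rule ccontr)
  assume nz: "E t \<noteq> 0"
  have T0: "0 \<in> {0..T}" using T by simp
  have "AE x in lebesgue_on {0<..<1}. y1 0 x = y01 x" "AE x in lebesgue_on {0<..<1}. y2 0 x = y02 x"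
    using ws1 ws2 by (simp_all add: weak_solution_def)
  then have "AE x in lebesgue_on {0<..<1}. y1 0 x = y2 0 x" using init by eventually_elim simp
  then have "negligible {x \<in> {0<..<1}. \<not> y1 0 x = y2 0 x}"
    by (rule iffD1[OF negligible_iff_AE_lebesgue_on, rotated]) simp
  then have "negligible ({x \<in> {0<..<1}. \<not> y1 0 x = y2 0 x} \<union> {0, 1})" by (rule negligible_Un) simp
  then have "negligible {x \<in> {0..1}. g 0 x \<noteq> 0}"
    by (rule negligible_subset) (auto simp: g_def less_le)
  then have E0: "E 0 = 0" using E_eq[OF T0] integral_g_zero by simp
  define S where "S = {0..t} \<inter> E -` {0}"
  have "closed S" unfolding S_def
    by (rule continuous_closed_preimage) (use t in \<open>auto intro: continuous_on_subset[OF E_continuous]\<close>)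
  moreover have "bounded S" by (rule bounded_subset[of "{0..t}"]) (auto simp: S_def)
  ultimately have cS: "compact S" by (simp add: compact_eq_bounded_closed)
  have S: "0 \<in> S" using E0 t by (simp add: S_def)
  obtain s where s: "s \<in> S" "\<And>r. r \<in> S \<Longrightarrow> r \<le> s" using compact_attains_sup[OF cS] S by blast
  have st: "0 \<le> s" "s < t" "E s = 0" using s(1) nz by (auto simp: S_def less_le)
  have sT: "s \<in> {0..T}" using st t by auto
  have sub: "{s..t} \<subseteq> {0..T}" using st t by auto
  have "finite {r \<in> {s..t}. vl r = 0}" "finite {r \<in> {s..t}. vr r = 0}"
    using sub by (auto intro: finite_subset[OF _ fin(1)] finite_subset[OF _ fin(2)])
  then obtain c where c: "s < c" "c \<le> t" "no_sign_change_on {s..c} vl" "no_sign_change_on {s..c} vr"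
    using exists_no_sign_change_right[OF continuous_on_subset[OF cvl sub] continuous_on_subset[OF cvr sub] st(2)] by blast
  obtain C where "\<And>T0 T1. 0 \<le> T0 \<Longrightarrow> T0 < T1 \<Longrightarrow> T1 \<le> T \<Longrightarrow> no_sign_change_on {T0..T1} vl \<Longrightarrow> no_sign_change_on {T0..T1} vr \<Longrightarrow>
      E T1 \<le> (E T0 + (p T0 0)\<^sup>2 + (p T0 1)\<^sup>2) * exp (C * (T1 - T0))"
    using energy_estimate by blast
  from this[OF st(1) c(1) _ c(3,4)] have "E c \<le> 0"
    using c(2) t st(3) E_zero_imp(2)[OF sT st(3), of 0] E_zero_imp(2)[OF sT st(3), of 1] by simp
  moreover have "0 \<le> E c" using E_nonneg[of c] c st t by auto
  ultimately have "c \<in> S" using c st by (simp add: S_def)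
  then have "c \<le> s" by (rule s(2))
  then show False using c(1) by simp
qed

text \<open>Once \<open>g\<close>, \<open>u\<close> and \<open>p\<close> vanish, the weak identity
  leaves only the flux, whose integral over each closed subinterval of \<open>[0, T)\<close> is then
  zero; \<open>\<phi>0\<close> and \<open>\<phi>1\<close> isolate the two ends. As the identity
  stops short of \<open>T\<close>, \<open>[0, T)\<close> is exhausted by closed intervals.\<close>

lemma boundary_flux_negligible:
  assumes z: "\<And>t. t \<in> {0..T} \<Longrightarrow> E t = 0"
  shows "negligible {t \<in> {0..T}. boundary_flux 1 0 t \<noteq> 0}" "negligible {t \<in> {0..T}. boundary_flux 0 1 t \<noteq> 0}"
proof -
  have B0: "B t \<psi> \<psi>' = 0" if t: "t \<in> {0..T}" and c: "continuous_on {0..1} \<psi>" "continuous_on {0..1} \<psi>'" for t \<psi> \<psi>'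
  proof -
    have "B t \<psi> \<psi>' = integral {0..1} (\<lambda>x. g t x * (v2 t x * \<psi>' x - dx v2 t x * \<psi> x))"
      unfolding B_alt[OF t c] by (rule integral_cong) (simp add: E_zero_imp(1,2)[OF t z[OF t]])
    then show ?thesis using integral_g_zero[OF E_zero_imp(3)[OF t z[OF t]]] by simp
  qed
  have flux: "negligible {t \<in> {0..T}. boundary_flux (\<phi> 0) (\<phi> 1) t \<noteq> 0}" if \<phi>: "prim \<phi> \<phi>'" "continuous_on {0..1} \<phi>'" for \<phi> \<phi>'
  proof -
    have c: "continuous_on {0..1} \<phi>" using \<phi>(1) by (rule prim_continuous)
    have d: "(\<phi> has_real_derivative \<phi>' x) (at x within {0..1})" if "x \<in> {0..1}" for x
      using prim_derivative[OF \<phi>] that by auto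
    have zero: "integral {s..t} (boundary_flux (\<phi> 0) (\<phi> 1)) = 0" if st: "0 \<le> s" "s < t" "t < T" for s t
    proof -
      have "integral {s..t} (\<lambda>\<tau>. B \<tau> \<phi> \<phi>') = integral {s..t} (\<lambda>\<tau>::real. 0)"
        by (rule integral_cong) (use st in \<open>auto intro!: B0 c \<phi>\<close>)
      moreover have "integral {0..1} (\<lambda>x. g r x * \<phi> x) = 0" if "r \<in> {0..T}" for r
        by (rule integral_g_zero[OF E_zero_imp(3)[OF that z[OF that]]])
      ultimately show ?thesis using difference_identity(1)[OF st d \<phi>(2)] st by simp
    qed
    \<comment> \<open>The offset \<open>2\<close> keeps the right end positive even for
      \<open>n = 0\<close>, as \<open>difference_identity\<close> asks for \<open>s < t\<close> and
      is applied with \<open>s = 0\<close>.\<close>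
    have "negligible {t \<in> {0..T - T / real (n + 2)}. boundary_flux (\<phi> 0) (\<phi> 1) t \<noteq> 0}" for n :: nat
    proof (rule negligible_if_integrals_zero)
      have "T * 1 < T * real (n + 2)" using T by (intro mult_strict_left_mono) auto
      then have "T / real (n + 2) < T" by (simp add: divide_less_eq)
      moreover have "0 < T / real (n + 2)" using T by simp
      ultimately have lt: "0 < T - T / real (n + 2)" "T - T / real (n + 2) < T" by linarith+
      then show "boundary_flux (\<phi> 0) (\<phi> 1) absolutely_integrable_on {0..T - T / real (n + 2)}"
        using difference_identity(2)[OF order_refl _ _ d \<phi>(2)] by blast
      fix c e assume ce: "0 \<le> c" "c \<le> e" "e \<le> T - T / real (n + 2)"
      then have "e < T" using lt(2) by linarith
      then show "integral {c..e} (boundary_flux (\<phi> 0) (\<phi> 1)) = 0" using zero[of c e] ce by (cases "c = e") auto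
    qed
    then have "negligible (\<Union>n. {t \<in> {0..T - T / real (n + 2)}. boundary_flux (\<phi> 0) (\<phi> 1) t \<noteq> 0})"
      by (rule negligible_Union_nat)
    then have "negligible ((\<Union>n. {t \<in> {0..T - T / real (n + 2)}. boundary_flux (\<phi> 0) (\<phi> 1) t \<noteq> 0}) \<union> {T})"
      by (rule negligible_Un) simp
    then show ?thesis
    proof (rule negligible_subset, intro subsetI)
      fix t assume t: "t \<in> {t \<in> {0..T}. boundary_flux (\<phi> 0) (\<phi> 1) t \<noteq> 0}"
      show "t \<in> (\<Union>n. {t \<in> {0..T - T / real (n + 2)}. boundary_flux (\<phi> 0) (\<phi> 1) t \<noteq> 0}) \<union> {T}"
      proof (cases "t = T")
        case False
        then have "0 < (T - t) / T" using t T by auto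
        then obtain n :: nat where n: "inverse (real (Suc n)) < (T - t) / T" using reals_Archimedean by blast
        have "1 / real (n + 2) \<le> inverse (real (Suc n))" by (simp add: field_simps)
        then have "1 / real (n + 2) \<le> (T - t) / T" using n by linarith
        then have "T / real (n + 2) \<le> T - t" using T by (simp add: field_simps)
        then have "t \<in> {0..T - T / real (n + 2)}" using t by auto
        then show ?thesis using t by blast
      qed simp
    qed
  qed
  show "negligible {t \<in> {0..T}. boundary_flux 1 0 t \<noteq> 0}"
    using flux[OF \<phi>_prim(1) \<phi>_continuous(2)] by (simp add: \<phi>0_def)
  show "negligible {t \<in> {0..T}. boundary_flux 0 1 t \<noteq> 0}"
    using flux[OF \<phi>_prim(3) \<phi>_continuous(4)] by (simp add: \<phi>1_def)
qed

lemma uniqueness: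
  assumes init: "AE x in lebesgue_on {0<..<1}. y01 x = y02 x"
    and fin: "finite {t \<in> {0..T}. vl t = 0}" "finite {t \<in> {0..T}. vr t = 0}"
  shows "\<forall>t\<in>{0..T}. AE x in lebesgue_on {0<..<1}. y1 t x = y2 t x"
    "AE t in lebesgue_on {0..T}. yr1 t = yr2 t" "AE t in lebesgue_on {0..T}. yl1 t = yl2 t"
proof -
  note z = E_zero[OF init fin]
  show "\<forall>t\<in>{0..T}. AE x in lebesgue_on {0<..<1}. y1 t x = y2 t x"
  proof
    fix t assume t: "t \<in> {0..T}"
    have "negligible {x \<in> {0<..<1}. \<not> y1 t x = y2 t x}"
      by (rule negligible_subset[OF E_zero_imp(3)[OF t z[OF t]]]) (auto simp: g_def)
    then show "AE x in lebesgue_on {0<..<1}. y1 t x = y2 t x"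
      by (rule iffD2[OF negligible_iff_AE_lebesgue_on, rotated]) simp
  qed
  \<comment> \<open>The flux at the right end is \<open>(yr1 t - yr2 t) * vr t\<close>; outside the
    finite zero set of \<open>vr\<close> its vanishing gives equality of the data.\<close>
  have "negligible {t \<in> {0..T}. \<not> yr1 t = yr2 t}"
    by (rule negligible_subset[OF negligible_Un[OF boundary_flux_negligible(2)[OF z] negligible_finite[OF fin(2)]]])
      (auto simp: boundary_flux_def)
  then show "AE t in lebesgue_on {0..T}. yr1 t = yr2 t"
    by (rule iffD2[OF negligible_iff_AE_lebesgue_on, rotated]) simp
  have "negligible {t \<in> {0..T}. \<not> yl1 t = yl2 t}"
    by (rule negligible_subset[OF negligible_Un[OF boundary_flux_negligible(1)[OF z] negligible_finite[OF fin(1)]]])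
      (auto simp: boundary_flux_def)
  then show "AE t in lebesgue_on {0..T}. yl1 t = yl2 t"
    by (rule iffD2[OF negligible_iff_AE_lebesgue_on, rotated]) simp
qed

end

theorem theorem1p4:
  fixes T \<kappa> :: real
    and vl vr yrc ylc y01 y02 yr1 yl1 yr2 yl2 :: "real \<Rightarrow> real"
    and y1 y2 v1 v2 :: "real \<Rightarrow> real \<Rightarrow> real"
  assumes "T > 0"
    and "continuous_on {0..T} vl" and "continuous_on {0..T} vr"
    and "finite {t \<in> {0..T}. vl t = 0}" and "finite {t \<in> {0..T}. vr t = 0}"
    and "Linf {0<..<1} y01" and "Linf {0<..<1} y02"
    and "Linf (Gamma_l T vl) ylc" and "Linf (Gamma_r T vr) yrc"
    and "weak_solution T \<kappa> y01 vl vr yrc ylc y1 yr1 yl1"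
    and "weak_solution T \<kappa> y02 vl vr yrc ylc y2 yr2 yl2"
    and "is_velocity T \<kappa> vl vr y1 v1" and "is_velocity T \<kappa> vl vr y2 v2"
    and "sobolev_H1 {0<..<T} vl" and "sobolev_H1 {0<..<T} vr"
  shows "(\<exists>C>0. \<forall>T0 T1. 0 \<le> T0 \<and> T0 < T1 \<and> T1 \<le> T \<and>
            no_sign_change_on {T0..T1} vl \<and> no_sign_change_on {T0..T1} vr \<longrightarrow>
            (H1_norm {0<..<1} (\<lambda>x. v1 T1 x - v2 T1 x))\<^sup>2 \<le>
            ((H1_norm {0<..<1} (\<lambda>x. v1 T0 x - v2 T0 x))\<^sup>2
              + \<bar>dx (\<lambda>t x. v1 t x - v2 t x) T0 0\<bar>\<^sup>2
              + \<bar>dx (\<lambda>t x. v1 t x - v2 t x) T0 1\<bar>\<^sup>2) * exp (C * (T1 - T0)))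
       \<and> ((AE x in lebesgue_on {0<..<1}. y01 x = y02 x) \<longrightarrow>
            (\<forall>t\<in>{0..T}. AE x in lebesgue_on {0<..<1}. y1 t x = y2 t x) \<and>
            (AE t in lebesgue_on {0..T}. yr1 t = yr2 t) \<and>
            (AE t in lebesgue_on {0..T}. yl1 t = yl2 t))"
proof -
  interpret two_solutions T \<kappa> vl vr yrc ylc y01 y02 yr1 yl1 yr2 yl2 y1 y2 v1 v2
    by unfold_locales (fact assms)+
  obtain C where C: "C > 0" "\<And>T0 T1. 0 \<le> T0 \<Longrightarrow> T0 < T1 \<Longrightarrow> T1 \<le> T \<Longrightarrow> no_sign_change_on {T0..T1} vl \<Longrightarrow> no_sign_change_on {T0..T1} vr \<Longrightarrow>
      E T1 \<le> (E T0 + (p T0 0)\<^sup>2 + (p T0 1)\<^sup>2) * exp (C * (T1 - T0))"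
    using energy_estimate by blast
  show ?thesis
  proof (intro conjI impI exI[of _ C] allI C(1))
    fix T0 T1 assume a: "0 \<le> T0 \<and> T0 < T1 \<and> T1 \<le> T \<and> no_sign_change_on {T0..T1} vl \<and> no_sign_change_on {T0..T1} vr"
    then have t: "T0 \<in> {0..T}" "T1 \<in> {0..T}" by auto
    have z: "0 \<in> {0..1::real}" "1 \<in> {0..1::real}" by simp_all
    show "(H1_norm {0<..<1} (\<lambda>x. v1 T1 x - v2 T1 x))\<^sup>2 \<le>
            ((H1_norm {0<..<1} (\<lambda>x. v1 T0 x - v2 T0 x))\<^sup>2
              + \<bar>dx (\<lambda>t x. v1 t x - v2 t x) T0 0\<bar>\<^sup>2
              + \<bar>dx (\<lambda>t x. v1 t x - v2 t x) T0 1\<bar>\<^sup>2) * exp (C * (T1 - T0))"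
      unfolding E_eq_H1_norm[OF t(1)] E_eq_H1_norm[OF t(2)] dx_difference[OF t(1) z(1)] dx_difference[OF t(1) z(2)] power2_abs
      by (rule C(2)) (use a in simp_all)
  next
    assume i: "AE x in lebesgue_on {0<..<1}. y01 x = y02 x"
    note un = uniqueness[OF i assms(4,5)]
    show "\<forall>t\<in>{0..T}. AE x in lebesgue_on {0<..<1}. y1 t x = y2 t x" by (rule un(1))
    show "AE t in lebesgue_on {0..T}. yr1 t = yr2 t" by (rule un(2))
    show "AE t in lebesgue_on {0..T}. yl1 t = yl2 t" by (rule un(3))
  qed
qed

end
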